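(* Let $A$ be a separable, homogeneous, unital $\mathrm{C}^*$-algebra and let $S\subset A$ be an operator system such that $\mathrm{C}^*(S)=A$. Then the following statements are equivalent. (i) Every irreducible $*$-representation of $A$ is a boundary representation for $S$. (ii) The identity representation of $A$ has the strong Korovkin rigidity property with respect to $S$. (iii) Every unital $*$-representation $\pi:A\to\pi(A)$ has the strong Korovkin rigidity property with respect to $S$.
   Context: An operator system in a unital $\mathrm{C}^*$-algebra is a self-adjoint linear subspace containing the unit; $\mathrm{C}^*(S)$ is the $\mathrm{C}^*$-algebra generated by $S$. A $\mathrm{C}^*$-algebra is homogeneous if all its irreducible $*$-representations have the same finite dimension. A unital $*$-representation $\rho:A\to B(L)$ has the unique extension property with respect to $S$ if the only unital completely positive map $\psi:A\to B(L)$ with $\psi|_S=\rho|_S$ is $\psi=\rho$. An irreducible $*$-representation with this property is called a boundary representation for $S$. A unital $*$-representation $\pi$ of $A$ has the strong Korovkin rigidity property with respect to $S$ if, whenever $\varphi_\lambda:A\to\pi(A)$ is a net of unital completely positive maps with $\lim_\lambda\|\varphi_\lambda(s)-\pi(s)\|=0$ for every $s\in S$, it follows that $\lim_\lambda\|\varphi_\lambda(a)-\pi(a)\|=0$ for every $a\in A$. For the identity representation one takes $\pi=\mathrm{id}:A\to A$ and $\pi(A)=A$. *)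

theory Defs
  imports "HOL-Analysis.Analysis"
begin

section \<open>Complex normed spaces, Hilbert spaces and C*-algebras\<close>

class scaleC =
  fixes scaleC :: "complex \<Rightarrow> 'a \<Rightarrow> 'a" (infixr \<open>*\<^sub>C\<close> 75)

class complex_normed_vector = real_normed_vector + scaleC +
  assumes scaleC_add_right: "c *\<^sub>C (x + y) = c *\<^sub>C x + c *\<^sub>C y"
    and scaleC_add_left: "(c + d) *\<^sub>C x = c *\<^sub>C x + d *\<^sub>C x"
    and scaleC_scaleC: "c *\<^sub>C d *\<^sub>C x = (c * d) *\<^sub>C x"
    and scaleR_scaleC: "r *\<^sub>R x = complex_of_real r *\<^sub>C x"
    and norm_scaleC: "norm (c *\<^sub>C x) = cmod c * norm x"

lemma scaleC_one: "1 *\<^sub>C x = (x :: 'a::complex_normed_vector)"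
  using scaleR_scaleC[of 1 x] by simp

global_interpretation complex_vector:
  vector_space "scaleC :: complex \<Rightarrow> 'a \<Rightarrow> 'a::complex_normed_vector"
  defines csubspace = complex_vector.subspace
    and cspan = complex_vector.span
    and cdependent = complex_vector.dependent
  by unfold_locales
    (simp_all add: scaleC_add_right scaleC_add_left scaleC_scaleC scaleC_one)

abbreviation clinear :: "('a::complex_normed_vector \<Rightarrow> 'b::complex_normed_vector) \<Rightarrow> bool"
  where "clinear \<equiv> Vector_Spaces.linear (*\<^sub>C) (*\<^sub>C)"

text \<open>The inner product is conjugate-linear in the first and linear in the second argument.\<close>

class chilbert_space = complex_normed_vector + banach +
  fixes cinner :: "'a \<Rightarrow> 'a \<Rightarrow> complex"
  assumes cinner_commute: "cinner x y = cnj (cinner y x)"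
    and cinner_add_right: "cinner x (y + z) = cinner x y + cinner x z"
    and cinner_scaleC_right: "cinner x (c *\<^sub>C y) = c * cinner x y"
    and cinner_self: "cinner x x = complex_of_real ((norm x)\<^sup>2)"

class cstar_algebra = complex_normed_vector + real_normed_algebra_1 + banach +
  fixes star :: "'a \<Rightarrow> 'a"
  assumes mult_scaleC_left: "(c *\<^sub>C x) * y = c *\<^sub>C (x * y)"
    and mult_scaleC_right: "x * (c *\<^sub>C y) = c *\<^sub>C (x * y)"
    and star_star: "star (star x) = x"
    and star_add: "star (x + y) = star x + star y"
    and star_scaleC: "star (c *\<^sub>C x) = cnj c *\<^sub>C star x"
    and star_mult: "star (x * y) = star y * star x"
    and norm_star_mult: "norm (star x * x) = (norm x)\<^sup>2"

instantiation complex :: "{chilbert_space, cstar_algebra}"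
begin

definition scaleC_complex :: "complex \<Rightarrow> complex \<Rightarrow> complex"
  where "scaleC_complex c x = c * x"

definition cinner_complex :: "complex \<Rightarrow> complex \<Rightarrow> complex"
  where "cinner_complex x y = cnj x * y"

definition star_complex :: "complex \<Rightarrow> complex"
  where "star_complex x = cnj x"

instance
proof
  fix x :: complex
  show "cinner x x = complex_of_real ((norm x)\<^sup>2)"
    by (metis cinner_complex_def complex_norm_square mult.commute of_real_power)
  show "norm (star x * x) = (norm x)\<^sup>2"
    by (simp add: star_complex_def norm_mult power2_eq_square)
qed (simp_all add: scaleC_complex_def cinner_complex_def star_complex_def
      algebra_simps norm_mult scaleR_conv_of_real)

end

instantiation blinfun :: (real_normed_vector, complex_normed_vector) complex_normed_vector
begin

definition scaleC_blinfun :: "complex \<Rightarrow> 'a \<Rightarrow>\<^sub>L 'b \<Rightarrow> 'a \<Rightarrow>\<^sub>L 'b"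
  where "scaleC_blinfun c T = Blinfun (\<lambda>x. c *\<^sub>C blinfun_apply T x)"

lemma scaleC_blinfun_apply: "blinfun_apply (c *\<^sub>C T) x = c *\<^sub>C blinfun_apply T x"
  for T :: "'a \<Rightarrow>\<^sub>L 'b"
proof -
  have "bounded_linear (\<lambda>x. c *\<^sub>C blinfun_apply T x)"
  proof (rule bounded_linear_intro[where K = "cmod c * norm T"])
    fix x y r
    show "c *\<^sub>C blinfun_apply T (x + y) = c *\<^sub>C blinfun_apply T x + c *\<^sub>C blinfun_apply T y"
      by (simp add: blinfun.add_right scaleC_add_right)
    show "c *\<^sub>C blinfun_apply T (r *\<^sub>R x) = r *\<^sub>R (c *\<^sub>C blinfun_apply T x)"
      by (simp add: blinfun.scaleR_right scaleR_scaleC scaleC_scaleC mult.commute)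
    show "norm (c *\<^sub>C blinfun_apply T x) \<le> norm x * (cmod c * norm T)"
      using mult_left_mono[OF norm_blinfun[of T x] norm_ge_zero[of c]]
      by (simp add: norm_scaleC mult.commute mult.left_commute)
  qed
  then show ?thesis
    by (simp add: scaleC_blinfun_def bounded_linear_Blinfun_apply)
qed

instance
proof
  fix c d :: complex and r :: real and S T :: "'a \<Rightarrow>\<^sub>L 'b"
  show "c *\<^sub>C (S + T) = c *\<^sub>C S + c *\<^sub>C T"
    by (rule blinfun_eqI) (simp add: scaleC_blinfun_apply blinfun.add_left scaleC_add_right)
  show "(c + d) *\<^sub>C T = c *\<^sub>C T + d *\<^sub>C T"
    by (rule blinfun_eqI) (simp add: scaleC_blinfun_apply blinfun.add_left scaleC_add_left)
  show "c *\<^sub>C d *\<^sub>C T = (c * d) *\<^sub>C T"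
    by (rule blinfun_eqI) (simp add: scaleC_blinfun_apply scaleC_scaleC)
  show "r *\<^sub>R T = complex_of_real r *\<^sub>C T"
    by (rule blinfun_eqI) (simp add: scaleC_blinfun_apply blinfun.scaleR_left scaleR_scaleC)
  have le: "norm (c *\<^sub>C T) \<le> cmod c * norm T" for c and T :: "'a \<Rightarrow>\<^sub>L 'b"
    using mult_left_mono[OF norm_blinfun[of T] norm_ge_zero[of c]]
    by (intro norm_blinfun_bound) (simp_all add: scaleC_blinfun_apply norm_scaleC mult.assoc)
  show "norm (c *\<^sub>C T) = cmod c * norm T"
  proof (cases "c = 0")
    case True
    then show ?thesis using le[of c T] by simp
  next
    case False
    have "inverse c *\<^sub>C c *\<^sub>C T = T"
      using False by (intro blinfun_eqI) (simp add: scaleC_blinfun_apply scaleC_scaleC scaleC_one)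
    then have "norm T \<le> inverse (cmod c) * norm (c *\<^sub>C T)"
      using le[of "inverse c" "c *\<^sub>C T"] by (simp add: norm_inverse)
    then have "cmod c * norm T \<le> norm (c *\<^sub>C T)"
      using False by (simp add: field_simps)
    then show ?thesis using le[of c T] by simp
  qed
qed

end


section \<open>Operator systems\<close>

definition operator_system :: "'a::cstar_algebra set \<Rightarrow> bool"
  where "operator_system S \<longleftrightarrow> csubspace S \<and> star ` S \<subseteq> S \<and> 1 \<in> S"

definition cstar_subalgebra :: "'a::cstar_algebra set \<Rightarrow> bool"
  where "cstar_subalgebra B \<longleftrightarrow>
    csubspace B \<and> closed B \<and> (\<forall>x\<in>B. \<forall>y\<in>B. x * y \<in> B) \<and> star ` B \<subseteq> B"

abbreviation generated_cstar_algebra :: "'a::cstar_algebra set \<Rightarrow> 'a set"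
  where "generated_cstar_algebra S \<equiv> cstar_subalgebra hull S"


section \<open>Concrete *-algebras and completely positive maps\<close>

text \<open>
  The linear structure and the norm of a concrete *-algebra are those of the ambient type.
  The record makes it possible to treat an abstract C*-algebra, the algebra \<open>B(L)\<close> and the image of
  a representation alike.
\<close>

record 'b star_algebra =
  carrier :: "'b set"
  product :: "'b \<Rightarrow> 'b \<Rightarrow> 'b"
  involution :: "'b \<Rightarrow> 'b"

definition full_algebra :: "'a::cstar_algebra star_algebra"
  where "full_algebra = \<lparr>carrier = UNIV, product = (*), involution = star\<rparr>"

text \<open>
  An \<open>n \<times> n\<close> matrix over \<open>B\<close> is a function of two indices, of which only the values at indices
  below \<open>n\<close> matter; it is positive if it is of the form \<open>z\<^sup>* z\<close> with \<open>z\<close> in the matrix algebra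
  \<open>M\<^sub>n(B)\<close>.
\<close>

definition positive_matrix ::
    "'b::comm_monoid_add star_algebra \<Rightarrow> nat \<Rightarrow> (nat \<Rightarrow> nat \<Rightarrow> 'b) \<Rightarrow> bool"
  where "positive_matrix B n x \<longleftrightarrow>
    (\<exists>z. (\<forall>i<n. \<forall>j<n. z i j \<in> carrier B) \<and>
         (\<forall>i<n. \<forall>j<n. x i j = (\<Sum>k<n. product B (involution B (z k i)) (z k j))))"

definition completely_positive ::
    "'b star_algebra \<Rightarrow> ('a::cstar_algebra \<Rightarrow> 'b::complex_normed_vector) \<Rightarrow> bool"
  where "completely_positive B \<phi> \<longleftrightarrow>
    clinear \<phi> \<and> range \<phi> \<subseteq> carrier B \<and>
    (\<forall>n x. positive_matrix full_algebra n x \<longrightarrow> positive_matrix B n (\<lambda>i j. \<phi> (x i j)))"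

definition ucp :: "'b star_algebra \<Rightarrow> ('a::cstar_algebra \<Rightarrow> 'b::complex_normed_vector) \<Rightarrow> bool"
  where "ucp B \<phi> \<longleftrightarrow>
    completely_positive B \<phi> \<and> (\<forall>b\<in>carrier B. product B (\<phi> 1) b = b \<and> product B b (\<phi> 1) = b)"


section \<open>Representations\<close>

text \<open>
  Hilbert spaces are closed subspaces \<open>L\<close> of an ambient Hilbert space, given by a type \<open>'h\<close>;
  every Hilbert space is of this form for a suitable \<open>'h\<close>, and a separable one is, up to unitary
  equivalence, of this form for every infinite-dimensional \<open>'h\<close>.
  An operator on \<open>L\<close> is identified with its extension by zero on the orthogonal complement
  of \<open>L\<close>. This identification preserves norms, products and adjoints, and the unit of \<open>B(L)\<close>
  becomes the orthogonal projection onto \<open>L\<close>. The elements of \<open>'h \<Rightarrow>\<^sub>L 'h\<close> are real-linear,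
  so complex linearity is required separately.
\<close>

definition closed_csubspace :: "'h::chilbert_space set \<Rightarrow> bool"
  where "closed_csubspace L \<longleftrightarrow> csubspace L \<and> closed L"

definition adjoint_op :: "('h \<Rightarrow>\<^sub>L 'h) \<Rightarrow> ('h::chilbert_space \<Rightarrow>\<^sub>L 'h)"
  where "adjoint_op T =
    (THE T'. \<forall>x y. cinner (blinfun_apply T x) y = cinner x (blinfun_apply T' y))"

definition bounded_operators :: "'h::chilbert_space set \<Rightarrow> ('h \<Rightarrow>\<^sub>L 'h) star_algebra"
  where "bounded_operators L =
    \<lparr>carrier = {T. clinear (blinfun_apply T) \<and> range (blinfun_apply T) \<subseteq> L \<and>
                   (\<forall>x. (\<forall>y\<in>L. cinner y x = 0) \<longrightarrow> blinfun_apply T x = 0)},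
     product = (o\<^sub>L),
     involution = adjoint_op\<rparr>"

definition unital_representation ::
    "'h::chilbert_space set \<Rightarrow> ('a::cstar_algebra \<Rightarrow> 'h \<Rightarrow>\<^sub>L 'h) \<Rightarrow> bool"
  where "unital_representation L \<pi> \<longleftrightarrow>
    closed_csubspace L \<and> range \<pi> \<subseteq> carrier (bounded_operators L) \<and> clinear \<pi> \<and>
    (\<forall>a b. \<pi> (a * b) = \<pi> a o\<^sub>L \<pi> b) \<and> (\<forall>a. \<pi> (star a) = adjoint_op (\<pi> a)) \<and>
    (\<forall>x\<in>L. blinfun_apply (\<pi> 1) x = x)"

text \<open>
  An irreducible representation is unital as soon as it is nonzero; the zero representation on a
  one-dimensional space is not counted as irreducible.
\<close>

definition irreducible_representation ::
    "'h::chilbert_space set \<Rightarrow> ('a::cstar_algebra \<Rightarrow> 'h \<Rightarrow>\<^sub>L 'h) \<Rightarrow> bool"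
  where "irreducible_representation L \<pi> \<longleftrightarrow>
    unital_representation L \<pi> \<and> L \<noteq> {0} \<and>
    (\<forall>K. closed_csubspace K \<and> K \<subseteq> L \<and> (\<forall>a. blinfun_apply (\<pi> a) ` K \<subseteq> K) \<longrightarrow> K = {0} \<or> K = L)"

definition has_cdim :: "'h::complex_normed_vector set \<Rightarrow> nat \<Rightarrow> bool"
  where "has_cdim L n \<longleftrightarrow> (\<exists>B. finite B \<and> card B = n \<and> \<not> cdependent B \<and> cspan B = L)"

definition infinite_cdim :: "'h::complex_normed_vector itself \<Rightarrow> bool"
  where "infinite_cdim _ \<longleftrightarrow> \<not> (\<exists>n. has_cdim (UNIV :: 'h set) n)"

definition homogeneous :: "'a::cstar_algebra itself \<Rightarrow> 'h::chilbert_space itself \<Rightarrow> bool"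
  where "homogeneous _ _ \<longleftrightarrow>
    (\<exists>n. \<forall>(L :: 'h set) (\<pi> :: 'a \<Rightarrow> 'h \<Rightarrow>\<^sub>L 'h). irreducible_representation L \<pi> \<longrightarrow> has_cdim L n)"

definition unique_extension_property ::
    "'a::cstar_algebra set \<Rightarrow> 'h::chilbert_space set \<Rightarrow> ('a \<Rightarrow> 'h \<Rightarrow>\<^sub>L 'h) \<Rightarrow> bool"
  where "unique_extension_property S L \<rho> \<longleftrightarrow>
    (\<forall>\<psi>. ucp (bounded_operators L) \<psi> \<and> (\<forall>s\<in>S. \<psi> s = \<rho> s) \<longrightarrow> \<psi> = \<rho>)"

definition boundary_representation ::
    "'a::cstar_algebra set \<Rightarrow> 'h::chilbert_space set \<Rightarrow> ('a \<Rightarrow> 'h \<Rightarrow>\<^sub>L 'h) \<Rightarrow> bool"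
  where "boundary_representation S L \<rho> \<longleftrightarrow>
    irreducible_representation L \<rho> \<and> unique_extension_property S L \<rho>"


section \<open>Strong Korovkin rigidity\<close>

definition directed_on :: "'i set \<Rightarrow> ('i \<times> 'i) set \<Rightarrow> bool"
  where "directed_on D r \<longleftrightarrow>
    D \<noteq> {} \<and> preorder_on D r \<and> (\<forall>d\<in>D. \<forall>e\<in>D. \<exists>f\<in>D. (d, f) \<in> r \<and> (e, f) \<in> r)"

text \<open>The filter of tails; convergence of a net indexed by \<open>D\<close> is convergence along it.\<close>

definition net_filter :: "'i set \<Rightarrow> ('i \<times> 'i) set \<Rightarrow> 'i filter"
  where "net_filter D r = (INF d\<in>D. principal {e. (d, e) \<in> r})"

text \<open>
  Here \<open>\<pi>\<close> is a representation with values in \<open>B\<close>, and \<open>B\<lparr>carrier := range \<pi>\<rparr>\<close> is its image.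
  Nets are indexed by the directed subsets of the type \<open>'i\<close>.
\<close>

definition strong_korovkin ::
    "'i itself \<Rightarrow> 'b star_algebra \<Rightarrow> 'a::cstar_algebra set \<Rightarrow>
     ('a \<Rightarrow> 'b::complex_normed_vector) \<Rightarrow> bool"
  where "strong_korovkin _ B S \<pi> \<longleftrightarrow>
    (\<forall>(D :: 'i set) r \<phi>.
       directed_on D r \<and> (\<forall>d\<in>D. ucp (B\<lparr>carrier := range \<pi>\<rparr>) (\<phi> d)) \<and>
       (\<forall>s\<in>S. ((\<lambda>d. norm (\<phi> d s - \<pi> s)) \<longlongrightarrow> 0) (net_filter D r)) \<longrightarrow>
       (\<forall>a. ((\<lambda>d. norm (\<phi> d a - \<pi> a)) \<longlongrightarrow> 0) (net_filter D r)))"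

lemma eventually_net_filter:
  assumes "directed_on D r"
  shows "eventually P (net_filter D r) \<longleftrightarrow> (\<exists>d\<in>D. \<forall>e\<in>D. (d, e) \<in> r \<longrightarrow> P e)"
proof -
  have D: "D \<noteq> {}" "r \<subseteq> D \<times> D" "trans r"
    and dir: "\<And>d e. d \<in> D \<Longrightarrow> e \<in> D \<Longrightarrow> \<exists>f\<in>D. (d, f) \<in> r \<and> (e, f) \<in> r"
    using assms by (auto simp: directed_on_def preorder_on_def)
  have "eventually P (net_filter D r) \<longleftrightarrow>
      (\<exists>d\<in>D. eventually P (principal {e. (d, e) \<in> r}))"
    unfolding net_filter_def
  proof (rule eventually_INF_base)
    fix d e assume "d \<in> D" "e \<in> D"
    then obtain f where "f \<in> D" "(d, f) \<in> r" "(e, f) \<in> r" using dir by blast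
    then show "\<exists>x\<in>D. principal {e. (x, e) \<in> r} \<le>
        inf (principal {e. (d, e) \<in> r}) (principal {ea. (e, ea) \<in> r})"
      using D(3) by (intro bexI[of _ f]) (auto dest: transD)
  qed (use D in auto)
  then show ?thesis
    using D(2) by (auto simp: eventually_principal)
qed

end

theory Submission
  imports Defs "HOL-Computational_Algebra.Fundamental_Theorem_Algebra"
begin

text \<open>
  Let \<open>q x = norm (\<theta> x)\<close>, where \<open>\<theta>\<close> is the identity or a representation.

  \<^emph>\<open>Boundary representations give rigidity.\<close> Every value \<open>q b\<close> is attained: there are an irreducible
  representation \<open>\<sigma>\<close> with \<open>norm (\<sigma> x) \<le> q x\<close> and a unit vector \<open>\<xi>\<close> with \<open>norm (\<sigma> b \<xi>) = q b\<close>
  (\<open>irreducible_representation_attains\<close>). If a net of unital completely positive maps \<open>\<phi> d\<close> converges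
  to \<open>\<theta>\<close> on \<open>S\<close> but not at \<open>a\<close>, choose for each \<open>d\<close> such a representation for the difference
  \<open>\<phi> d a - \<theta> a\<close>. By homogeneity these representations, and their compositions with \<open>\<phi> d\<close>, take values
  in the \<open>n \<times> n\<close> matrices for one fixed \<open>n\<close>. Tychonoff's theorem yields limits \<open>\<rho>\<close> and \<open>\<Psi>\<close> along a
  refinement of the net. Here \<open>\<rho>\<close> is a representation, again irreducible by homogeneity, while \<open>\<Psi>\<close> is
  unital and completely positive, agrees with \<open>\<rho>\<close> on \<open>S\<close> and differs from \<open>\<rho>\<close> at \<open>a\<close>; so \<open>\<rho>\<close> is not
  a boundary representation (\<open>strong_korovkin_of_boundary\<close>).

  \<^emph>\<open>Rigidity of the identity gives boundary representations.\<close> Let \<open>\<psi>\<close> be unital and completely positive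
  with \<open>\<psi> = \<pi>\<close> on \<open>S\<close>, where \<open>\<pi>\<close> is irreducible. Burnside's theorem gives lifts \<open>m k\<close> of the matrix
  units \<open>E\<^sub>0\<^sub>k\<close>. Let \<open>r N\<close> be positive contractions that lift the unit and annihilate, in the limit, a
  suitable part of the kernel of \<open>\<pi>\<close> (\<open>approximate_unit_sequence\<close>). The maps
  \<open>\<Psi> N x = \<lambda> \<Sum>\<^sub>a\<^sub>d \<psi>(x)\<^sub>a\<^sub>d (r m\<^sub>a)\<^sup>* (r m\<^sub>d)\<close> lift \<open>\<lambda> \<psi>\<close>, and on \<open>S\<close> they are almost \<open>x \<mapsto> c x\<close>, where
  \<open>c = \<Psi> N 1\<close>; as \<open>S\<close> is self-adjoint, \<open>c\<close> then asymptotically commutes with \<open>S\<close>. Hence the unital completely positive maps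
  \<open>x \<mapsto> (1 - c)\<^sup>1\<^sup>/\<^sup>2 x (1 - c)\<^sup>1\<^sup>/\<^sup>2 + \<Psi> N x\<close> converge to the identity on \<open>S\<close>, so by rigidity everywhere. But they
  lift \<open>(1 - \<lambda>) \<pi> + \<lambda> \<psi>\<close>, and \<open>\<psi> = \<pi>\<close> follows (\<open>unique_extension_of_strong_korovkin\<close>).

  \<^emph>\<open>Rigidity of an irreducible representation\<close> \<open>\<pi>\<close> gives uniqueness at once: its range is all of \<open>B(L)\<close>
  (\<open>irreducible_range\<close>), so an extension \<open>\<psi>\<close> of \<open>\<pi>\<close> restricted to \<open>S\<close> is a constant net to which rigidity
  applies.

  The square root of a positive element is a power series. Pure states are obtained by maximising
  successively over a dense sequence (\<open>extreme_functional_exists\<close>), which in a separable algebra does the work of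
  the theorems of Hahn--Banach and Krein--Milman.
\<close>

section \<open>The square root series\<close>

text \<open>The coefficients of the power series of \<open>(1 - x)\<^sup>1\<^sup>/\<^sup>2\<close>.\<close>

definition sqrt_coeff :: "nat \<Rightarrow> real"
  where "sqrt_coeff m = pochhammer (- 1 / 2) m / fact m"

lemma sqrt_coeff_gbinomial: "sqrt_coeff m = (- 1) ^ m * ((1 / 2) gchoose m)"
  by (simp add: sqrt_coeff_def gbinomial_pochhammer)

lemma sqrt_coeff_0: "sqrt_coeff 0 = 1"
  by (simp add: sqrt_coeff_def)

lemma sqrt_coeff_nonpos:
  assumes "m > 0"
  shows "sqrt_coeff m \<le> 0"
proof -
  obtain k where "m = Suc k" using assms gr0_implies_Suc by blast
  then show ?thesis
    by (simp add: sqrt_coeff_def pochhammer_rec divide_nonpos_pos pochhammer_nonneg)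
qed

lemma sqrt_coeff_convolution:
  "(\<Sum>k\<le>m. sqrt_coeff k * sqrt_coeff (m - k)) = (if m = 0 then 1 else if m = 1 then - 1 else 0)"
proof -
  have "(\<Sum>k\<le>m. sqrt_coeff k * sqrt_coeff (m - k))
      = (\<Sum>k\<le>m. (- 1) ^ m * (((1 / 2) gchoose k) * ((1 / 2) gchoose (m - k))))"
    by (intro sum.cong) (auto simp: sqrt_coeff_gbinomial simp flip: power_add)
  also have "\<dots> = (- 1) ^ m * ((1::real) gchoose m)"
    using gbinomial_Vandermonde[of "1/2::real" "1/2" m]
    by (simp add: sum_distrib_left[symmetric] atMost_atLeast0)
  also have "(1::real) gchoose m = of_nat (1 choose m)"
    by (metis binomial_gbinomial of_nat_1)
  also have "(- 1) ^ m * (of_nat (1 choose m)::real) = (if m = 0 then 1 else if m = 1 then - 1 else 0)"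
    by (cases m) (auto simp: binomial_eq_0)
  finally show ?thesis .
qed

text \<open>The sum of the first \<open>N + 1\<close> coefficients is, up to the sign \<open>(-1)\<^sup>N\<close>, the binomial coefficient of
  \<open>- 1/2\<close> over \<open>N\<close>, and so it is nonnegative. As only the coefficient of index \<open>0\<close> is positive, the others cannot
  exceed it in total. Therefore the series converges up to the boundary of the unit ball.\<close>

lemma sqrt_coeff_partial_sum: "(\<Sum>m\<in>{1..N}. \<bar>sqrt_coeff m\<bar>) \<le> 1"
proof -
  have "(\<Sum>k\<le>N. sqrt_coeff k) = (- 1) ^ N * ((- 1 / 2) gchoose N)"
    using gbinomial_sum_lower_neg[of "1/2::real" N]
    by (simp add: sqrt_coeff_gbinomial mult.commute)
  also have "\<dots> = pochhammer (1 / 2) N / fact N"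
    by (simp add: gbinomial_pochhammer)
  also have "\<dots> \<ge> 0"
    by (simp add: pochhammer_nonneg)
  finally have 1: "(\<Sum>k\<le>N. sqrt_coeff k) \<ge> 0" .
  have "(\<Sum>k\<le>N. sqrt_coeff k) = sqrt_coeff 0 + (\<Sum>k\<in>{1..N}. sqrt_coeff k)"
    by (simp add: atMost_atLeast0 sum.atLeast_Suc_atMost)
  moreover have "(\<Sum>k\<in>{1..N}. sqrt_coeff k) = - (\<Sum>m\<in>{1..N}. \<bar>sqrt_coeff m\<bar>)"
    unfolding sum_negf[symmetric] using sqrt_coeff_nonpos by (intro sum.cong) force+
  ultimately show ?thesis using 1 by (simp add: sqrt_coeff_0)
qed

lemma sqrt_coeff_abs_summable: "summable (\<lambda>m. \<bar>sqrt_coeff m\<bar>)"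
proof (rule bounded_imp_summable)
  fix N
  have "(\<Sum>k\<le>N. \<bar>sqrt_coeff k\<bar>) = \<bar>sqrt_coeff 0\<bar> + (\<Sum>k\<in>{1..N}. \<bar>sqrt_coeff k\<bar>)"
    by (simp add: atMost_atLeast0 sum.atLeast_Suc_atMost)
  then show "(\<Sum>k\<le>N. \<bar>sqrt_coeff k\<bar>) \<le> 2"
    using sqrt_coeff_partial_sum[of N] by (simp add: sqrt_coeff_0)
qed auto

lemma sqrt_coeff_tail_suminf: "(\<Sum>m. \<bar>sqrt_coeff (Suc m)\<bar>) \<le> 1"
proof (rule suminf_le_const)
  show "summable (\<lambda>m. \<bar>sqrt_coeff (Suc m)\<bar>)"
    using sqrt_coeff_abs_summable summable_Suc_iff[of "\<lambda>m. \<bar>sqrt_coeff m\<bar>"] by simp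
  fix n
  have "(\<Sum>m<n. \<bar>sqrt_coeff (Suc m)\<bar>) = (\<Sum>m\<in>{1..n}. \<bar>sqrt_coeff m\<bar>)"
    by (simp add: sum.atLeast1_atMost_eq)
  then show "(\<Sum>m<n. \<bar>sqrt_coeff (Suc m)\<bar>) \<le> 1"
    using sqrt_coeff_partial_sum[of n] by simp
qed

definition sqrt_one_minus :: "'a::{real_normed_algebra_1, banach} \<Rightarrow> 'a"
  where "sqrt_one_minus x = (\<Sum>m. sqrt_coeff m *\<^sub>R x ^ m)"

context
  fixes x :: "'a::{real_normed_algebra_1, banach}"
  assumes le1: "norm x \<le> 1"
begin

lemma sqrt_one_minus_abs_summable: "summable (\<lambda>m. norm (sqrt_coeff m *\<^sub>R x ^ m))"
proof (rule summable_comparison_test'[OF sqrt_coeff_abs_summable])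
  fix m
  have "norm (x ^ m) \<le> 1"
    using norm_power_ineq[of x m] power_le_one[OF norm_ge_zero le1, of m] by linarith
  then show "norm (norm (sqrt_coeff m *\<^sub>R x ^ m)) \<le> \<bar>sqrt_coeff m\<bar>"
    by (simp add: mult_left_le)
qed

lemma sqrt_one_minus_sums: "(\<lambda>m. sqrt_coeff m *\<^sub>R x ^ m) sums sqrt_one_minus x"
  unfolding sqrt_one_minus_def
  by (rule summable_sums[OF summable_norm_cancel[OF sqrt_one_minus_abs_summable]])

lemma sqrt_one_minus_square: "sqrt_one_minus x * sqrt_one_minus x = 1 - x"
proof -
  have "(\<lambda>k. \<Sum>i\<le>k. (sqrt_coeff i *\<^sub>R x ^ i) * (sqrt_coeff (k - i) *\<^sub>R x ^ (k - i)))
      sums (sqrt_one_minus x * sqrt_one_minus x)"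
    unfolding sqrt_one_minus_def
    by (rule Cauchy_product_sums[OF sqrt_one_minus_abs_summable sqrt_one_minus_abs_summable])
  also have "(\<lambda>k. \<Sum>i\<le>k. (sqrt_coeff i *\<^sub>R x ^ i) * (sqrt_coeff (k - i) *\<^sub>R x ^ (k - i)))
      = (\<lambda>k. (\<Sum>i\<le>k. sqrt_coeff i * sqrt_coeff (k - i)) *\<^sub>R x ^ k)"
    by (simp add: scaleR_sum_left power_add[symmetric] mult.commute)
  also have "\<dots> = (\<lambda>k. if k \<in> {0,1} then (if k = 0 then 1 else - x) else 0)"
    by (auto simp: sqrt_coeff_convolution)
  finally have 1: "(\<lambda>k. if k \<in> {0,1::nat} then (if k = 0 then 1 else - x) else 0)
      sums (sqrt_one_minus x * sqrt_one_minus x)" .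
  have "(\<lambda>k. if k \<in> {0,1::nat} then (if k = 0 then 1 else - x) else 0)
      sums (\<Sum>k\<in>{0,1::nat}. if k = 0 then 1 else - x)"
    by (rule sums_If_finite_set) simp
  from sums_unique2[OF 1 this] show ?thesis by simp
qed

lemma sqrt_one_minus_commute:
  assumes "z * x = x * z"
  shows "z * sqrt_one_minus x = sqrt_one_minus x * z"
proof -
  have "z * x ^ m = x ^ m * z" for m
    by (induction m) (simp_all add: assms mult.assoc[symmetric], metis assms mult.assoc)
  then have "(\<lambda>m. z * (sqrt_coeff m *\<^sub>R x ^ m)) = (\<lambda>m. (sqrt_coeff m *\<^sub>R x ^ m) * z)"
    by simp
  moreover have "(\<lambda>m. z * (sqrt_coeff m *\<^sub>R x ^ m)) sums (z * sqrt_one_minus x)"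
    by (intro sums_mult sqrt_one_minus_sums)
  moreover have "(\<lambda>m. (sqrt_coeff m *\<^sub>R x ^ m) * z) sums (sqrt_one_minus x * z)"
    by (intro sums_mult2 sqrt_one_minus_sums)
  ultimately show ?thesis by (metis sums_unique2)
qed

lemma norm_one_minus_sqrt_le: "norm (1 - sqrt_one_minus x) \<le> norm x"
proof -
  have s: "(\<lambda>m. sqrt_coeff (Suc m) *\<^sub>R x ^ Suc m) sums (sqrt_one_minus x - 1)"
    using sums_split_initial_segment[OF sqrt_one_minus_sums, of 1] by (simp add: sqrt_coeff_0)
  have sS: "summable (\<lambda>m. norm (sqrt_coeff (Suc m) *\<^sub>R x ^ Suc m))"
    using sqrt_one_minus_abs_summable
      summable_Suc_iff[of "\<lambda>m. norm (sqrt_coeff m *\<^sub>R x ^ m)"] by simp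
  have sC: "summable (\<lambda>m. \<bar>sqrt_coeff (Suc m)\<bar>)"
    using sqrt_coeff_abs_summable summable_Suc_iff[of "\<lambda>m. \<bar>sqrt_coeff m\<bar>"] by simp
  have "norm (sqrt_one_minus x - 1) \<le> (\<Sum>m. norm (sqrt_coeff (Suc m) *\<^sub>R x ^ Suc m))"
    using summable_norm[OF sS] sums_unique[OF s] by simp
  also have "\<dots> \<le> (\<Sum>m. \<bar>sqrt_coeff (Suc m)\<bar> * norm x)"
  proof (rule suminf_le[OF _ sS])
    show "summable (\<lambda>m. \<bar>sqrt_coeff (Suc m)\<bar> * norm x)"
      using sC by (rule summable_mult2)
    fix m
    have "norm (x ^ Suc m) \<le> norm x ^ Suc m" by (rule norm_power_ineq)
    also have "\<dots> \<le> norm x"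
      using mult_left_le[OF power_le_one[OF norm_ge_zero le1, of m] norm_ge_zero[of x]] by simp
    finally show "norm (sqrt_coeff (Suc m) *\<^sub>R x ^ Suc m) \<le> \<bar>sqrt_coeff (Suc m)\<bar> * norm x"
      by (simp add: mult_left_mono del: power_Suc)
  qed
  also have "\<dots> = (\<Sum>m. \<bar>sqrt_coeff (Suc m)\<bar>) * norm x"
    using suminf_mult2[OF sC] by simp
  also have "\<dots> \<le> norm x"
    using mult_right_mono[OF sqrt_coeff_tail_suminf norm_ge_zero[of x]] by simp
  finally show ?thesis by (simp add: norm_minus_commute)
qed

end

section \<open>Positive elements of a C*-algebra\<close>

lemma scaleC_zero_right [simp]: "c *\<^sub>C (0::'a::complex_normed_vector) = 0"
  by (rule complex_vector.scale_zero_right)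

lemma scaleC_of_real: "complex_of_real r *\<^sub>C x = r *\<^sub>R (x :: 'a::complex_normed_vector)"
  by (simp add: scaleR_scaleC)

lemma bounded_linear_scaleC: "bounded_linear (\<lambda>x :: 'a::complex_normed_vector. c *\<^sub>C x)"
  by (rule bounded_linear_intro[where K = "cmod c"])
     (auto simp: scaleC_add_right scaleR_scaleC scaleC_scaleC mult.commute norm_scaleC)

lemma star_zero [simp]: "star (0::'a::cstar_algebra) = 0"
  using star_add[of "0::'a" 0] by simp

lemma star_minus: "star (- x) = - star (x::'a::cstar_algebra)"
  using star_add[of x "- x"] by (simp add: add_eq_0_iff2 minus_equation_iff)

lemma star_diff: "star (x - y) = star x - star (y::'a::cstar_algebra)"
  using star_add[of x "- y"] by (simp add: star_minus)

lemma star_one [simp]: "star (1::'a::cstar_algebra) = 1"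
  by (metis mult.left_neutral mult.right_neutral star_mult star_star)

lemma star_scaleR: "star (r *\<^sub>R x) = r *\<^sub>R star (x::'a::cstar_algebra)"
  by (simp add: scaleR_scaleC star_scaleC)

lemma star_power: "star (x ^ m) = star (x::'a::cstar_algebra) ^ m"
  by (induction m) (simp_all add: star_mult power_commutes)

lemma star_sum: "star (\<Sum>i\<in>I. f i) = (\<Sum>i\<in>I. star (f i :: 'a::cstar_algebra))"
  by (induction I rule: infinite_finite_induct) (auto simp: star_add)

lemma norm_star [simp]: "norm (star x) = norm (x::'a::cstar_algebra)"
proof -
  have le: "norm x \<le> norm (star x)" for x :: 'a
  proof (cases "x = 0")
    case False
    have "norm x * norm x \<le> norm (star x) * norm x"
      using norm_mult_ineq[of "star x" x] by (simp add: norm_star_mult power2_eq_square)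
    then show ?thesis using False by simp
  qed simp
  show ?thesis using le[of x] le[of "star x"] by (simp add: star_star)
qed

lemma norm_mult_star: "norm (x * star x) = (norm (x::'a::cstar_algebra))\<^sup>2"
  using norm_star_mult[of "star x"] by (simp add: star_star)

lemma bounded_linear_star: "bounded_linear (star :: 'a::cstar_algebra \<Rightarrow> 'a)"
  by (rule bounded_linear_intro[where K = 1]) (auto simp: star_add star_scaleR)

lemma norm_square_selfadjoint:
  "star x = x \<Longrightarrow> norm (x * x) = (norm (x::'a::cstar_algebra))\<^sup>2"
  using norm_star_mult[of x] by simp

lemma star_sqrt_one_minus:
  fixes x :: "'a::cstar_algebra"
  assumes "norm x \<le> 1"
  shows "star (sqrt_one_minus x) = sqrt_one_minus (star x)"
proof -
  have "(\<lambda>m. star (sqrt_coeff m *\<^sub>R x ^ m)) sums star (sqrt_one_minus x)"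
    by (rule bounded_linear.sums[OF bounded_linear_star sqrt_one_minus_sums[OF assms]])
  then have "(\<lambda>m. sqrt_coeff m *\<^sub>R star x ^ m) sums star (sqrt_one_minus x)"
    by (simp add: star_scaleR star_power)
  moreover have "(\<lambda>m. sqrt_coeff m *\<^sub>R star x ^ m) sums sqrt_one_minus (star x)"
    using assms by (intro sqrt_one_minus_sums) simp
  ultimately show ?thesis by (rule sums_unique2)
qed

text \<open>The square root is required to be self-adjoint. In this form positivity is easily matched with norm
  bounds, and stability under sums follows; that \<open>x\<^sup>* x\<close> is positive for every \<open>x\<close> is the hard part
  (\<open>pos_star_mult\<close>).\<close>

definition pos :: "'a::cstar_algebra \<Rightarrow> bool"
  where "pos x \<longleftrightarrow> (\<exists>y. star y = y \<and> x = y * y)"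

lemma pos_selfadjoint: "pos x \<Longrightarrow> star x = x"
  by (auto simp: pos_def star_mult)

lemma pos_square: "star y = y \<Longrightarrow> pos (y * y)"
  by (auto simp: pos_def)

text \<open>If \<open>w\<^sup>2 + y\<^sup>2 = 1\<close> with commuting self-adjoint \<open>w\<close> and \<open>y\<close>, then \<open>w + i y\<close> is unitary, and
  \<open>w\<close> is the mean of this unitary and its adjoint.\<close>

lemma norm_le_1_of_unit_circle:
  fixes w y :: "'a::cstar_algebra"
  assumes "star w = w" "star y = y" "w * y = y * w" "w * w + y * y = 1"
  shows "norm w \<le> 1" "norm y \<le> 1"
proof -
  define v where "v = w + \<i> *\<^sub>C y"
  have sv: "star v = w - \<i> *\<^sub>C y"
    by (simp add: v_def star_add star_scaleC assms complex_vector.scale_minus_left)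
  have "star v * v = (w - \<i> *\<^sub>C y) * (w + \<i> *\<^sub>C y)"
    by (simp only: sv) (simp only: v_def)
  also have "\<dots> = w * w + y * y"
    by (simp add: algebra_simps mult_scaleC_left mult_scaleC_right assms
        scaleC_scaleC scaleC_one complex_vector.scale_minus_left)
  finally have "norm v = 1"
    using norm_star_mult[of v] assms(4) by (simp add: power2_eq_1_iff) (smt (verit) norm_ge_zero)
  then have n: "norm v = 1" "norm (star v) = 1" by simp_all
  have "2 *\<^sub>R w = v + star v" by (simp add: sv) (simp add: v_def scaleR_2)
  then have "2 * norm w \<le> 2"
    using norm_triangle_ineq[of v "star v"] n by (metis norm_scaleR abs_numeral one_add_one)
  then show "norm w \<le> 1" by simp
  have "v - star v = 2 *\<^sub>R (\<i> *\<^sub>C y)" by (simp add: sv) (simp add: v_def scaleR_2)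
  then have "norm (v - star v) = 2 * norm y" by (simp add: norm_scaleC)
  then show "norm y \<le> 1"
    using norm_triangle_ineq4[of v "star v"] n by simp
qed

text \<open>If \<open>x = y\<^sup>2\<close> and \<open>w = (1 - x)\<^sup>1\<^sup>/\<^sup>2\<close>, then \<open>w\<^sup>2 + y\<^sup>2 = 1\<close>, so \<open>w\<close> and \<open>1 - x = w\<^sup>2\<close> have norm at most \<open>1\<close>.\<close>

lemma pos_norm_one_minus:
  assumes "pos x" "norm x \<le> 1"
  shows "norm (1 - x) \<le> 1"
proof -
  obtain y where y: "star y = y" "x = y * y" using assms by (auto simp: pos_def)
  define w where "w = sqrt_one_minus x"
  have sx: "star x = x" by (rule pos_selfadjoint[OF assms(1)])
  have w: "star w = w" "w * w = 1 - x" "w * y = y * w"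
    using star_sqrt_one_minus[OF assms(2)] sqrt_one_minus_square[OF assms(2)]
      sqrt_one_minus_commute[OF assms(2), of y] sx by (simp_all add: w_def) (simp add: y(2) mult.assoc)
  have "norm w \<le> 1"
    using norm_le_1_of_unit_circle(1)[of w y] w y by simp
  then have "norm w * norm w \<le> 1" by (simp add: mult_le_one)
  then show ?thesis using norm_mult_ineq[of w w] w(2) by simp
qed

lemma pos_scaleR:
  assumes "pos x" "r \<ge> 0"
  shows "pos (r *\<^sub>R x)"
proof -
  obtain y where y: "star y = y" "x = y * y" using assms by (auto simp: pos_def)
  have "r *\<^sub>R x = (sqrt r *\<^sub>R y) * (sqrt r *\<^sub>R y)" using y assms(2) by simp
  moreover have "star (sqrt r *\<^sub>R y) = sqrt r *\<^sub>R y" by (simp add: star_scaleR y)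
  ultimately show ?thesis by (metis pos_square)
qed

lemma pos_norm_diff:
  assumes "pos x" "norm x \<le> r"
  shows "norm (r *\<^sub>R 1 - x) \<le> r"
proof (cases "r = 0")
  case False
  then have r: "r > 0" using assms(2) norm_ge_zero[of x] by linarith
  have "norm (1 - (1 / r) *\<^sub>R x) \<le> 1"
    using r assms by (intro pos_norm_one_minus pos_scaleR) auto
  moreover have "r *\<^sub>R 1 - x = r *\<^sub>R (1 - (1 / r) *\<^sub>R x)"
    using r by (simp add: scaleR_diff_right)
  ultimately show ?thesis using r by (simp add: mult_left_le)
qed (use assms in simp)

text \<open>The root is \<open>\<surd>r (1 - x)\<^sup>1\<^sup>/\<^sup>2\<close> with \<open>x = 1 - h / r\<close>. As a limit of polynomials in \<open>h\<close> it commutes with whatever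
  commutes with \<open>h\<close>, and the series gives the bound from which its own positivity will follow.\<close>

lemma sqrt_of_norm_diff:
  assumes "star h = h" "norm (r *\<^sub>R 1 - h) \<le> r"
  shows "\<exists>y. star y = y \<and> h = y * y \<and> (\<exists>s. norm (s *\<^sub>R 1 - y) \<le> s) \<and>
    (\<forall>z. z * h = h * z \<longrightarrow> z * y = y * z)"
proof (cases "r = 0")
  case True
  then show ?thesis using assms by (intro exI[of _ 0]) (auto intro: exI[of _ 0])
next
  case False
  then have r: "r > 0" using assms(2) norm_ge_zero[of "r *\<^sub>R 1 - h"] by linarith
  define x where "x = 1 - (1 / r) *\<^sub>R h"
  have rx: "r *\<^sub>R 1 - h = r *\<^sub>R x" using r by (simp add: x_def scaleR_diff_right)
  have x: "norm x \<le> 1"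
    using assms(2) r unfolding rx by simp
  have sx: "star x = x" by (simp add: x_def star_diff star_scaleR assms)
  define y where "y = sqrt r *\<^sub>R sqrt_one_minus x"
  have "star y = y" by (simp add: y_def star_scaleR star_sqrt_one_minus[OF x] sx)
  moreover have "norm (sqrt r *\<^sub>R 1 - y) \<le> sqrt r"
  proof -
    have "norm (1 - sqrt_one_minus x) \<le> 1" using norm_one_minus_sqrt_le[OF x] x by simp
    then have "sqrt r * norm (1 - sqrt_one_minus x) \<le> sqrt r" using r by (simp add: mult_left_le)
    then show ?thesis using r by (simp add: y_def flip: scaleR_diff_right)
  qed
  moreover have "h = y * y"
    using r by (simp add: y_def sqrt_one_minus_square[OF x]) (simp add: x_def)
  moreover have "z * y = y * z" if "z * h = h * z" for z
  proof -
    have "z * x = x * z" using that by (simp add: x_def algebra_simps)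
    then show ?thesis using sqrt_one_minus_commute[OF x, of z] by (simp add: y_def)
  qed
  ultimately show ?thesis by blast
qed

lemma pos_of_norm_diff: "star h = h \<Longrightarrow> norm (r *\<^sub>R 1 - h) \<le> r \<Longrightarrow> pos h"
  using sqrt_of_norm_diff[of h r] by (auto simp: pos_def)

lemma pos_sqrt:
  assumes "pos h"
  obtains y where "pos y" "star y = y" "h = y * y" "\<And>z. z * h = h * z \<Longrightarrow> z * y = y * z"
  using sqrt_of_norm_diff[OF pos_selfadjoint[OF assms] pos_norm_diff[OF assms order_refl]]
    pos_of_norm_diff by blast

lemma pos_zero [simp]: "pos 0" and pos_one [simp]: "pos 1"
  using pos_square[of 0] pos_square[of 1] by simp_all

text \<open>The norm condition that characterises positivity passes to sums by the triangle inequality.\<close>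

lemma pos_add:
  assumes "pos x" "pos y"
  shows "pos (x + y)"
proof (rule pos_of_norm_diff)
  show "star (x + y) = x + y" using assms by (simp add: star_add pos_selfadjoint)
  have "(norm x + norm y) *\<^sub>R 1 - (x + y) = (norm x *\<^sub>R 1 - x) + (norm y *\<^sub>R 1 - y)"
    by (simp add: algebra_simps)
  then have "norm ((norm x + norm y) *\<^sub>R 1 - (x + y)) = norm ((norm x *\<^sub>R 1 - x) + (norm y *\<^sub>R 1 - y))"
    by (rule arg_cong)
  then show "norm ((norm x + norm y) *\<^sub>R 1 - (x + y)) \<le> norm x + norm y"
    using norm_triangle_ineq[of "norm x *\<^sub>R 1 - x" "norm y *\<^sub>R 1 - y"]
      pos_norm_diff[OF assms(1) order_refl] pos_norm_diff[OF assms(2) order_refl] by linarith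
qed

lemma pos_sum: "(\<And>i. i \<in> I \<Longrightarrow> pos (f i)) \<Longrightarrow> pos (\<Sum>i\<in>I. f i)"
  by (induction I rule: infinite_finite_induct) (auto intro: pos_add)

lemma pos_limit:
  assumes "\<And>n. pos (X n)" "X \<longlonglongrightarrow> x"
  shows "pos x"
proof -
  obtain r where r: "\<And>n. norm (X n) \<le> r"
    using Bseq_def convergent_imp_Bseq assms(2) convergentI by metis
  show ?thesis
  proof (rule pos_of_norm_diff)
    have "(\<lambda>n. star (X n)) \<longlonglongrightarrow> star x"
      by (rule bounded_linear.tendsto[OF bounded_linear_star assms(2)])
    then show "star x = x"
      using assms LIMSEQ_unique by (simp add: pos_selfadjoint)
    have "(\<lambda>n. norm (r *\<^sub>R 1 - X n)) \<longlonglongrightarrow> norm (r *\<^sub>R 1 - x)"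
      by (intro tendsto_intros assms)
    then show "norm (r *\<^sub>R 1 - x) \<le> r"
      by (rule LIMSEQ_le_const2) (use pos_norm_diff[OF assms(1) r] in blast)
  qed
qed

lemma pos_norm_minus:
  assumes "star h = h" "norm h \<le> r"
  shows "pos (r *\<^sub>R 1 - h)"
  by (rule pos_of_norm_diff[of _ r]) (use assms in \<open>auto simp: star_diff star_scaleR\<close>)

lemma pos_real: "pos (c *\<^sub>R 1 :: 'a::cstar_algebra) \<longleftrightarrow> c \<ge> 0"
proof
  assume p: "pos (c *\<^sub>R 1 :: 'a)"
  have "(\<bar>c\<bar> *\<^sub>R 1 - c *\<^sub>R 1 :: 'a) = (\<bar>c\<bar> - c) *\<^sub>R 1"
    by (simp add: scaleR_diff_left)
  then have "\<bar>\<bar>c\<bar> - c\<bar> \<le> \<bar>c\<bar>"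
    using pos_norm_diff[OF p, of "\<bar>c\<bar>"] by simp
  then show "c \<ge> 0" by linarith
qed (simp add: pos_scaleR)

text \<open>For \<open>d > c\<close>, commuting square roots of \<open>a / d\<close> and \<open>1 - a / d\<close> satisfy the equation of the unit circle.\<close>

lemma norm_le_of_pos:
  fixes a :: "'a::cstar_algebra"
  assumes "pos a" "pos (c *\<^sub>R 1 - a)"
  shows "norm a \<le> c"
proof -
  have "pos (c *\<^sub>R 1 :: 'a)" using pos_add[OF assms] by simp
  then have c0: "c \<ge> 0" by (simp add: pos_real)
  have *: "norm a \<le> d" if d: "d > 0" "pos (d *\<^sub>R 1 - a)" for d
  proof -
    obtain y where y: "star y = y" "a = y * y" "\<And>z. z * a = a * z \<Longrightarrow> z * y = y * z"
      using pos_sqrt[OF assms(1)] by blast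
    obtain w where w: "star w = w" "d *\<^sub>R 1 - a = w * w"
        "\<And>z. z * (d *\<^sub>R 1 - a) = (d *\<^sub>R 1 - a) * z \<Longrightarrow> z * w = w * z"
      using pos_sqrt[OF d(2)] by blast
    have "y * (d *\<^sub>R 1 - a) = (d *\<^sub>R 1 - a) * y"
      by (simp add: y(2) algebra_simps)
    then have yw: "w * y = y * w" using w(3) by simp
    define s where "s = 1 / sqrt d"
    have ss: "s * s = 1 / d" using d by (simp add: s_def)
    have "norm (s *\<^sub>R y) \<le> 1"
    proof (rule norm_le_1_of_unit_circle(2)[of "s *\<^sub>R w"])
      have "(s *\<^sub>R w) * (s *\<^sub>R w) + (s *\<^sub>R y) * (s *\<^sub>R y) = (1 / d) *\<^sub>R (w * w + y * y)"
        by (simp add: ss scaleR_add_right)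
      also have "w * w + y * y = d *\<^sub>R 1" using w(2) y(2) by (simp add: algebra_simps)
      finally show "(s *\<^sub>R w) * (s *\<^sub>R w) + (s *\<^sub>R y) * (s *\<^sub>R y) = 1" using d by simp
    qed (use w(1) y(1) yw in \<open>simp_all add: star_scaleR\<close>)
    then have "norm (s *\<^sub>R y) ^ 2 \<le> 1" by (simp add: power_le_one)
    moreover have "norm (s *\<^sub>R y) ^ 2 = (1 / d) * norm y ^ 2"
      by (simp add: power_mult_distrib ss[symmetric]) (simp add: power2_eq_square)
    ultimately have "(1 / d) * norm y ^ 2 \<le> 1" by simp
    then have "norm y ^ 2 \<le> d" using d by (simp add: field_simps)
    then show ?thesis using norm_square_selfadjoint[OF y(1)] y(2) by simp
  qed
  show ?thesis
  proof (rule field_le_epsilon)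
    fix e :: real assume e: "e > 0"
    have "pos ((c *\<^sub>R 1 - a) + e *\<^sub>R 1)" using e assms by (intro pos_add) (auto simp: pos_real)
    then have "pos ((c + e) *\<^sub>R 1 - a)" by (simp add: algebra_simps)
    then show "norm a \<le> c + e" using * e c0 by simp
  qed
qed

text \<open>In terms of the spectrum: the norm of a positive element is its largest spectral value, and adding \<open>s\<close>
  shifts the spectrum.\<close>

lemma norm_add_real_pos:
  assumes "pos a" "s \<ge> 0"
  shows "norm (s *\<^sub>R 1 + a) = s + norm a"
proof (rule antisym)
  show "norm (s *\<^sub>R 1 + a) \<le> s + norm a"
    using norm_triangle_ineq[of "s *\<^sub>R 1" a] assms(2) by simp
  define c where "c = norm (s *\<^sub>R 1 + a)"
  have "pos (c *\<^sub>R 1 - (s *\<^sub>R 1 + a))"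
    by (rule pos_norm_minus) (use assms in \<open>auto simp: c_def star_add star_scaleR pos_selfadjoint\<close>)
  then have "pos ((c - s) *\<^sub>R 1 - a)" by (simp add: algebra_simps)
  from norm_le_of_pos[OF assms(1) this] show "s + norm a \<le> norm (s *\<^sub>R 1 + a)"
    by (simp add: c_def)
qed

lemma pos_mono_norm:
  assumes "pos a" "pos (b - a)"
  shows "norm a \<le> norm b"
proof (rule norm_le_of_pos[OF assms(1)])
  have "pos b" using pos_add[OF assms] by simp
  then have "pos (norm b *\<^sub>R 1 - b)" by (intro pos_norm_minus pos_selfadjoint) auto
  from pos_add[OF this assms(2)] show "pos (norm b *\<^sub>R 1 - a)" by simp
qed

lemma norm_power_two_power_selfadjoint:
  fixes x :: "'a::cstar_algebra"
  assumes "star x = x"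
  shows "norm (x ^ (2 ^ k)) = norm x ^ (2 ^ k)"
proof (induction k)
  case (Suc k)
  have "norm (x ^ (2 ^ Suc k)) = norm (x ^ 2 ^ k * x ^ 2 ^ k)"
    by (simp add: power_add[symmetric] mult_2)
  also have "\<dots> = (norm (x ^ 2 ^ k))\<^sup>2"
    by (rule norm_square_selfadjoint) (simp add: star_power assms)
  finally show ?case by (simp add: Suc power_mult[symmetric] mult.commute)
qed simp

lemma cartesian_decomposition:
  fixes y :: "'a::cstar_algebra"
  obtains s t where "star s = s" "star t = t" "y = s + \<i> *\<^sub>C t"
proof
  show "star ((1/2) *\<^sub>R (y + star y)) = (1/2) *\<^sub>R (y + star y)"
    by (simp add: star_scaleR star_add star_star add.commute)
  show "star ((- \<i> / 2) *\<^sub>C (y - star y)) = (- \<i> / 2) *\<^sub>C (y - star y)"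
    by (simp add: star_scaleC star_diff star_star complex_vector.scale_right_diff_distrib)
  show "y = (1/2) *\<^sub>R (y + star y) + \<i> *\<^sub>C (- \<i> / 2) *\<^sub>C (y - star y)"
    by (simp add: scaleC_scaleC scaleR_scaleC flip: scaleC_add_right)
      (simp add: scaleC_add_right complex_vector.scale_right_diff_distrib
        scaleC_add_left[symmetric] scaleC_one)
qed

text \<open>Let \<open>u\<close> be \<open>y\<close>, normalised. As \<open>u\<^sup>* u + u u\<^sup>*\<close> is a sum of squares, \<open>z = u u\<^sup>*\<close> is positive, while \<open>u\<^sup>* u \<le> 0\<close>
  gives \<open>norm (1 + u\<^sup>* u) \<le> 1\<close>. Now \<open>(1 + z)\<^sup>i u = u (1 + u\<^sup>* u)\<^sup>i\<close> is bounded in \<open>i\<close>, so the powers of \<open>1 + z\<close> grow at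
  most linearly. But \<open>norm (1 + z) = 2\<close>, and the norm of the power of exponent \<open>2\<^sup>2\<close> is \<open>2\<^sup>4 > 1 + 4\<close>.\<close>

lemma minus_star_mult_pos_imp_zero:
  fixes y :: "'a::cstar_algebra"
  assumes "pos (- (star y * y))"
  shows "y = 0"
proof (rule ccontr)
  assume y0: "y \<noteq> 0"
  define u where "u = (1 / norm y) *\<^sub>R y"
  have nu: "norm u = 1" using y0 by (simp add: u_def)
  have "- (star u * u) = (1 / norm y * (1 / norm y)) *\<^sub>R (- (star y * y))"
    by (simp add: u_def star_scaleR)
  then have pu: "pos (- (star u * u))" by (simp only:) (intro pos_scaleR assms, simp)
  obtain s t where st: "star s = s" "star t = t" "u = s + \<i> *\<^sub>C t"
    by (rule cartesian_decomposition)
  have "star u * u + u * star u = 2 *\<^sub>R (s * s + t * t)"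
    by (simp add: st star_add star_scaleC algebra_simps mult_scaleC_left mult_scaleC_right
        scaleC_scaleC scaleC_one scaleR_2 complex_vector.scale_minus_left)
  moreover have "pos (2 *\<^sub>R (s * s + t * t))"
    using st by (intro pos_scaleR pos_add pos_square) auto
  ultimately have "pos (star u * u + u * star u + - (star u * u))"
    using pos_add[OF _ pu] by metis
  then have pz: "pos (u * star u)" by simp
  define z where "z = u * star u"
  have z: "pos z" "norm z = 1" "star z = z"
    using pz norm_mult_star[of u] nu pos_selfadjoint by (auto simp: z_def)
  have n1: "norm (1 + star u * u) \<le> 1"
    using pos_norm_one_minus[OF pu] norm_star_mult[of u] nu by simp
  have comm: "(1 + z) ^ i * u = u * (1 + star u * u) ^ i" for i
  proof (induction i)
    case (Suc i)
    have "(1 + z) ^ Suc i * u = (1 + z) * (u * (1 + star u * u) ^ i)"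
      by (simp add: mult.assoc Suc)
    also have "\<dots> = u * ((1 + star u * u) * (1 + star u * u) ^ i)"
      by (simp add: z_def algebra_simps)
    finally show ?case by simp
  qed simp
  have b: "norm ((1 + z) ^ i * z) \<le> 1" for i
  proof -
    have "norm ((1 + z) ^ i * z) = norm (u * (1 + star u * u) ^ i * star u)"
      by (simp add: comm[symmetric] z_def mult.assoc)
    also have "\<dots> \<le> norm u * norm ((1 + star u * u) ^ i) * norm (star u)"
      using norm_mult_ineq[of "u * (1 + star u * u) ^ i" "star u"]
        norm_mult_ineq[of u "(1 + star u * u) ^ i"] nu by simp
    also have "\<dots> \<le> 1"
      using norm_power_ineq[of "1 + star u * u" i] power_le_one[OF _ n1, of i] nu by simp
    finally show ?thesis .
  qed
  have "norm ((1 + z) ^ j) \<le> 1 + real j" for j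
  proof (induction j)
    case (Suc j)
    have "(1 + z) ^ Suc j = (1 + z) ^ j * (1 + z)" by (simp only: power_Suc2)
    then have "(1 + z) ^ Suc j = (1 + z) ^ j + (1 + z) ^ j * z"
      by (simp only: distrib_left mult_1_right)
    then show ?case
      using norm_triangle_ineq[of "(1 + z) ^ j" "(1 + z) ^ j * z"] Suc b[of j] by simp
  qed simp
  moreover have "norm ((1 + z) ^ (2 ^ 2)) = 2 ^ (2 ^ 2)"
  proof -
    have "norm (1 + z) = 2" using norm_add_real_pos[OF z(1), of 1] z(2) by simp
    then show ?thesis
      by (subst norm_power_two_power_selfadjoint) (simp_all add: star_add z(3))
  qed
  ultimately have "2 ^ (2 ^ 2) \<le> 1 + real (2 ^ 2)" by metis
  then show False by simp
qed

text \<open>With \<open>h = x\<^sup>* x\<close> and \<open>k = |h| - h\<close>, the element \<open>y = x k\<close> satisfies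
  \<open>y\<^sup>* y = h k\<^sup>2 = - |h| k\<^sup>2 \<le> 0\<close>, so it vanishes; then \<open>k\<^sup>3 = 0\<close> and \<open>h = |h|\<close>.\<close>

lemma pos_star_mult: "pos (star x * (x::'a::cstar_algebra))"
proof -
  define h where "h = star x * x"
  have sh: "star h = h" by (simp add: h_def star_mult star_star)
  obtain m where m: "pos m" "star m = m" "h * h = m * m"
      "\<And>z. z * (h * h) = h * h * z \<Longrightarrow> z * m = m * z"
    using pos_sqrt[OF pos_square[OF sh]] by blast
  obtain w where w: "star w = w" "m = w * w" "\<And>z. z * m = m * z \<Longrightarrow> z * w = w * z"
    using pos_sqrt[OF m(1)] by blast
  define k where "k = m - h"
  have hm: "h * m = m * h" using m(4)[of h] by (simp add: mult.assoc)
  have sk: "star k = k" by (simp add: k_def star_diff sh m(2))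
  have hk: "h * k = - (m * k)" "k * h = - (k * m)" "m * k = k * m"
    using hm m(3) by (simp_all add: k_def algebra_simps)
  have wk: "k * w = w * k" using w(3)[of k] hk(3) by simp
  define y where "y = x * k"
  have "star y * y = k * h * k" by (simp add: y_def star_mult sk h_def mult.assoc)
  also have "\<dots> = - (k * m * k)" by (simp add: hk)
  finally have yy: "star y * y = - (k * m * k)" .
  have "k * m * k = star (w * k) * (w * k)" by (simp add: star_mult sk w(1) w(2) mult.assoc)
  also have "\<dots> = (w * k) * (w * k)" by (simp add: star_mult w(1) sk wk)
  finally have kmk: "k * m * k = (w * k) * (w * k)" .
  have "pos (- (star y * y))"
    unfolding yy kmk by (simp add: pos_square star_mult w(1) sk wk)
  then have "y = 0" by (rule minus_star_mult_pos_imp_zero)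
  then have 1: "k * m * k = 0" "k * h * k = 0" using yy \<open>star y * y = k * h * k\<close> by simp_all
  then have "k * k * k = 0" by (metis (no_types, lifting) diff_zero k_def left_diff_distrib right_diff_distrib)
  then have "(k * k) * (k * k) = 0" by (metis mult.assoc mult_zero_left)
  then have "norm k ^ 2 ^ 2 = 0"
    using norm_square_selfadjoint[OF sk] norm_square_selfadjoint[of "k * k"] sk
    by (simp add: star_mult)
  then have "k = 0" by simp
  then show ?thesis using m(1) by (simp add: k_def h_def)
qed

lemma pos_conj: "pos a \<Longrightarrow> pos (star b * a * (b::'a::cstar_algebra))"
proof -
  assume "pos a"
  then obtain y where "star y = y" "a = y * y" by (auto simp: pos_def)
  then have "star b * a * b = star (y * b) * (y * b)" by (simp add: star_mult mult.assoc)
  then show ?thesis by (simp only: pos_star_mult)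
qed

lemma pos_diff_star_mult:
  fixes x :: "'a::cstar_algebra"
  assumes "(norm x)\<^sup>2 \<le> r"
  shows "pos (r *\<^sub>R 1 - star x * x)"
  by (rule pos_norm_minus) (simp_all add: star_mult star_star norm_star_mult assms)

lemma star_mult_complement:
  fixes x :: "'a::cstar_algebra"
  assumes "(norm x)\<^sup>2 \<le> r"
  obtains c where "star x * x + star c * c = r *\<^sub>R 1"
proof -
  obtain c where "star c = c" "r *\<^sub>R 1 - star x * x = c * c"
    using pos_diff_star_mult[OF assms] by (auto simp: pos_def)
  then have "star x * x + star c * c = r *\<^sub>R 1" by (simp add: algebra_simps)
  then show ?thesis by (rule that)
qed

text \<open>The terms \<open>(1 - y)\<^sup>j y\<close> decrease in \<open>j\<close> and the first \<open>m\<close> of them add up to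
  \<open>1 - (1 - y)\<^sup>m \<le> 1\<close>.\<close>

lemma norm_power_one_minus_mult:
  fixes y :: "'a::cstar_algebra"
  assumes "pos y" "norm y \<le> 1"
  shows "real m * norm ((1 - y) ^ m * y) \<le> 1"
proof -
  define t where "t = 1 - y"
  have st: "star y = y" "star t = t" using pos_selfadjoint[OF assms(1)] by (simp_all add: t_def star_diff)
  have "pos t" by (rule pos_of_norm_diff[of _ 1]) (use assms st in \<open>simp_all add: t_def star_diff\<close>)
  then obtain u where u: "star u = u" "t = u * u" "\<And>z. z * t = t * z \<Longrightarrow> z * u = u * z"
    using pos_sqrt by blast
  obtain g where g: "star g = g" "y = g * g" "\<And>z. z * y = y * z \<Longrightarrow> z * g = g * z"
    using pos_sqrt[OF assms(1)] by blast
  have ty: "t * y = y * t" by (simp add: t_def algebra_simps)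
  have uy: "y * u = u * y" using u(3)[of y] ty by simp
  have ug: "u * g = g * u" using g(3)[of u] uy by simp
  have ugj: "u ^ j * g = g * u ^ j" "u ^ j * y = y * u ^ j" for j
    by (metis power_commuting_commutes ug) (metis power_commuting_commutes uy)
  have tj: "t ^ j = u ^ j * u ^ j" for j
    by (simp add: u(2) power_add[symmetric] mult_2[symmetric] power_mult power2_eq_square)
  have p1: "pos (t ^ j)" for j
    unfolding tj by (rule pos_square) (simp add: star_power u)
  have p2: "pos (t ^ j * y)" for j
  proof -
    have "t ^ j * y = (u ^ j * g) * (u ^ j * g)"
      by (simp add: tj g(2) mult.assoc) (metis mult.assoc ugj(1))
    moreover have "star (u ^ j * g) = u ^ j * g"
      by (simp add: star_mult star_power u(1) g(1) ugj(1)[symmetric])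
    ultimately show ?thesis by (metis pos_square)
  qed
  have p3: "pos (t ^ j * y - t ^ Suc j * y)" for j
  proof -
    have "t ^ j * y - t ^ Suc j * y = t ^ j * (y - t * y)"
      by (simp add: right_diff_distrib) (metis mult.assoc power_commutes)
    also have "y - t * y = y * y" by (simp add: t_def algebra_simps)
    also have "t ^ j * (y * y) = (u ^ j * y) * (u ^ j * y)"
      by (simp add: tj mult.assoc) (metis mult.assoc ugj(2))
    finally have "t ^ j * y - t ^ Suc j * y = (u ^ j * y) * (u ^ j * y)" .
    moreover have "star (u ^ j * y) = u ^ j * y"
      by (simp add: star_mult star_power u(1) st(1) ugj(2)[symmetric])
    ultimately show ?thesis by (metis pos_square)
  qed
  have p4: "pos (t ^ j * y - t ^ (j + i) * y)" for i j
  proof (induction i)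
    case (Suc i)
    show ?case using pos_add[OF Suc p3[of "j + i"]] by simp
  qed simp
  have "(\<Sum>j<m. t ^ j * y) = 1 - t ^ m"
  proof (induction m)
    case (Suc m)
    have "t ^ m * y = t ^ m * (1 - t)" by (simp add: t_def)
    also have "\<dots> = t ^ m - t ^ Suc m" by (simp only: right_diff_distrib mult_1_right power_Suc2)
    finally show ?case by (simp only: sum.lessThan_Suc Suc) (simp only: algebra_simps)
  qed simp
  then have "1 - real m *\<^sub>R (t ^ m * y) = t ^ m + (\<Sum>j<m. t ^ j * y - t ^ m * y)"
    by (simp add: sum_subtractf) (simp add: scaleR_conv_of_real)
  moreover have "pos (t ^ m + (\<Sum>j<m. t ^ j * y - t ^ m * y))"
  proof (intro pos_add pos_sum p1)
    fix j assume "j \<in> {..<m}"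
    then have "j + (m - j) = m" by simp
    then show "pos (t ^ j * y - t ^ m * y)" using p4[of j "m - j"] by metis
  qed
  ultimately have "pos (1 *\<^sub>R 1 - real m *\<^sub>R (t ^ m * y))" by (metis scaleR_one)
  then have "norm (real m *\<^sub>R (t ^ m * y)) \<le> 1"
    by (rule norm_le_of_pos[rotated]) (simp add: pos_scaleR p2)
  then show ?thesis by (simp add: t_def[symmetric])
qed

section \<open>Hilbert spaces\<close>

lemma bounded_bilinear_scaleC:
  "bounded_bilinear (scaleC :: complex \<Rightarrow> 'a \<Rightarrow> 'a::complex_normed_vector)"
proof
  show "\<exists>K. \<forall>a b. norm (a *\<^sub>C (b::'a)) \<le> norm a * norm b * K"
    by (intro exI[of _ 1]) (simp add: norm_scaleC)
  show "(r *\<^sub>R a) *\<^sub>C b = r *\<^sub>R (a *\<^sub>C b)" "a *\<^sub>C (r *\<^sub>R b) = r *\<^sub>R (a *\<^sub>C b)" for r a and b :: 'a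
    unfolding scaleR_conv_of_real by (simp_all add: scaleR_scaleC[where 'a = 'a] scaleC_scaleC mult.commute)
qed (simp_all add: scaleC_add_left scaleC_add_right)

lemma clinear_iff:
  "clinear f \<longleftrightarrow> (\<forall>x y. f (x + y) = f x + f y) \<and> (\<forall>c x. f (c *\<^sub>C x) = c *\<^sub>C f x)"
  by (auto simp: Vector_Spaces.linear_iff complex_vector.vector_space_axioms)

lemma clinearD:
  assumes "clinear f"
  shows "f (x + y) = f x + f y" "f (c *\<^sub>C x) = c *\<^sub>C f x" "f 0 = 0" "f (x - y) = f x - f y"
    "f (- x) = - f x" "f (r *\<^sub>R x) = r *\<^sub>R f x" "f (sum g I) = (\<Sum>i\<in>I. f (g i))"
proof -
  interpret Vector_Spaces.linear scaleC scaleC f by (rule assms)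
  show "f (x + y) = f x + f y" "f (c *\<^sub>C x) = c *\<^sub>C f x" "f 0 = 0" "f (x - y) = f x - f y"
    "f (- x) = - f x" "f (r *\<^sub>R x) = r *\<^sub>R f x" "f (sum g I) = (\<Sum>i\<in>I. f (g i))"
    by (auto simp: add scale zero diff neg sum scaleR_scaleC)
qed

lemma cinner_add_left: "cinner (x + y) z = cinner x z + cinner y (z::'h::chilbert_space)"
  by (metis cinner_add_right cinner_commute complex_cnj_add)

lemma cinner_scaleC_left: "cinner (c *\<^sub>C x) y = cnj c * cinner x (y::'h::chilbert_space)"
  by (metis cinner_scaleC_right cinner_commute complex_cnj_mult)

lemma cinner_zero_right [simp]: "cinner x (0::'h::chilbert_space) = 0"
  using cinner_scaleC_right[of x 0 0] by simp

lemma cinner_zero_left [simp]: "cinner (0::'h::chilbert_space) x = 0"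
  using cinner_scaleC_left[of 0 0 x] by simp

lemma cinner_minus_right: "cinner x (- y) = - cinner x (y::'h::chilbert_space)"
  using cinner_add_right[of x y "- y"] by (simp add: add_eq_0_iff)

lemma cinner_minus_left: "cinner (- x) y = - cinner x (y::'h::chilbert_space)"
  using cinner_add_left[of x "- x" y] by (simp add: add_eq_0_iff)

lemma cinner_diff_right: "cinner x (y - z) = cinner x y - cinner x (z::'h::chilbert_space)"
  using cinner_add_right[of x y "- z"] by (simp add: cinner_minus_right)

lemma cinner_diff_left: "cinner (x - y) z = cinner x z - cinner y (z::'h::chilbert_space)"
  using cinner_add_left[of x "- y" z] by (simp add: cinner_minus_left)

lemma cinner_sum_right: "cinner x (sum f I) = (\<Sum>i\<in>I. cinner x (f i :: 'h::chilbert_space))"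
  by (induction I rule: infinite_finite_induct) (auto simp: cinner_add_right)

lemma cinner_sum_left: "cinner (sum f I) x = (\<Sum>i\<in>I. cinner (f i :: 'h::chilbert_space) x)"
  by (induction I rule: infinite_finite_induct) (auto simp: cinner_add_left)

lemma cinner_scaleR_right: "cinner x (r *\<^sub>R y) = of_real r * cinner x (y::'h::chilbert_space)"
  by (simp add: scaleR_scaleC cinner_scaleC_right)

lemma cinner_scaleR_left: "cinner (r *\<^sub>R x) y = of_real r * cinner x (y::'h::chilbert_space)"
  by (simp add: scaleR_scaleC cinner_scaleC_left)

lemma cinner_self_eq_0 [simp]: "cinner x x = 0 \<longleftrightarrow> x = (0::'h::chilbert_space)"
  by (simp add: cinner_self)

lemma Re_cinner_self: "Re (cinner x x) = (norm (x::'h::chilbert_space))\<^sup>2"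
  by (simp add: cinner_self)

lemma norm_add_square:
  "(norm (x + y))\<^sup>2 = (norm x)\<^sup>2 + 2 * Re (cinner x y) + (norm (y::'h::chilbert_space))\<^sup>2"
proof -
  have "Re (cinner y x) = Re (cinner x y)" by (subst cinner_commute) simp
  then show ?thesis
    by (simp add: Re_cinner_self[symmetric] cinner_add_left cinner_add_right)
qed

lemma norm_diff_square:
  "(norm (x - y))\<^sup>2 = (norm x)\<^sup>2 - 2 * Re (cinner x y) + (norm (y::'h::chilbert_space))\<^sup>2"
  using norm_add_square[of x "- y"] by (simp add: cinner_minus_right)

lemma norm_parallelogram:
  "(norm (x + y))\<^sup>2 + (norm (x - y))\<^sup>2 = 2 * (norm x)\<^sup>2 + 2 * (norm (y::'h::chilbert_space))\<^sup>2"
  by (simp add: norm_add_square norm_diff_square)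

lemma norm_pythagoras:
  "cinner x y = 0 \<Longrightarrow> (norm (x + y))\<^sup>2 = (norm x)\<^sup>2 + (norm (y::'h::chilbert_space))\<^sup>2"
  by (simp add: norm_add_square)

lemma cinner_Cauchy_Schwarz: "cmod (cinner x y) \<le> norm x * norm (y::'h::chilbert_space)"
proof (cases "y = 0")
  case False
  define c where "c = cinner y x / of_real ((norm y)\<^sup>2)"
  have "cinner y (x - c *\<^sub>C y) = 0"
    using False by (simp add: cinner_diff_right cinner_scaleC_right cinner_self c_def)
  then have "cinner (x - c *\<^sub>C y) (c *\<^sub>C y) = 0"
    by (subst cinner_commute) (simp add: cinner_scaleC_left)
  then have "(norm x)\<^sup>2 = (norm (x - c *\<^sub>C y))\<^sup>2 + (norm (c *\<^sub>C y))\<^sup>2"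
    using norm_pythagoras[of "x - c *\<^sub>C y" "c *\<^sub>C y"] by simp
  then have "(norm (c *\<^sub>C y))\<^sup>2 \<le> (norm x)\<^sup>2" by simp
  then have "cmod c * norm y \<le> norm x"
    unfolding norm_scaleC by (rule power2_le_imp_le) simp
  moreover have "cmod c = cmod (cinner x y) / (norm y)\<^sup>2"
    by (simp add: c_def norm_divide norm_power) (metis cinner_commute complex_mod_cnj)
  ultimately show ?thesis
    using False by (simp add: field_simps power2_eq_square)
qed simp

lemma bounded_bilinear_cinner: "bounded_bilinear (cinner :: 'h::chilbert_space \<Rightarrow> 'h \<Rightarrow> complex)"
proof
  show "\<exists>K. \<forall>a b :: 'h. cmod (cinner a b) \<le> norm a * norm b * K"
    by (intro exI[of _ 1] allI) (simp add: cinner_Cauchy_Schwarz)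
qed (simp_all add: cinner_add_left cinner_add_right cinner_scaleR_left cinner_scaleR_right
      scaleR_conv_of_real)

lemmas tendsto_cinner = bounded_bilinear.tendsto[OF bounded_bilinear_cinner]

lemma cinner_eqI:
  assumes "\<And>z. cinner z x = cinner z (y::'h::chilbert_space)"
  shows "x = y"
proof -
  have "cinner (x - y) (x - y) = 0" using assms[of "x - y"] by (simp add: cinner_diff_right)
  then show ?thesis by simp
qed

lemma closed_csubspaceD:
  assumes "closed_csubspace L"
  shows "0 \<in> L" "x \<in> L \<Longrightarrow> y \<in> L \<Longrightarrow> x + y \<in> L" "x \<in> L \<Longrightarrow> c *\<^sub>C x \<in> L"
    "x \<in> L \<Longrightarrow> y \<in> L \<Longrightarrow> x - y \<in> L" "x \<in> L \<Longrightarrow> r *\<^sub>R x \<in> L" "closed L"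
    "(\<And>i. i \<in> I \<Longrightarrow> f i \<in> L) \<Longrightarrow> sum f I \<in> L"
  using assms complex_vector.subspace_0 complex_vector.subspace_add complex_vector.subspace_scale
    complex_vector.subspace_diff complex_vector.subspace_sum
  unfolding closed_csubspace_def csubspace_def scaleR_scaleC by metis+

text \<open>A minimising sequence for the distance to \<open>L\<close> is Cauchy by the parallelogram law.\<close>

lemma projection_exists:
  fixes h :: "'h::chilbert_space"
  assumes L: "closed_csubspace L"
  shows "\<exists>p\<in>L. \<forall>k\<in>L. cinner k (h - p) = 0"
proof -
  note LD = closed_csubspaceD[OF L]
  define d where "d = Inf ((\<lambda>k. (norm (h - k))\<^sup>2) ` L)"
  have bdd: "bdd_below ((\<lambda>k. (norm (h - k))\<^sup>2) ` L)" by (rule bdd_belowI[of _ 0]) auto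
  have dle: "d \<le> (norm (h - k))\<^sup>2" if "k \<in> L" for k
    unfolding d_def using bdd that by (intro cInf_lower) auto
  have "\<exists>k\<in>L. (norm (h - k))\<^sup>2 < d + 1 / real (Suc m)" for m
  proof -
    have "\<exists>v\<in>((\<lambda>k. (norm (h - k))\<^sup>2) ` L). v < d + 1 / real (Suc m)"
      unfolding d_def using bdd LD(1) by (intro cInf_lessD) auto
    then show ?thesis by blast
  qed
  then obtain k where k: "\<And>m. k m \<in> L" "\<And>m. (norm (h - k m))\<^sup>2 < d + 1 / real (Suc m)"
    by metis
  have diff: "(norm (k m - k l))\<^sup>2 \<le> 2 / real (Suc m) + 2 / real (Suc l)" for m l
  proof -
    have "(1/2) *\<^sub>R (k m + k l) \<in> L" using k LD by simp
    then have "d \<le> (norm (h - (1/2) *\<^sub>R (k m + k l)))\<^sup>2" by (rule dle)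
    also have "h - (1/2) *\<^sub>R (k m + k l) = (1/2) *\<^sub>R ((h - k m) + (h - k l))"
      by (simp add: algebra_simps flip: scaleR_add_left)
    also have "(norm \<dots>)\<^sup>2 = (1/4) * (norm ((h - k m) + (h - k l)))\<^sup>2"
      by (simp only: norm_scaleR) (simp add: power2_eq_square)
    finally have "4 * d \<le> (norm ((h - k m) + (h - k l)))\<^sup>2" by simp
    moreover have "(h - k m) - (h - k l) = - (k m - k l)" by simp
    then have "norm ((h - k m) - (h - k l)) = norm (k m - k l)" by (simp only: norm_minus_cancel)
    ultimately show ?thesis
      using norm_parallelogram[of "h - k m" "h - k l"] k(2)[of m] k(2)[of l]
      by (simp del: of_nat_Suc)
  qed
  have "Cauchy k"
  proof (rule metric_CauchyI)
    fix e :: real assume e: "e > 0"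
    then have "e\<^sup>2 / 4 > 0" by simp
    then obtain M where M: "1 / real (Suc M) < e\<^sup>2 / 4" using nat_approx_posE by metis
    show "\<exists>M. \<forall>m\<ge>M. \<forall>n\<ge>M. dist (k m) (k n) < e"
    proof (intro exI allI impI)
      fix m n assume mn: "m \<ge> M" "n \<ge> M"
      have le: "1 / real (Suc m) \<le> 1 / real (Suc M)" "1 / real (Suc n) \<le> 1 / real (Suc M)"
        using mn by (auto simp: frac_le)
      have "(norm (k m - k n))\<^sup>2 < e\<^sup>2"
        using diff[of m n] le M by linarith
      then show "dist (k m) (k n) < e"
        using e by (simp add: dist_norm power_less_imp_less_base)
    qed
  qed
  then obtain p where p: "k \<longlonglongrightarrow> p" using Cauchy_convergent convergent_def by blast
  have pL: "p \<in> L" using closed_sequentially[OF LD(6) _ p] k by blast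
  have "(\<lambda>m. (norm (h - k m))\<^sup>2) \<longlonglongrightarrow> (norm (h - p))\<^sup>2" by (intro tendsto_intros p)
  moreover have "(\<lambda>m. d + 1 / real (Suc m)) \<longlonglongrightarrow> d + 0"
    using lim_inverse_n' LIMSEQ_Suc by (intro tendsto_intros) fastforce
  ultimately have pd: "(norm (h - p))\<^sup>2 \<le> d"
    using LIMSEQ_le[of "\<lambda>m. (norm (h - k m))\<^sup>2" "(norm (h - p))\<^sup>2" "\<lambda>m. d + 1 / real (Suc m)" "d + 0"]
      less_imp_le[OF k(2)] by simp
  have "cinner x (h - p) = 0" if x: "x \<in> L" for x
  proof (rule ccontr)
    assume ne: "cinner x (h - p) \<noteq> 0"
    then have x0: "x \<noteq> 0" by auto
    define c where "c = cinner x (h - p) / of_real ((norm x)\<^sup>2)"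
    have "cinner x (h - p - c *\<^sub>C x) = 0"
      using x0 by (simp add: cinner_diff_right cinner_scaleC_right cinner_self c_def)
    then have "cinner (h - p - c *\<^sub>C x) (c *\<^sub>C x) = 0"
      by (subst cinner_commute) (simp add: cinner_scaleC_left)
    then have "(norm (h - p))\<^sup>2 = (norm (h - p - c *\<^sub>C x))\<^sup>2 + (norm (c *\<^sub>C x))\<^sup>2"
      using norm_pythagoras[of "h - p - c *\<^sub>C x" "c *\<^sub>C x"] by simp
    moreover have "d \<le> (norm (h - (p + c *\<^sub>C x)))\<^sup>2" using pL x LD by (intro dle) auto
    then have "d \<le> (norm (h - p - c *\<^sub>C x))\<^sup>2" by (simp add: diff_diff_eq)
    ultimately have "(norm (c *\<^sub>C x))\<^sup>2 \<le> 0" using pd by linarith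
    then show False using x0 ne by (simp add: norm_scaleC c_def)
  qed
  then show ?thesis using pL by blast
qed

definition proj :: "'h::chilbert_space set \<Rightarrow> 'h \<Rightarrow> 'h"
  where "proj L h = (SOME p. p \<in> L \<and> (\<forall>k\<in>L. cinner k (h - p) = 0))"

context
  fixes L :: "'h::chilbert_space set"
  assumes L: "closed_csubspace L"
begin

lemma proj_in: "proj L h \<in> L" and proj_orthogonal: "k \<in> L \<Longrightarrow> cinner k (h - proj L h) = 0"
  using projection_exists[OF L, of h] someI_ex[of "\<lambda>p. p \<in> L \<and> (\<forall>k\<in>L. cinner k (h - p) = 0)"]
  unfolding proj_def by blast+

lemma proj_unique:
  assumes "p \<in> L" "\<And>k. k \<in> L \<Longrightarrow> cinner k (h - p) = 0"
  shows "proj L h = p"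
proof -
  have "proj L h - p \<in> L" using closed_csubspaceD(4)[OF L proj_in assms(1)] .
  then have "cinner (proj L h - p) (h - p) - cinner (proj L h - p) (h - proj L h) = 0"
    using assms(2) proj_orthogonal by simp
  then have "cinner (proj L h - p) (proj L h - p) = 0" by (simp add: cinner_diff_right)
  then show ?thesis by simp
qed

lemma proj_of_mem: "h \<in> L \<Longrightarrow> proj L h = h"
  by (rule proj_unique) auto

lemma proj_of_orthogonal: "(\<And>k. k \<in> L \<Longrightarrow> cinner k h = 0) \<Longrightarrow> proj L h = 0"
  by (rule proj_unique) (auto simp: closed_csubspaceD(1)[OF L])

lemma cinner_proj: "k \<in> L \<Longrightarrow> cinner k (proj L h) = cinner k h"
  using proj_orthogonal[of k h] by (simp add: cinner_diff_right)

lemma cinner_proj_left: "k \<in> L \<Longrightarrow> cinner (proj L h) k = cinner h k"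
  using cinner_proj[of k h] by (metis cinner_commute)

lemma clinear_proj: "clinear (proj L)"
  unfolding clinear_iff
proof (intro conjI allI)
  show "proj L (x + y) = proj L x + proj L y" for x y
    by (rule proj_unique)
      (auto simp: closed_csubspaceD[OF L] proj_in cinner_diff_right cinner_add_right cinner_proj)
  show "proj L (c *\<^sub>C x) = c *\<^sub>C proj L x" for c x
    by (rule proj_unique)
      (auto simp: closed_csubspaceD[OF L] proj_in cinner_diff_right cinner_scaleC_right cinner_proj)
qed

lemma norm_proj_le: "norm (proj L h) \<le> norm h"
proof -
  have "cinner (proj L h) (h - proj L h) = 0" by (rule proj_orthogonal[OF proj_in])
  from norm_pythagoras[OF this] have "(norm (proj L h))\<^sup>2 \<le> (norm h)\<^sup>2" by simp
  then show ?thesis by (rule power2_le_imp_le) simp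
qed

lemma bounded_linear_proj: "bounded_linear (proj L)"
  by (rule bounded_linear_intro[where K = 1]) (auto simp: clinearD[OF clinear_proj] norm_proj_le)

end

text \<open>The kernel of a nonzero functional has a one-dimensional orthogonal complement, which contains the
  representing vector.\<close>

lemma riesz_representation:
  fixes g :: "'h::chilbert_space \<Rightarrow> complex"
  assumes g: "bounded_linear g" "\<And>c x. g (c *\<^sub>C x) = c * g x"
  shows "\<exists>y. \<forall>x. g x = cinner y x"
proof (cases "\<forall>x. g x = 0")
  case False
  then obtain h where h: "g h \<noteq> 0" by blast
  interpret g: bounded_linear g by (rule g(1))
  define K where "K = {x. g x = 0}"
  have K: "closed_csubspace K"
    unfolding closed_csubspace_def csubspace_def[symmetric] complex_vector.subspace_def
  proof (intro conjI ballI allI)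
    have "K = g -` {0}" by (auto simp: K_def)
    then show "closed K" using closed_vimage[of "{0}" g] g.continuous_on[OF continuous_on_id] by simp
  qed (auto simp: K_def g.zero g.add g(2))
  define z where "z = h - proj K h"
  have gz: "g z = g h" using proj_in[OF K, of h] by (simp add: z_def g.diff K_def)
  then have z0: "z \<noteq> 0" using h g.zero by auto
  define y where "y = cnj (g z / of_real ((norm z)\<^sup>2)) *\<^sub>C z"
  have "g x = cinner y x" for x
  proof -
    have "g x *\<^sub>C z - g z *\<^sub>C x \<in> K" by (simp add: K_def g.diff g(2))
    from proj_orthogonal[OF K this, of h] have "cinner (g x *\<^sub>C z - g z *\<^sub>C x) z = 0"
      by (simp add: z_def)
    then have "cinner z (g x *\<^sub>C z - g z *\<^sub>C x) = 0" by (subst cinner_commute) simp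
    then have "g x * of_real ((norm z)\<^sup>2) = g z * cinner z x"
      by (simp add: cinner_diff_right cinner_scaleC_right cinner_self)
    then show ?thesis using z0 by (simp add: y_def cinner_scaleC_left field_simps)
  qed
  then show ?thesis by blast
qed (auto intro: exI[of _ 0])

lemma adjoint_op_eqI:
  assumes "\<And>x y. cinner (blinfun_apply T x) y = cinner x (blinfun_apply T' y)"
  shows "adjoint_op T = T'"
  unfolding adjoint_op_def
proof (rule the_equality)
  fix T'' assume *: "\<forall>x y. cinner (blinfun_apply T x) y = cinner x (blinfun_apply T'' y)"
  show "T'' = T'"
    by (rule blinfun_eqI, rule cinner_eqI) (use * assms in metis)
qed (use assms in blast)

text \<open>The adjoint at \<open>y\<close> is the Riesz vector of \<open>x \<mapsto> \<langle>y, T x\<rangle>\<close>. Together with \<open>adjoint_op_eqI\<close> this shows that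
  \<open>adjoint_op\<close> is not a default value for complex-linear operators.\<close>

lemma adjoint_exists:
  fixes T :: "'h::chilbert_space \<Rightarrow>\<^sub>L 'h"
  assumes "clinear (blinfun_apply T)"
  shows "\<exists>T'. \<forall>x y. cinner (blinfun_apply T x) y = cinner x (blinfun_apply T' y)"
proof -
  have "\<exists>z. \<forall>x. cinner y (blinfun_apply T x) = cinner z x" for y
  proof (rule riesz_representation)
    show "bounded_linear (\<lambda>x. cinner y (blinfun_apply T x))"
      by (intro bounded_linear_compose[OF bounded_bilinear.bounded_linear_right[OF bounded_bilinear_cinner]]
          blinfun.bounded_linear_right)
  qed (simp add: clinearD[OF assms] cinner_scaleC_right)
  then obtain a where a: "\<And>y x. cinner y (blinfun_apply T x) = cinner (a y) x" by metis
  have a': "cinner x (a y) = cinner (blinfun_apply T x) y" for x y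
    using a[of y x] by (metis cinner_commute)
  have n: "norm (a y) \<le> norm y * norm T" for y
  proof (cases "a y = 0")
    case False
    have "(norm (a y))\<^sup>2 = cmod (cinner (a y) (a y))"
      by (simp add: cinner_self norm_power)
    also have "\<dots> = cmod (cinner (blinfun_apply T (a y)) y)"
      by (simp only: a')
    also have "\<dots> \<le> norm (blinfun_apply T (a y)) * norm y" by (rule cinner_Cauchy_Schwarz)
    also have "\<dots> \<le> norm T * norm (a y) * norm y"
      by (intro mult_right_mono norm_blinfun) auto
    finally show ?thesis using False by (simp add: power2_eq_square mult_ac)
  qed simp
  have "bounded_linear a"
  proof (rule bounded_linear_intro[OF _ _ n])
    show "a (x + y) = a x + a y" for x y
      by (rule cinner_eqI) (simp add: a' cinner_add_right)
    show "a (r *\<^sub>R x) = r *\<^sub>R a x" for r x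
      by (rule cinner_eqI) (simp add: a' cinner_scaleR_right)
  qed
  then show ?thesis using a' by (intro exI[of _ "Blinfun a"]) (simp add: bounded_linear_Blinfun_apply)
qed

lemma cinner_adjoint_op:
  assumes "clinear (blinfun_apply T)"
  shows "cinner (blinfun_apply T x) y = cinner x (blinfun_apply (adjoint_op T) y)"
  using adjoint_exists[OF assms] adjoint_op_eqI by metis

section \<open>Orthonormal families\<close>

definition orthonormal :: "nat \<Rightarrow> (nat \<Rightarrow> 'h::chilbert_space) \<Rightarrow> bool"
  where "orthonormal n e \<longleftrightarrow> (\<forall>i<n. \<forall>j<n. cinner (e i) (e j) = (if i = j then 1 else 0))"

definition comb :: "nat \<Rightarrow> (nat \<Rightarrow> 'h::chilbert_space) \<Rightarrow> (nat \<Rightarrow> complex) \<Rightarrow> 'h"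
  where "comb n e c = (\<Sum>i<n. c i *\<^sub>C e i)"

lemma cinner_comb_right:
  assumes "orthonormal n e" "i < n"
  shows "cinner (e i) (comb n e c) = c i"
proof -
  have "cinner (e i) (comb n e c) = (\<Sum>j<n. c j * (if i = j then 1 else 0))"
    unfolding comb_def cinner_sum_right using assms
    by (intro sum.cong) (auto simp: cinner_scaleC_right orthonormal_def)
  then show ?thesis using assms(2) by (simp add: if_distrib sum.delta cong: if_cong)
qed

lemma norm_comb:
  assumes "orthonormal n e"
  shows "(norm (comb n e c))\<^sup>2 = (\<Sum>i<n. (cmod (c i))\<^sup>2)"
proof -
  have "cinner (comb n e c) (comb n e c) = (\<Sum>i<n. cnj (c i) * c i)"
    by (subst (1) comb_def)
      (auto simp: cinner_sum_left cinner_scaleC_left cinner_comb_right[OF assms] intro!: sum.cong)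
  also have "\<dots> = of_real (\<Sum>i<n. (cmod (c i))\<^sup>2)"
    by (simp add: complex_norm_square mult.commute del: of_real_power)
  finally show ?thesis unfolding cinner_self of_real_eq_iff .
qed

lemma comb_add: "comb n e (\<lambda>i. c i + d i) = comb n e c + comb n e d"
  by (simp add: comb_def scaleC_add_left sum.distrib)

lemma comb_scaleC: "comb n e (\<lambda>i. a * c i) = a *\<^sub>C comb n e c"
  by (simp add: comb_def complex_vector.scale_sum_right scaleC_scaleC)

lemma cspan_eq_range_comb: "cspan (e ` {..<n}) = range (comb n e)"
proof
  show "range (comb n e) \<subseteq> cspan (e ` {..<n})"
    unfolding comb_def
    by (clarify, rule complex_vector.span_sum, rule complex_vector.span_scale,
        rule complex_vector.span_base, simp)
  have "csubspace (range (comb n e))"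
    unfolding complex_vector.subspace_def
  proof (intro conjI ballI allI)
    show "0 \<in> range (comb n e)" by (rule range_eqI[of _ _ "\<lambda>_. 0"]) (simp add: comb_def)
    show "x + y \<in> range (comb n e)" if "x \<in> range (comb n e)" "y \<in> range (comb n e)" for x y
      using that by (auto simp: comb_add[symmetric])
    show "a *\<^sub>C x \<in> range (comb n e)" if "x \<in> range (comb n e)" for a x
      using that by (auto simp: comb_scaleC[symmetric])
  qed
  moreover have "e ` {..<n} \<subseteq> range (comb n e)"
  proof safe
    fix i assume i: "i < n"
    have "e i = comb n e (\<lambda>j. if j = i then 1 else 0)"
      using i by (simp add: comb_def if_distrib[of "\<lambda>c. c *\<^sub>C _"] scaleC_one sum.delta cong: if_cong)
    then show "e i \<in> range (comb n e)" by blast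
  qed
  ultimately show "cspan (e ` {..<n}) \<subseteq> range (comb n e)"
    by (rule complex_vector.span_minimal[rotated])
qed

context
  fixes n :: nat and e :: "nat \<Rightarrow> 'h::chilbert_space"
  assumes on: "orthonormal n e"
begin

lemma orthonormal_expansion:
  "x \<in> cspan (e ` {..<n}) \<longleftrightarrow> comb n e (\<lambda>i. cinner (e i) x) = x"
proof
  assume "x \<in> cspan (e ` {..<n})"
  then obtain c where c: "x = comb n e c" unfolding cspan_eq_range_comb by blast
  have "comb n e (\<lambda>i. cinner (e i) x) = comb n e c"
    unfolding c by (subst (1) comb_def) (auto simp: comb_def cinner_comb_right[OF on, unfolded comb_def] intro!: sum.cong)
  then show "comb n e (\<lambda>i. cinner (e i) x) = x" by (simp add: c)
qed (metis cspan_eq_range_comb rangeI)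

lemma closed_csubspace_cspan: "closed_csubspace (cspan (e ` {..<n}))"
proof -
  have "continuous_on UNIV (\<lambda>x. \<Sum>i<n. cinner (e i) x *\<^sub>C e i)"
    by (intro continuous_on_sum bounded_bilinear.continuous_on[OF bounded_bilinear_scaleC]
        bounded_bilinear.continuous_on[OF bounded_bilinear_cinner] continuous_intros)
  then have "closed {x. comb n e (\<lambda>i. cinner (e i) x) = x}"
    unfolding comb_def by (rule closed_Collect_eq) (rule continuous_on_id)
  moreover have "{x. comb n e (\<lambda>i. cinner (e i) x) = x} = cspan (e ` {..<n})"
    using orthonormal_expansion by blast
  ultimately show ?thesis
    by (simp add: closed_csubspace_def complex_vector.subspace_span)
qed

lemma proj_cspan: "proj (cspan (e ` {..<n})) x = comb n e (\<lambda>i. cinner (e i) x)"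
proof (rule proj_unique[OF closed_csubspace_cspan])
  show "comb n e (\<lambda>i. cinner (e i) x) \<in> cspan (e ` {..<n})"
    unfolding cspan_eq_range_comb by blast
  fix k assume "k \<in> cspan (e ` {..<n})"
  then obtain c where c: "k = comb n e c" unfolding cspan_eq_range_comb by blast
  show "cinner k (x - comb n e (\<lambda>i. cinner (e i) x)) = 0"
    unfolding c by (subst (1) comb_def)
      (auto simp: cinner_sum_left cinner_scaleC_left cinner_diff_right cinner_comb_right[OF on] intro!: sum.neutral)
qed

lemma orthonormal_inj: "inj_on e {..<n}"
  using on unfolding inj_on_def orthonormal_def by (metis lessThan_iff zero_neq_one)

lemma orthonormal_independent: "\<not> cdependent (e ` {..<n})"
proof -
  have "\<not> (\<exists>u. (\<exists>v\<in>e ` {..<n}. u v \<noteq> 0) \<and> (\<Sum>v\<in>e ` {..<n}. u v *\<^sub>C v) = 0)"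
  proof safe
    fix u i assume i: "i < n" "u (e i) \<noteq> 0" and 0: "(\<Sum>v\<in>e ` {..<n}. u v *\<^sub>C v) = 0"
    have "comb n e (\<lambda>i. u (e i)) = 0"
      using 0 by (simp add: comb_def sum.reindex[OF orthonormal_inj])
    then show False using cinner_comb_right[OF on i(1), of "\<lambda>i. u (e i)"] i(2) by simp
  qed
  then show ?thesis by (subst complex_vector.dependent_finite) auto
qed

lemma orthonormal_has_cdim: "has_cdim (cspan (e ` {..<n})) n"
  unfolding has_cdim_def
  using orthonormal_independent card_image[OF orthonormal_inj] by (intro exI[of _ "e ` {..<n}"]) simp

lemma orthonormal_extend:
  assumes x: "x \<notin> cspan (e ` {..<n})"
  obtains v where "orthonormal (Suc n) (e(n := v))" "v \<in> cspan (insert x (e ` {..<n}))"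
proof
  let ?S = "cspan (e ` {..<n})"
  let ?z = "x - proj ?S x"
  let ?v = "(1 / norm ?z) *\<^sub>R ?z"
  have z: "?z \<noteq> 0" using x proj_in[OF closed_csubspace_cspan, of x] by auto
  have ei: "cinner (e i) ?v = 0" if "i < n" for i
    using proj_orthogonal[OF closed_csubspace_cspan, of "e i" x] that
    by (simp add: cinner_scaleR_right complex_vector.span_base)
  then have ei': "cinner ?v (e i) = 0" if "i < n" for i
    using that by (metis cinner_commute complex_cnj_zero)
  have "norm ?v = 1" using z by simp
  then have vv: "cinner ?v ?v = 1" unfolding cinner_self by simp
  show "orthonormal (Suc n) (e(n := ?v))"
    using on ei ei' vv unfolding orthonormal_def less_Suc_eq by auto
  have "?S \<subseteq> cspan (insert x (e ` {..<n}))" by (intro complex_vector.span_mono) auto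
  then have "proj ?S x \<in> cspan (insert x (e ` {..<n}))"
    using proj_in[OF closed_csubspace_cspan, of x] by blast
  then show "?v \<in> cspan (insert x (e ` {..<n}))"
    unfolding scaleR_scaleC
    by (rule complex_vector.span_scale[OF complex_vector.span_diff[OF complex_vector.span_base[OF insertI1]]])
qed

end

lemma norm_orthonormal: "orthonormal n e \<Longrightarrow> i < n \<Longrightarrow> norm (e i) = 1"
  using Re_cinner_self[of "e i"] power_eq_1_iff[of "norm (e i)" 2] by (simp add: orthonormal_def)

lemma orthonormal_nonzero: "orthonormal n e \<Longrightarrow> i < n \<Longrightarrow> e i \<noteq> 0"
  unfolding orthonormal_def by (metis cinner_zero_left zero_neq_one)

lemma orthonormal_card_le:
  assumes "orthonormal m f" "f ` {..<m} \<subseteq> cspan B" "finite B"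
  shows "m \<le> card B"
  using complex_vector.independent_span_bound[OF assms(3) orthonormal_independent[OF assms(1)] assms(2)]
    card_image[OF orthonormal_inj[OF assms(1)]] by simp

lemma has_cdim_unique:
  assumes "has_cdim L m" "has_cdim L n"
  shows "m = n"
  using assms complex_vector.dim_eq_card unfolding has_cdim_def by metis

text \<open>An orthonormal family in \<open>K\<close> of maximal length spans \<open>K\<close>, since otherwise it could be extended.\<close>

lemma finite_dim_orthonormal_basis:
  fixes K :: "'h::chilbert_space set"
  assumes "csubspace K" "K \<subseteq> cspan B" "finite B"
  obtains n e where "orthonormal n e" "cspan (e ` {..<n}) = K"
proof -
  let ?P = "\<lambda>n. \<exists>e. orthonormal n e \<and> e ` {..<n} \<subseteq> K"
  have bound: "n \<le> card B" if "?P n" for n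
    using that orthonormal_card_le[OF _ _ assms(3)] assms(2) by (meson order_trans)
  have "?P 0" by (simp add: orthonormal_def)
  then have n: "?P (Greatest ?P)" "\<And>m. ?P m \<Longrightarrow> m \<le> Greatest ?P"
    using GreatestI_nat[of ?P 0 "card B"] Greatest_le_nat[of ?P _ "card B"] bound by blast+
  define n where "n = Greatest ?P"
  note n = n[folded n_def]
  then obtain e where e: "orthonormal n e" "e ` {..<n} \<subseteq> K" by blast
  have sub: "cspan (e ` {..<n}) \<subseteq> K"
    using e(2) assms(1) by (rule complex_vector.span_minimal)
  have "K \<subseteq> cspan (e ` {..<n})"
  proof (rule ccontr)
    assume "\<not> K \<subseteq> cspan (e ` {..<n})"
    then obtain x where x: "x \<in> K" "x \<notin> cspan (e ` {..<n})" by blast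
    obtain v where v: "orthonormal (Suc n) (e(n := v))" "v \<in> cspan (insert x (e ` {..<n}))"
      by (rule orthonormal_extend[OF e(1) x(2)])
    have "v \<in> K" using v(2) complex_vector.span_minimal[of "insert x (e ` {..<n})" K] x e assms(1) by auto
    then have "(e(n := v)) ` {..<Suc n} \<subseteq> K" using e(2) by (auto simp: less_Suc_eq)
    then have "Suc n \<le> n" using n(2)[of "Suc n"] v(1) by blast
    then show False by simp
  qed
  then show ?thesis using that[OF e(1)] sub by blast
qed

lemma has_cdim_orthonormal_basis:
  assumes "has_cdim (L::'h::chilbert_space set) n"
  obtains e where "orthonormal n e" "cspan (e ` {..<n}) = L"
proof -
  obtain B where B: "finite B" "cspan B = L" using assms by (auto simp: has_cdim_def)
  have "csubspace L" using B(2) complex_vector.subspace_span by blast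
  then obtain m e where e: "orthonormal m e" "cspan (e ` {..<m}) = L"
    using finite_dim_orthonormal_basis[of L B] B by blast
  then have "m = n" using has_cdim_unique orthonormal_has_cdim assms by blast
  then show ?thesis using that e by blast
qed

text \<open>Step \<open>n\<close> of the construction changes the family at the index \<open>n\<close> only, so the values stabilise.\<close>

lemma infinite_orthonormal_sequence:
  assumes "infinite_cdim TYPE('h::chilbert_space)"
  obtains u :: "nat \<Rightarrow> 'h::chilbert_space" where "\<And>n. orthonormal n u"
proof -
  have step: "\<exists>v. orthonormal n e \<longrightarrow> orthonormal (Suc n) (e(n := v))" for n and e :: "nat \<Rightarrow> 'h"
  proof (cases "orthonormal n e")
    case True
    have "cspan (e ` {..<n}) \<noteq> UNIV"
      using orthonormal_has_cdim[OF True] assms unfolding infinite_cdim_def by metis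
    then obtain x where "x \<notin> cspan (e ` {..<n})" by blast
    then show ?thesis using orthonormal_extend[OF True] by metis
  qed simp
  then obtain F where F: "\<And>n e. orthonormal n e \<Longrightarrow> orthonormal (Suc n) (e(n := F n (e :: nat \<Rightarrow> 'h)))"
    by metis
  define E where "E = rec_nat (\<lambda>_. 0) (\<lambda>n e. e(n := F n e))"
  have E: "E (Suc n) = (E n)(n := F n (E n))" for n by (simp add: E_def)
  have on: "orthonormal n (E n)" for n
  proof (induction n)
    case (Suc n)
    show ?case unfolding E by (rule F[OF Suc])
  qed (simp add: orthonormal_def)
  have stable: "E (Suc i + k) i = E (Suc i) i" for i k
    by (induction k) (simp_all add: E)
  have "orthonormal n (\<lambda>i. E (Suc i) i)" for n
    unfolding orthonormal_def
  proof (intro allI impI)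
    fix i j assume "i < n" "j < n"
    then have "E n i = E (Suc i) i" "E n j = E (Suc j) j"
      using stable[of i "n - Suc i"] stable[of j "n - Suc j"] by simp_all
    then show "cinner (E (Suc i) i) (E (Suc j) j) = (if i = j then 1 else 0)"
      using on[of n] \<open>i < n\<close> \<open>j < n\<close> unfolding orthonormal_def by metis
  qed
  then show ?thesis by (rule that)
qed

section \<open>Extreme functionals below a sublinear functional\<close>

definition sublinear :: "('a::real_vector \<Rightarrow> real) \<Rightarrow> bool"
  where "sublinear p \<longleftrightarrow> (\<forall>x y. p (x + y) \<le> p x + p y) \<and> (\<forall>r x. r \<ge> 0 \<longrightarrow> p (r *\<^sub>R x) = r * p x)"

lemma sublinearD:
  assumes "sublinear p"
  shows "p (x + y) \<le> p x + p y" "r \<ge> 0 \<Longrightarrow> p (r *\<^sub>R x) = r * p x" "p 0 = 0" "- p (- x) \<le> p x"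
    "p x - p y \<le> p (x - y)"
proof -
  show 1: "p (x + y) \<le> p x + p y" for x y using assms by (simp add: sublinear_def)
  show "r \<ge> 0 \<Longrightarrow> p (r *\<^sub>R x) = r * p x" using assms by (simp add: sublinear_def)
  have "p (0 *\<^sub>R 0) = 0 * p 0" using assms unfolding sublinear_def by blast
  then show 0: "p 0 = 0" by simp
  show "- p (- x) \<le> p x" using 1[of x "- x"] 0 by simp
  show "p x - p y \<le> p (x - y)" using 1[of "x - y" y] by simp
qed

text \<open>The upper envelope of the linear functionals \<open>f \<le> p\<close> with \<open>f a = p a\<close>. These form the face on which
  \<open>f \<mapsto> f a\<close> is maximal.\<close>

definition face_at :: "'a::real_vector \<Rightarrow> ('a \<Rightarrow> real) \<Rightarrow> 'a \<Rightarrow> real"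
  where "face_at a p x = (INF t\<in>{0..}. p (x + t *\<^sub>R a) - t * p a)"

context
  fixes p :: "'a::real_vector \<Rightarrow> real" and a :: 'a
  assumes p: "sublinear p"
begin

lemma face_at_bdd: "bdd_below ((\<lambda>t. p (x + t *\<^sub>R a) - t * p a) ` {0..})"
proof (rule bdd_belowI2)
  fix t :: real assume "t \<in> {0..}"
  then have "t * p a = p (t *\<^sub>R a)" using sublinearD(2)[OF p] by simp
  also have "\<dots> \<le> p (x + t *\<^sub>R a) + p (- x)"
    using sublinearD(1)[OF p, of "x + t *\<^sub>R a" "- x"] by simp
  finally show "- p (- x) \<le> p (x + t *\<^sub>R a) - t * p a" by simp
qed

lemma face_at_le: "t \<ge> 0 \<Longrightarrow> face_at a p x \<le> p (x + t *\<^sub>R a) - t * p a"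
  unfolding face_at_def by (rule cINF_lower[OF face_at_bdd]) simp

lemma face_at_le_self: "face_at a p x \<le> p x"
  using face_at_le[of 0 x] by simp

lemma face_at_minus: "face_at a p (- a) \<le> - p a"
  using face_at_le[of 1 "- a"] sublinearD(3)[OF p] by simp

lemma face_at_greatest:
  "(\<And>t. t \<ge> 0 \<Longrightarrow> c \<le> p (x + t *\<^sub>R a) - t * p a) \<Longrightarrow> c \<le> face_at a p x"
  unfolding face_at_def by (rule cINF_greatest) auto

lemma sublinear_face_at: "sublinear (face_at a p)"
  unfolding sublinear_def
proof (intro conjI allI impI)
  fix x y
  have "face_at a p (x + y) - face_at a p y \<le> face_at a p x"
  proof (rule face_at_greatest)
    fix t :: real assume t: "t \<ge> 0"
    have "face_at a p (x + y) - (p (x + t *\<^sub>R a) - t * p a) \<le> face_at a p y"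
    proof (rule face_at_greatest)
      fix s :: real assume s: "s \<ge> 0"
      have "face_at a p (x + y) \<le> p ((x + y) + (t + s) *\<^sub>R a) - (t + s) * p a"
        using s t by (intro face_at_le) simp
      also have "(x + y) + (t + s) *\<^sub>R a = (x + t *\<^sub>R a) + (y + s *\<^sub>R a)" by (simp add: algebra_simps)
      finally show "face_at a p (x + y) - (p (x + t *\<^sub>R a) - t * p a) \<le> p (y + s *\<^sub>R a) - s * p a"
        using sublinearD(1)[OF p, of "x + t *\<^sub>R a" "y + s *\<^sub>R a"] by (simp add: algebra_simps)
    qed
    then show "face_at a p (x + y) - face_at a p y \<le> p (x + t *\<^sub>R a) - t * p a" by simp
  qed
  then show "face_at a p (x + y) \<le> face_at a p x + face_at a p y" by simp
next
  have z: "face_at a p 0 = 0"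
  proof (rule antisym)
    show "face_at a p 0 \<le> 0" using face_at_le_self[of 0] sublinearD(3)[OF p] by simp
    show "0 \<le> face_at a p 0" by (rule face_at_greatest) (simp add: sublinearD(2)[OF p])
  qed
  have le: "r * face_at a p x \<le> face_at a p (r *\<^sub>R x)" if r: "r > 0" for r x
  proof (rule face_at_greatest)
    fix t :: real assume t: "t \<ge> 0"
    have "face_at a p x \<le> p (x + (t / r) *\<^sub>R a) - (t / r) * p a"
      using r t by (intro face_at_le) simp
    then have "r * face_at a p x \<le> r * (p (x + (t / r) *\<^sub>R a) - (t / r) * p a)"
      using r by (intro mult_left_mono) auto
    also have "\<dots> = p (r *\<^sub>R (x + (t / r) *\<^sub>R a)) - t * p a"
      using r by (subst sublinearD(2)[OF p]) (auto simp: algebra_simps)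
    also have "r *\<^sub>R (x + (t / r) *\<^sub>R a) = r *\<^sub>R x + t *\<^sub>R a"
      using r by (simp add: scaleR_add_right)
    finally show "r * face_at a p x \<le> p (r *\<^sub>R x + t *\<^sub>R a) - t * p a" .
  qed
  fix r :: real and x assume "r \<ge> 0"
  then consider "r = 0" | "r > 0" by linarith
  then show "face_at a p (r *\<^sub>R x) = r * face_at a p x"
  proof cases
    case 2
    have "(1 / r) * face_at a p (r *\<^sub>R x) \<le> face_at a p ((1 / r) *\<^sub>R r *\<^sub>R x)"
      using 2 by (intro le) simp
    then have "face_at a p (r *\<^sub>R x) \<le> r * face_at a p x"
      using 2 by (simp add: field_simps)
    then show ?thesis using le[OF 2, of x] by simp
  qed (simp add: z)
qed

end

text \<open>Cut down the set of functionals below \<open>p\<close> to the faces at \<open>a 0\<close>, \<open>a 1\<close> and so on. The limit \<open>f\<close> of the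
  decreasing sublinear functionals satisfies \<open>f (- a k) = - f (a k)\<close>, which extends to all vectors by density and makes
  \<open>f\<close> linear. If \<open>f\<close> is a proper convex combination of two functionals below \<open>p\<close>, then by maximality at \<open>a k\<close> both of
  them lie in every face, so they are dominated by \<open>f\<close> and hence equal to it.\<close>

lemma extreme_functional_exists:
  fixes p :: "'a::real_normed_vector \<Rightarrow> real" and a :: "nat \<Rightarrow> 'a"
  assumes p: "sublinear p" and K: "\<And>x. p x \<le> K * norm x"
    and dense: "closure (range a) = UNIV"
  obtains f where "linear f" "\<And>x. f x \<le> p x" "f (a 0) = p (a 0)"
    "\<forall>g h t. linear g \<longrightarrow> linear h \<longrightarrow> (\<forall>x. g x \<le> p x) \<longrightarrow> (\<forall>x. h x \<le> p x) \<longrightarrow>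
       0 < t \<longrightarrow> t < 1 \<longrightarrow> (\<forall>x. f x = t * g x + (1 - t) * h x) \<longrightarrow> g = f"
proof -
  define P where "P = rec_nat p (\<lambda>k. face_at (a k))"
  have P: "P 0 = p" "P (Suc k) = face_at (a k) (P k)" for k by (simp_all add: P_def)
  have sub: "sublinear (P k)" for k
    by (induction k) (simp_all add: P p sublinear_face_at)
  have dec: "P (Suc k) x \<le> P k x" for k x
    unfolding P(2) by (rule face_at_le_self[OF sub])
  then have decs: "decseq (\<lambda>k. P k x)" for x by (simp add: decseq_Suc_iff)
  have lep: "P k x \<le> p x" for k x using decs[of x] P(1) unfolding decseq_def by (metis le0)
  have bdd: "bdd_below (range (\<lambda>k. P k x))" for x
    by (rule bdd_belowI2[of _ "- p (- x)"]) (use sublinearD(4)[OF sub] lep[of _ "- x"] in \<open>smt (verit)\<close>)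
  define f where "f x = (INF k. P k x)" for x
  have fle: "f x \<le> P k x" for k x unfolding f_def by (rule cINF_lower[OF bdd]) simp
  have lim: "(\<lambda>k. P k x) \<longlonglongrightarrow> f x" for x
    unfolding f_def by (rule LIMSEQ_decseq_INF[OF bdd decs])
  have fsub: "sublinear f"
    unfolding sublinear_def
  proof (intro conjI allI impI)
    fix x y
    show "f (x + y) \<le> f x + f y"
      by (rule LIMSEQ_le[OF lim tendsto_add[OF lim lim]]) (use sublinearD(1)[OF sub] in blast)
    fix r :: real assume "r \<ge> 0"
    then have "(\<lambda>k. P k (r *\<^sub>R x)) = (\<lambda>k. r * P k x)" using sublinearD(2)[OF sub] by auto
    then show "f (r *\<^sub>R x) = r * f x"
      using lim[of "r *\<^sub>R x"] tendsto_mult_left[OF lim, of r x] LIMSEQ_unique by metis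
  qed
  have fK: "f x \<le> K * norm x" for x using fle[of x 0] K[of x] P(1) by simp
  have at: "f (- a k) \<le> - P k (a k)" for k
    using fle[of "- a k" "Suc k"] face_at_minus[OF sub, of "a k" k] P(2) by simp
  then have eqP: "f (a k) = P k (a k)" for k
    using sublinearD(4)[OF fsub, of "a k"] fle[of "a k" k] by (smt (verit))
  have cont: "continuous_on UNIV f"
  proof (rule continuous_at_imp_continuous_on, rule ballI)
    fix x
    have K0: "K \<ge> 0 \<or> (\<forall>y. norm (y::'a) = 0)"
    proof (rule ccontr)
      assume "\<not> ?thesis"
      then obtain y :: 'a where y: "K < 0" "norm y > 0" by auto
      have "f y + f (- y) < 0" using fK[of y] fK[of "- y"] mult_neg_pos[OF y] by simp
      then show False using sublinearD(4)[OF fsub, of y] by simp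
    qed
    have "\<bar>f y - f x\<bar> \<le> \<bar>K\<bar> * norm (y - x)" for y
    proof (cases "K \<ge> 0")
      case True
      then show ?thesis
        using sublinearD(5)[OF fsub, of y x] sublinearD(5)[OF fsub, of x y] fK[of "x - y"] fK[of "y - x"]
        by (simp add: norm_minus_commute)
    next
      case False
      then have "y = x" using K0 by (metis norm_eq_zero)
      then show ?thesis by simp
    qed
    moreover have "((\<lambda>y. \<bar>K\<bar> * norm (y - x)) \<longlongrightarrow> 0) (at x)"
      by (auto intro!: tendsto_eq_intros)
    ultimately have "((\<lambda>y. f y - f x) \<longlongrightarrow> 0) (at x)"
      by (intro Lim_null_comparison[of "\<lambda>y. f y - f x" "\<lambda>y. \<bar>K\<bar> * norm (y - x)"]) simp_all
    then show "isCont f x"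
      unfolding isCont_def by (rule LIM_zero_cancel)
  qed
  have odd: "f (- x) = - f x" for x
  proof -
    have "closed {x. f (- x) + f x = 0}"
      by (intro closed_Collect_eq continuous_intros cont
          continuous_on_compose2[OF cont, of UNIV uminus]) auto
    moreover have "f (- a k) + f (a k) = 0" for k
      using at[of k] eqP[of k] sublinearD(4)[OF fsub, of "a k"] by simp
    then have "range a \<subseteq> {x. f (- x) + f x = 0}" by auto
    ultimately have "closure (range a) \<subseteq> {x. f (- x) + f x = 0}" by (rule closure_minimal[rotated])
    then show ?thesis using dense by (simp add: add_eq_0_iff2 set_eq_iff subset_iff)
  qed
  have "linear f"
  proof (rule linearI)
    fix x y
    have "f (- x + - y) \<le> f (- x) + f (- y)" by (rule sublinearD(1)[OF fsub])
    then have "f x + f y \<le> f (x + y)" using odd[of "x + y"] by (simp add: odd)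
    then show "f (x + y) = f x + f y" using sublinearD(1)[OF fsub, of x y] by simp
  next
    fix r x
    show "f (r *\<^sub>R x) = r *\<^sub>R f x"
    proof (cases "r \<ge> 0")
      case True then show ?thesis using sublinearD(2)[OF fsub] by simp
    next
      case False
      then have "f (- ((- r) *\<^sub>R x)) = - (- r * f x)"
        using sublinearD(2)[OF fsub, of "- r" x] odd by (metis linorder_not_le neg_0_le_iff_le less_imp_le)
      then show ?thesis by simp
    qed
  qed
  moreover have "f x \<le> p x" for x using fle[of x 0] P(1) by simp
  moreover have "f (a 0) = p (a 0)" using eqP[of 0] P(1) by simp
  moreover have "g = f"
    if g: "linear g" "linear h" "\<And>x. g x \<le> p x" "\<And>x. h x \<le> p x" "0 < t" "t < 1"
      "\<And>x. f x = t * g x + (1 - t) * h x" for g h t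
  proof -
    have "(\<forall>x. g x \<le> P k x) \<and> (\<forall>x. h x \<le> P k x)" for k
    proof (induction k)
      case (Suc k)
      have eq: "g (a k) = P k (a k)" "h (a k) = P k (a k)"
      proof -
        have le: "g (a k) \<le> P k (a k)" "h (a k) \<le> P k (a k)" using Suc by auto
        have "t * (P k (a k) - g (a k)) + (1 - t) * (P k (a k) - h (a k)) = 0"
          using g(7)[of "a k"] eqP[of k] by (simp add: algebra_simps)
        moreover have "t * (P k (a k) - g (a k)) \<ge> 0" "(1 - t) * (P k (a k) - h (a k)) \<ge> 0"
          using le g by auto
        ultimately have "t * (P k (a k) - g (a k)) = 0" "(1 - t) * (P k (a k) - h (a k)) = 0"
          by linarith+
        then show "g (a k) = P k (a k)" "h (a k) = P k (a k)" using g(5,6) by auto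
      qed
      have "l x \<le> P (Suc k) x" if l: "linear l" "\<forall>x. l x \<le> P k x" "l (a k) = P k (a k)" for l x
        unfolding P(2)
      proof (rule face_at_greatest[OF sub])
        fix s :: real assume "s \<ge> 0"
        have "l x = l (x + s *\<^sub>R a k) - s * l (a k)"
          by (simp add: linear_add[OF l(1)] linear_scale[OF l(1)])
        then show "l x \<le> P k (x + s *\<^sub>R a k) - s * P k (a k)"
          using l(2)[rule_format, of "x + s *\<^sub>R a k"] l(3) by simp
      qed
      then show ?case using Suc eq g(1,2) by blast
    qed (use g P(1) in simp)
    then have gf: "g x \<le> f x" for x using LIMSEQ_le_const[OF lim] by blast
    have "f x \<le> g x" for x
      using gf[of "- x"] odd[of x] linear_neg[OF g(1), of x] by simp
    then show "g = f" using gf by (intro ext antisym)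
  qed
  ultimately show ?thesis using that by blast
qed

section \<open>C*-seminorms and their pure states\<close>

text \<open>The two seminorms of interest are the norm of the algebra and \<open>x \<mapsto> norm (\<pi> x)\<close> for a representation \<open>\<pi>\<close>.
  The last two conditions are what positivity of \<open>x\<^sup>* x\<close> means in terms of the seminorm: they locate the spectrum of
  \<open>x\<^sup>* x\<close> between \<open>0\<close> and \<open>(q x)\<^sup>2\<close>, with the upper end attained.\<close>

locale cstar_seminorm =
  fixes q :: "'a::cstar_algebra \<Rightarrow> real" and K :: real
  assumes q_add: "q (x + y) \<le> q x + q y"
    and q_scaleC: "q (c *\<^sub>C x) = cmod c * q x"
    and q_mult: "q (x * y) \<le> q x * q y"
    and q_star: "q (star x) = q x"
    and q_one: "q 1 = 1"
    and q_le_norm: "q x \<le> K * norm x"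
    and q_diff: "(q x)\<^sup>2 \<le> r \<Longrightarrow> q (r *\<^sub>R 1 - star x * x) \<le> r"
    and q_sum: "r \<ge> 0 \<Longrightarrow> r + (q x)\<^sup>2 \<le> q (r *\<^sub>R 1 + star x * x)"
begin

lemma q_scaleR: "q (r *\<^sub>R x) = \<bar>r\<bar> * q x"
  by (simp add: scaleR_scaleC q_scaleC)

lemma q_zero [simp]: "q 0 = 0"
  using q_scaleR[of 0 0] by simp

lemma q_minus: "q (- x) = q x"
  using q_scaleR[of "- 1" x] by simp

lemma q_nonneg: "q x \<ge> 0"
  using q_add[of x "- x"] by (simp add: q_minus)

lemma q_power: "q (x ^ m) \<le> q x ^ m"
proof (induction m)
  case (Suc m)
  have "q (x ^ Suc m) \<le> q x * q (x ^ m)" using q_mult[of x "x ^ m"] by simp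
  also have "\<dots> \<le> q x * q x ^ m" using Suc q_nonneg by (rule mult_left_mono)
  finally show ?case by simp
qed (simp add: q_one)

definition re_part :: "'a \<Rightarrow> 'a"
  where "re_part x = (1/2) *\<^sub>R (x + star x)"

lemma re_part_simps:
  "re_part (x + y) = re_part x + re_part y" "re_part (r *\<^sub>R x) = r *\<^sub>R re_part x"
  "star x = x \<Longrightarrow> re_part x = x" "star x = - x \<Longrightarrow> re_part x = 0" "re_part (- x) = - re_part x"
  by (simp_all add: re_part_def star_add star_scaleR scaleR_add_right scaleR_diff_right star_minus flip: scaleR_add_left)

lemma q_re_part: "q (re_part x) \<le> q x"
  using q_add[of x "star x"] by (simp add: re_part_def q_scaleR q_star)

text \<open>The maximum of the spectrum of the real part of \<open>x\<close>.\<close>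

definition smax :: "'a \<Rightarrow> real"
  where "smax x = (INF r\<in>{0..}. q (r *\<^sub>R 1 + re_part x) - r)"

lemma smax_bdd: "bdd_below ((\<lambda>r. q (r *\<^sub>R 1 + re_part x) - r) ` {0..})"
proof (rule bdd_belowI2)
  fix r :: real assume r: "r \<in> {0..}"
  have "q (r *\<^sub>R 1) \<le> q (r *\<^sub>R 1 + re_part x) + q (- re_part x)"
    using q_add[of "r *\<^sub>R 1 + re_part x" "- re_part x"] by simp
  then show "- q (re_part x) \<le> q (r *\<^sub>R 1 + re_part x) - r"
    using r by (simp add: q_scaleR q_one q_minus)
qed

lemma smax_le: "r \<ge> 0 \<Longrightarrow> smax x \<le> q (r *\<^sub>R 1 + re_part x) - r"
  unfolding smax_def by (rule cINF_lower[OF smax_bdd]) simp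

lemma smax_greatest: "(\<And>r. r \<ge> 0 \<Longrightarrow> c \<le> q (r *\<^sub>R 1 + re_part x) - r) \<Longrightarrow> c \<le> smax x"
  unfolding smax_def by (rule cINF_greatest) auto

lemma smax_le_q: "smax x \<le> q x"
  using smax_le[of 0 x] q_re_part[of x] by simp

lemma sublinear_smax: "sublinear smax"
  unfolding sublinear_def
proof (intro conjI allI impI)
  fix x y
  have "smax (x + y) - smax y \<le> smax x"
  proof (rule smax_greatest)
    fix r :: real assume r: "r \<ge> 0"
    have "smax (x + y) - (q (r *\<^sub>R 1 + re_part x) - r) \<le> smax y"
    proof (rule smax_greatest)
      fix s :: real assume s: "s \<ge> 0"
      have "smax (x + y) \<le> q ((r + s) *\<^sub>R 1 + re_part (x + y)) - (r + s)"
        using r s by (intro smax_le) simp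
      also have "(r + s) *\<^sub>R 1 + re_part (x + y) = (r *\<^sub>R 1 + re_part x) + (s *\<^sub>R 1 + re_part y)"
        by (simp add: re_part_simps algebra_simps)
      finally show "smax (x + y) - (q (r *\<^sub>R 1 + re_part x) - r) \<le> q (s *\<^sub>R 1 + re_part y) - s"
        using q_add[of "r *\<^sub>R 1 + re_part x" "s *\<^sub>R 1 + re_part y"] by simp
    qed
    then show "smax (x + y) - smax y \<le> q (r *\<^sub>R 1 + re_part x) - r" by simp
  qed
  then show "smax (x + y) \<le> smax x + smax y" by simp
next
  have re0: "re_part 0 = 0" by (simp add: re_part_def)
  have z: "smax 0 = 0"
  proof (rule antisym)
    show "smax 0 \<le> 0" using smax_le[of 0 0] by (simp add: re0)
    show "0 \<le> smax 0" by (rule smax_greatest) (simp add: re0 q_scaleR q_one)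
  qed
  have le: "s * smax x \<le> smax (s *\<^sub>R x)" if s: "s > 0" for s x
  proof (rule smax_greatest)
    fix r :: real assume r: "r \<ge> 0"
    have "smax x \<le> q ((r / s) *\<^sub>R 1 + re_part x) - r / s" using r s by (intro smax_le) simp
    then have "s * smax x \<le> s * (q ((r / s) *\<^sub>R 1 + re_part x) - r / s)"
      using s by (intro mult_left_mono) auto
    also have "\<dots> = q (s *\<^sub>R ((r / s) *\<^sub>R 1 + re_part x)) - r"
      using s by (simp only: q_scaleR) (simp add: right_diff_distrib)
    also have "s *\<^sub>R ((r / s) *\<^sub>R 1 + re_part x) = r *\<^sub>R 1 + re_part (s *\<^sub>R x)"
      using s by (simp add: re_part_simps scaleR_add_right)
    finally show "s * smax x \<le> q (r *\<^sub>R 1 + re_part (s *\<^sub>R x)) - r" .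
  qed
  fix s :: real and x assume "s \<ge> 0"
  then consider "s = 0" | "s > 0" by linarith
  then show "smax (s *\<^sub>R x) = s * smax x"
  proof cases
    case 2
    have "(1 / s) * smax (s *\<^sub>R x) \<le> smax ((1 / s) *\<^sub>R s *\<^sub>R x)" using 2 by (intro le) simp
    then have "smax (s *\<^sub>R x) \<le> s * smax x" using 2 by (simp add: field_simps)
    then show ?thesis using le[OF 2, of x] by simp
  qed (simp add: z)
qed

lemma smax_star_mult: "smax (star x * x) = (q x)\<^sup>2"
proof (rule antisym)
  have re: "re_part (star x * x) = star x * x" by (rule re_part_simps) (simp add: star_mult star_star)
  have "smax (star x * x) \<le> q (star x * x)" by (rule smax_le_q)
  also have "\<dots> \<le> (q x)\<^sup>2" using q_mult[of "star x" x] by (simp add: q_star power2_eq_square)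
  finally show "smax (star x * x) \<le> (q x)\<^sup>2" .
  show "(q x)\<^sup>2 \<le> smax (star x * x)"
    by (rule smax_greatest) (use q_sum in \<open>simp add: re algebra_simps\<close>)
qed

lemma smax_minus_star_mult: "smax (- (star x * x)) \<le> 0"
proof -
  have re: "re_part (- (star x * x)) = - (star x * x)"
    by (rule re_part_simps) (simp add: star_mult star_star star_minus)
  show ?thesis using smax_le[of "(q x)\<^sup>2" "- (star x * x)"] q_diff[of x "(q x)\<^sup>2"] by (simp add: re)
qed

end

section \<open>The representation of a state on a given Hilbert space\<close>

lemma power_growth_le:
  fixes \<alpha> \<beta> C :: real
  assumes "\<And>m. \<alpha> ^ 2 ^ m \<le> C * \<beta> ^ 2 ^ m" "\<beta> \<ge> 0"
  shows "\<alpha> \<le> \<beta>"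
proof (rule ccontr)
  assume "\<not> \<alpha> \<le> \<beta>"
  then have lt: "\<beta> < \<alpha>" by simp
  show False
  proof (cases "\<beta> = 0")
    case True
    then show False using assms(1)[of 0] lt by simp
  next
    case False
    then have b: "\<beta> > 0" using assms(2) by simp
    have "\<alpha> / \<beta> > 1" using lt b by simp
    then obtain n where n: "C < (\<alpha> / \<beta>) ^ n" using real_arch_pow by blast
    have "(\<alpha> / \<beta>) ^ n \<le> (\<alpha> / \<beta>) ^ 2 ^ n"
      using \<open>\<alpha> / \<beta> > 1\<close> by (intro power_increasing) (auto simp: less_imp_le less_exp)
    moreover have "(\<alpha> / \<beta>) ^ 2 ^ n \<le> C"
      using assms(1)[of n] b by (simp add: power_divide divide_simps)
    ultimately show False using n by simp
  qed
qed

locale cstar_state = cstar_seminorm q K for q :: "'a::cstar_algebra \<Rightarrow> real" and K +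
  fixes F :: "'a \<Rightarrow> complex"
  assumes F_add: "F (x + y) = F x + F y"
    and F_scaleC: "F (c *\<^sub>C x) = c * F x"
    and F_star: "F (star x) = cnj (F x)"
    and F_pos: "Re (F (star x * x)) \<ge> 0"
    and F_le: "Re (F x) \<le> q x"
    and F_one: "F 1 = 1"
begin

lemma F_scaleR: "F (r *\<^sub>R x) = of_real r * F x"
  by (simp add: scaleR_scaleC F_scaleC)

lemma F_zero [simp]: "F 0 = 0"
  using F_scaleC[of 0 0] by simp

lemma F_minus: "F (- x) = - F x"
  using F_scaleR[of "- 1" x] by simp

lemma F_diff: "F (x - y) = F x - F y"
  using F_add[of x "- y"] by (simp add: F_minus)

lemma F_star_mult_real: "F (star x * x) = of_real (Re (F (star x * x)))"
  using F_star[of "star x * x"] by (simp add: star_mult star_star complex_eq_iff)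

text \<open>For self-adjoint \<open>z\<close>, the Cauchy--Schwarz inequality for \<open>y \<mapsto> F (b\<^sup>* y b)\<close> gives
  \<open>F (b\<^sup>* z b)\<^sup>2 \<le> F (b\<^sup>* b) F (b\<^sup>* z\<^sup>2 b)\<close>; iterating it and taking roots leaves
  \<open>F (b\<^sup>* z b) \<le> F (b\<^sup>* b) q z\<close>.\<close>

lemma F_conj_le:
  "Re (F (star (x * b) * (x * b))) \<le> (q x)\<^sup>2 * Re (F (star b * b))"
proof -
  define z where "z = star x * x"
  have sz: "star z = z" by (simp add: z_def star_mult star_star)
  define G where "G y = Re (F (star b * y * b))" for y
  have G: "G (y + y') = G y + G y'" "G (r *\<^sub>R y) = r * G y" "G (y - y') = G y - G y'" for y y' r
    by (simp_all add: G_def algebra_simps F_add F_scaleR F_diff)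
  have Gpos: "G (y * y) \<ge> 0" if "star y = y" for y
    using F_pos[of "y * b"] that by (simp add: G_def star_mult mult.assoc)
  have CS: "(G y)\<^sup>2 \<le> G 1 * G (y * y)" if y: "star y = y" for y
  proof -
    have 1: "0 \<le> G (y * y) - 2 * t * G y + t\<^sup>2 * G 1" for t
    proof -
      have "0 \<le> G ((y - t *\<^sub>R 1) * (y - t *\<^sub>R 1))" using y by (intro Gpos) (simp add: star_diff star_scaleR)
      also have "(y - t *\<^sub>R 1) * (y - t *\<^sub>R 1) = y * y - (2 * t) *\<^sub>R y + (t * t) *\<^sub>R 1"
        by (simp add: algebra_simps) (metis scaleR_2 scaleR_scaleR mult.commute)
      finally show ?thesis by (simp add: G power2_eq_square)
    qed
    show ?thesis
    proof (cases "G 1 = 0")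
      case True
      have "G y = 0"
      proof (rule ccontr)
        assume "G y \<noteq> 0"
        then show False using 1[of "(G (y * y) + 1) / (2 * G y)"] True by simp
      qed
      then show ?thesis using True by simp
    next
      case False
      then have p: "G 1 > 0" using Gpos[of 1] by simp
      have "0 \<le> G (y * y) - (G y)\<^sup>2 / G 1"
        using 1[of "G y / G 1"] p by (simp add: power2_eq_square)
      then show ?thesis using p by (simp add: field_simps)
    qed
  qed
  have "G z \<le> q z * G 1"
  proof (cases "G 1 = 0")
    case True
    then show ?thesis using CS[OF sz] by simp
  next
    case False
    then have p: "G 1 > 0" using Gpos[of 1] by simp
    have iter: "(G z / G 1) ^ 2 ^ m \<le> G (z ^ 2 ^ m) / G 1" for m
    proof (induction m)
      case (Suc m)
      have "G z / G 1 \<ge> 0"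
        using F_pos[of "x * b"] p by (simp add: G_def z_def star_mult mult.assoc)
      then have "(G z / G 1) ^ 2 ^ Suc m \<le> (G (z ^ 2 ^ m) / G 1)\<^sup>2"
        using power_mono[OF Suc, of 2] by (simp add: power_mult[symmetric] mult.commute)
      also have "\<dots> \<le> G (z ^ 2 ^ m * z ^ 2 ^ m) / G 1"
        using CS[of "z ^ 2 ^ m"] p by (simp add: star_power sz power_divide power2_eq_square divide_simps)
          (simp add: mult_ac)
      finally show ?case by (simp add: power_add[symmetric] mult_2)
    qed simp
    have "G z / G 1 \<le> q z"
    proof (rule power_growth_le[OF _ q_nonneg])
      fix m
      have "G (z ^ 2 ^ m) \<le> q (star b * z ^ 2 ^ m * b)" unfolding G_def by (rule F_le)
      also have "\<dots> \<le> q (star b * z ^ 2 ^ m) * q b" by (rule q_mult)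
      also have "\<dots> \<le> q (star b) * q (z ^ 2 ^ m) * q b" by (intro mult_right_mono q_mult q_nonneg)
      also have "\<dots> \<le> q (star b) * q z ^ 2 ^ m * q b"
        by (intro mult_right_mono mult_left_mono q_power q_nonneg)
      finally have "G (z ^ 2 ^ m) / G 1 \<le> (q (star b) * q b / G 1) * q z ^ 2 ^ m"
        using p by (simp add: divide_simps mult_ac)
      then show "(G z / G 1) ^ 2 ^ m \<le> (q (star b) * q b / G 1) * q z ^ 2 ^ m"
        using iter[of m] by linarith
    qed
    then show ?thesis using p by (simp add: divide_simps)
  qed
  also have "\<dots> \<le> (q x)\<^sup>2 * G 1"
  proof (rule mult_right_mono)
    show "q z \<le> (q x)\<^sup>2" using q_mult[of "star x" x] by (simp add: z_def q_star power2_eq_square)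
    show "0 \<le> G 1" using Gpos[of 1] by simp
  qed
  finally show ?thesis by (simp add: G_def z_def star_mult mult.assoc)
qed

lemma F_norm_bound: "Re (F (star a * a)) \<le> (K * norm a)\<^sup>2"
proof -
  have "Re (F (star (a * 1) * (a * 1))) \<le> (q a)\<^sup>2 * Re (F (star 1 * 1))" by (rule F_conj_le)
  also have "\<dots> = (q a)\<^sup>2" by (simp add: F_one)
  also have "\<dots> \<le> (K * norm a)\<^sup>2" by (intro power_mono q_le_norm q_nonneg)
  finally show ?thesis by simp
qed

end

lemma orthonormal_series:
  fixes u :: "nat \<Rightarrow> 'h::chilbert_space"
  assumes u: "\<And>n. orthonormal n u" and c: "summable (\<lambda>j. (cmod (c j))\<^sup>2)"
  shows "summable (\<lambda>j. c j *\<^sub>C u j)" "(norm (\<Sum>j. c j *\<^sub>C u j))\<^sup>2 = (\<Sum>j. (cmod (c j))\<^sup>2)"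
proof -
  have seg: "(norm (\<Sum>j\<in>{m..<n}. c j *\<^sub>C u j))\<^sup>2 = (\<Sum>j\<in>{m..<n}. (cmod (c j))\<^sup>2)" for m n
  proof -
    define d where "d j = (if j < m then 0 else c j)" for j
    have "(\<Sum>j\<in>{m..<n}. c j *\<^sub>C u j) = comb n u d"
      unfolding comb_def by (rule sum.mono_neutral_cong_left) (auto simp: d_def)
    moreover have "(\<Sum>j\<in>{m..<n}. (cmod (c j))\<^sup>2) = (\<Sum>j<n. (cmod (d j))\<^sup>2)"
      by (rule sum.mono_neutral_cong_left) (auto simp: d_def)
    ultimately show ?thesis using norm_comb[OF u, of n d] by simp
  qed
  show s: "summable (\<lambda>j. c j *\<^sub>C u j)"
    unfolding summable_Cauchy
  proof (intro allI impI)
    fix e :: real assume e: "e > 0"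
    then have "e\<^sup>2 > 0" by simp
    then obtain N where N: "\<And>m n. m \<ge> N \<Longrightarrow> norm (\<Sum>j\<in>{m..<n}. (cmod (c j))\<^sup>2) < e\<^sup>2"
      using c unfolding summable_Cauchy by blast
    have "norm (\<Sum>j\<in>{m..<n}. c j *\<^sub>C u j) < e" if "m \<ge> N" for m n
    proof (rule power_less_imp_less_base[of _ 2])
      show "(norm (\<Sum>j\<in>{m..<n}. c j *\<^sub>C u j))\<^sup>2 < e\<^sup>2" using N[OF that, of n] seg[of m n] by simp
    qed (use e in simp)
    then show "\<exists>N. \<forall>m\<ge>N. \<forall>n. norm (\<Sum>j\<in>{m..<n}. c j *\<^sub>C u j) < e" by blast
  qed
  have "(\<lambda>n. (norm (\<Sum>j<n. c j *\<^sub>C u j))\<^sup>2) \<longlonglongrightarrow> (norm (\<Sum>j. c j *\<^sub>C u j))\<^sup>2"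
    by (intro tendsto_intros summable_LIMSEQ s)
  moreover have "(\<lambda>n. \<Sum>j<n. (cmod (c j))\<^sup>2) \<longlonglongrightarrow> (\<Sum>j. (cmod (c j))\<^sup>2)"
    by (rule summable_LIMSEQ[OF c])
  moreover have "(\<lambda>n. (norm (\<Sum>j<n. c j *\<^sub>C u j))\<^sup>2) = (\<lambda>n. \<Sum>j<n. (cmod (c j))\<^sup>2)"
    using seg[of 0] by (simp add: lessThan_atLeast0)
  ultimately show "(norm (\<Sum>j. c j *\<^sub>C u j))\<^sup>2 = (\<Sum>j. (cmod (c j))\<^sup>2)"
    using LIMSEQ_unique by metis
qed

context cstar_state
begin

definition sip :: "'a \<Rightarrow> 'a \<Rightarrow> complex"
  where "sip x y = F (star x * y)"

lemma sip_simps: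
  "sip x (y + z) = sip x y + sip x z" "sip (x + y) z = sip x z + sip y z"
  "sip x (y - z) = sip x y - sip x z" "sip (x - y) z = sip x z - sip y z"
  "sip x (c *\<^sub>C y) = c * sip x y" "sip (c *\<^sub>C x) y = cnj c * sip x y"
  "sip x (r *\<^sub>R y) = of_real r * sip x y" "sip (r *\<^sub>R x) y = of_real r * sip x y"
  "sip x 0 = 0" "sip 0 x = 0"
  by (simp_all add: sip_def star_add star_diff star_scaleC star_scaleR algebra_simps
      F_add F_diff F_scaleC F_scaleR mult_scaleC_left mult_scaleC_right)

lemma sip_sum_right: "sip x (\<Sum>i\<in>I. f i) = (\<Sum>i\<in>I. sip x (f i))"
  by (induction I rule: infinite_finite_induct) (auto simp: sip_simps)

lemma sip_sum_left: "sip (\<Sum>i\<in>I. f i) x = (\<Sum>i\<in>I. sip (f i) x)"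
  by (induction I rule: infinite_finite_induct) (auto simp: sip_simps)

lemma sip_commute: "sip y x = cnj (sip x y)"
  using F_star[of "star x * y"] by (simp add: sip_def star_mult star_star)

lemma sip_self: "sip x x = of_real (Re (sip x x))" and sip_nonneg: "Re (sip x x) \<ge> 0"
  using F_star_mult_real[of x] F_pos[of x] by (simp_all add: sip_def)

text \<open>The form \<open>sip\<close> may be degenerate. Null vectors are replaced by \<open>0\<close>, so that the Gram--Schmidt process needs
  no selection of a subsequence; the vanishing terms do no harm in the expansions.\<close>

definition sip_unit :: "'a \<Rightarrow> 'a"
  where "sip_unit y = (if sip y y = 0 then 0 else (1 / sqrt (Re (sip y y))) *\<^sub>R y)"

declare sum.cong [fundef_cong]

function gram_schmidt :: "(nat \<Rightarrow> 'a) \<Rightarrow> nat \<Rightarrow> 'a" where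
  "gram_schmidt a k = sip_unit (a k - (\<Sum>j<k. sip (gram_schmidt a j) (a k) *\<^sub>C gram_schmidt a j))"
  by auto
termination by (relation "Wellfounded.measure snd") auto

declare gram_schmidt.simps [simp del]

lemma gram_schmidt_orthonormal:
  "sip (gram_schmidt a i) (gram_schmidt a j) = (if i = j \<and> gram_schmidt a i \<noteq> 0 then 1 else 0)"
proof -
  let ?e = "gram_schmidt a"
  have self: "sip (?e k) (?e k) = (if ?e k \<noteq> 0 then 1 else 0)" for k
  proof -
    have "sip (sip_unit y) (sip_unit y) = (if sip_unit y \<noteq> 0 then 1 else 0)" for y
    proof (cases "sip y y = 0")
      case False
      then have p: "Re (sip y y) > 0" using sip_self[of y] sip_nonneg[of y]
        by (metis less_eq_real_def of_real_0)
      define \<rho> where "\<rho> = sqrt (Re (sip y y))"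
      have r: "\<rho> > 0" "\<rho> * \<rho> = Re (sip y y)" using p by (simp_all add: \<rho>_def)
      have y0: "y \<noteq> 0" using False by (auto simp: sip_simps)
      have u: "sip_unit y = (1 / \<rho>) *\<^sub>R y" using False by (simp add: sip_unit_def \<rho>_def)
      have "sip (sip_unit y) (sip_unit y) = of_real (1 / \<rho> * (1 / \<rho>) * (\<rho> * \<rho>))"
        unfolding u sip_simps r(2) by (subst sip_self) (simp add: mult.assoc)
      then show ?thesis using r y0 u p by simp
    qed (simp add: sip_unit_def sip_simps)
    then show ?thesis by (subst (1 2 3) gram_schmidt.simps) blast
  qed
  have "\<forall>i<n. \<forall>j<n. i \<noteq> j \<longrightarrow> sip (?e i) (?e j) = 0" for n
  proof (induction n)
    case (Suc n)
    define y where "y = a n - (\<Sum>j<n. sip (?e j) (a n) *\<^sub>C ?e j)"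
    have "sip (?e i) y = 0" if i: "i < n" for i
    proof -
      have "(\<Sum>j<n. sip (?e j) (a n) * sip (?e i) (?e j))
          = (\<Sum>j<n. if j = i then sip (?e i) (a n) else 0)"
        using Suc i self[of i] by (intro sum.cong) (auto simp: sip_simps)
      then show ?thesis using i by (simp add: y_def sip_simps sip_sum_right)
    qed
    then have new: "sip (?e i) (?e n) = 0" if "i < n" for i
      using that by (subst (2) gram_schmidt.simps) (simp add: y_def[symmetric] sip_unit_def sip_simps)
    then have "sip (?e n) (?e i) = 0" if "i < n" for i using that sip_commute[of "?e n" "?e i"] by simp
    then show ?case using Suc new by (auto simp: less_Suc_eq)
  qed simp
  then have "i \<noteq> j \<Longrightarrow> sip (?e i) (?e j) = 0" by (meson less_max_iff_disj lessI less_Suc_eq max.strict_coboundedI1 linorder_neqE_nat nat_less_le)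
  then show ?thesis using self by (auto simp: sip_simps)
qed

lemma gram_schmidt_residual:
  fixes a m x
  defines "x' \<equiv> x - (\<Sum>j<m. sip (gram_schmidt a j) x *\<^sub>C gram_schmidt a j)"
  shows "Re (sip x x) = Re (sip x' x') + (\<Sum>j<m. (cmod (sip (gram_schmidt a j) x))\<^sup>2)"
proof -
  let ?e = "gram_schmidt a"
  define g where "g = (\<Sum>j<m. sip (?e j) x *\<^sub>C ?e j)"
  have eg: "sip (?e i) g = sip (?e i) x" if "i < m" for i
  proof -
    have "sip (?e i) g = (\<Sum>j<m. if j = i then sip (?e i) x else 0)"
      unfolding g_def sip_sum_right
      by (intro sum.cong) (auto simp: sip_simps gram_schmidt_orthonormal)
    then show ?thesis using that by simp
  qed
  have gx': "sip g x' = 0"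
    unfolding g_def sip_sum_left
    by (intro sum.neutral) (auto simp: sip_simps x'_def eg g_def[symmetric])
  then have "sip x' g = 0" using sip_commute[of x' g] by simp
  moreover have "sip g g = of_real (\<Sum>j<m. (cmod (sip (?e j) x))\<^sup>2)"
    by (subst (1) g_def)
      (simp add: sip_sum_left sip_simps eg complex_norm_square mult.commute del: of_real_power)
  moreover have "x = x' + g" by (simp add: x'_def g_def)
  then have "sip x x = sip x' x' + sip x' g + sip g x' + sip g g"
    by (simp only: sip_simps) simp
  ultimately show ?thesis using gx' by simp
qed

lemma gram_schmidt_bessel: "(\<Sum>j<m. (cmod (sip (gram_schmidt a j) x))\<^sup>2) \<le> Re (sip x x)"
  using gram_schmidt_residual[where x = x and m = m and a = a] sip_nonneg by (smt (verit))

text \<open>Subtracting from \<open>a k\<close> its components along the first \<open>k + 1\<close> vectors leaves a null vector.\<close>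

lemma gram_schmidt_parseval:
  "Re (sip (a k) (a k)) = (\<Sum>j<Suc k. (cmod (sip (gram_schmidt a j) (a k)))\<^sup>2)"
proof -
  let ?e = "gram_schmidt a"
  define y where "y = a k - (\<Sum>j<k. sip (?e j) (a k) *\<^sub>C ?e j)"
  have ek: "?e k = sip_unit y" by (subst gram_schmidt.simps) (simp add: y_def)
  have "sip (?e k) (\<Sum>j<k. sip (?e j) (a k) *\<^sub>C ?e j) = 0"
    unfolding sip_sum_right by (intro sum.neutral) (auto simp: sip_simps gram_schmidt_orthonormal)
  then have eq: "sip (?e k) (a k) = sip (?e k) y" by (simp add: y_def sip_simps)
  define z where "z = a k - (\<Sum>j<Suc k. sip (?e j) (a k) *\<^sub>C ?e j)"
  have z: "z = y - sip (?e k) y *\<^sub>C ?e k" by (simp add: z_def y_def[symmetric] eq diff_diff_eq[symmetric])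
  have "Re (sip z z) = 0"
  proof (cases "sip y y = 0")
    case False
    then have p: "Re (sip y y) > 0" using sip_self[of y] sip_nonneg[of y]
      by (metis less_eq_real_def of_real_0)
    define \<rho> where "\<rho> = sqrt (Re (sip y y))"
    have r: "\<rho> > 0" "\<rho> * \<rho> = Re (sip y y)" using p by (simp_all add: \<rho>_def)
    have u: "sip_unit y = (1 / \<rho>) *\<^sub>R y" using False by (simp add: sip_unit_def \<rho>_def)
    have "sip (sip_unit y) y = of_real \<rho>"
      unfolding u sip_simps by (subst sip_self) (use r in \<open>simp add: r(2)[symmetric]\<close>)
    then have "z = 0" using r by (simp add: z ek u scaleC_of_real)
    then show ?thesis by (simp add: sip_simps)
  qed (simp add: z ek sip_unit_def sip_simps)
  then show ?thesis using gram_schmidt_residual[where x = "a k" and m = "Suc k" and a = a] by (simp only: z_def)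
qed

lemma F_bounded_linear: "bounded_linear F"
proof (rule bounded_linear_intro[where K = K])
  fix x
  show "norm (F x) \<le> norm x * K"
  proof (cases "F x = 0")
    case False
    define c where "c = cnj (F x) / of_real (cmod (F x))"
    have "F (c *\<^sub>C x) = of_real (cmod (F x))"
      using False by (simp add: F_scaleC c_def complex_norm_square[symmetric] power2_eq_square mult.commute)
    then have "cmod (F x) \<le> q (c *\<^sub>C x)" using F_le[of "c *\<^sub>C x"] by simp
    also have "\<dots> \<le> K * norm x"
      using False q_le_norm[of x] by (simp add: q_scaleC c_def norm_divide)
    finally show ?thesis by (simp add: mult.commute)
  next
    case True
    then show ?thesis using q_le_norm[of x] q_nonneg[of x] by (simp add: mult.commute)
  qed
qed (simp_all add: F_add F_scaleR scaleR_conv_of_real[where 'a = complex])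

text \<open>Send \<open>x\<close> to the vector whose coordinates along \<open>u\<close> are the Gram--Schmidt coefficients of \<open>x\<close>. By Bessel's
  inequality this is bounded; it preserves the norm on the dense sequence, hence everywhere, and polarisation gives
  the inner products.\<close>

lemma isometry_exists:
  fixes u :: "nat \<Rightarrow> 'h::chilbert_space" and a :: "nat \<Rightarrow> 'a"
  assumes u: "\<And>n. orthonormal n u" and dense: "closure (range a) = (UNIV :: 'a set)"
  shows "\<exists>V :: 'a \<Rightarrow> 'h. clinear V \<and> (\<forall>x y. cinner (V x) (V y) = F (star x * y))"
proof -
  let ?e = "gram_schmidt a"
  have s2: "summable (\<lambda>j. (cmod (sip (?e j) x))\<^sup>2)" for x
    by (rule bounded_imp_summable[of _ "Re (sip x x)"])
      (use gram_schmidt_bessel[of a x "Suc _"] in \<open>auto simp: lessThan_Suc_atMost\<close>)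
  define V where "V x = (\<Sum>j. sip (?e j) x *\<^sub>C u j)" for x
  have sV: "summable (\<lambda>j. sip (?e j) x *\<^sub>C u j)" for x by (rule orthonormal_series(1)[OF u s2])
  have V: "clinear V"
    unfolding clinear_iff
  proof (intro conjI allI)
    show "V (x + y) = V x + V y" for x y
      using suminf_add[OF sV sV, of x y] by (simp add: V_def sip_simps scaleC_add_left)
    show "V (c *\<^sub>C x) = c *\<^sub>C V x" for c x
      using bounded_linear.suminf[OF bounded_linear_scaleC sV, of c x]
      by (simp add: V_def sip_simps scaleC_scaleC)
  qed
  have nV: "(norm (V x))\<^sup>2 = (\<Sum>j. (cmod (sip (?e j) x))\<^sup>2)" for x
    unfolding V_def by (rule orthonormal_series(2)[OF u s2])
  have le: "(norm (V x))\<^sup>2 \<le> Re (sip x x)" for x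
    unfolding nV by (rule suminf_le_const[OF s2 gram_schmidt_bessel])
  have "norm (V x) \<le> norm x * K" for x
  proof (rule power2_le_imp_le)
    show "(norm (V x))\<^sup>2 \<le> (norm x * K)\<^sup>2"
      using le[of x] F_norm_bound[of x] by (simp add: sip_def mult.commute)
    show "0 \<le> norm x * K" using q_le_norm[of x] q_nonneg[of x] by (simp add: mult.commute)
  qed
  then have Vb: "bounded_linear V"
    by (intro bounded_linear_intro) (auto simp: clinearD[OF V])
  have iso: "(norm (V x))\<^sup>2 = Re (sip x x)" for x
  proof -
    have "closed {x. (norm (V x))\<^sup>2 = Re (sip x x)}"
      unfolding sip_def
      by (intro closed_Collect_eq continuous_intros bounded_linear.continuous_on[OF Vb]
          bounded_linear.continuous_on[OF F_bounded_linear]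
          bounded_linear.continuous_on[OF bounded_linear_star])
    moreover have "(norm (V (a k)))\<^sup>2 = Re (sip (a k) (a k))" for k
    proof (rule antisym[OF le])
      show "Re (sip (a k) (a k)) \<le> (norm (V (a k)))\<^sup>2"
        unfolding gram_schmidt_parseval nV by (rule sum_le_suminf[OF s2]) auto
    qed
    then have "range a \<subseteq> {x. (norm (V x))\<^sup>2 = Re (sip x x)}" by auto
    ultimately have "closure (range a) \<subseteq> {x. (norm (V x))\<^sup>2 = Re (sip x x)}" by (rule closure_minimal[rotated])
    then show ?thesis using dense by auto
  qed
  have re: "Re (cinner (V x) (V y)) = Re (sip x y)" for x y
  proof -
    have "Re (sip y x) = Re (sip x y)" using sip_commute[of y x] by simp
    then show ?thesis
      using iso[of "x + y"] iso[of x] iso[of y]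
      by (simp add: clinearD[OF V] norm_add_square sip_simps)
  qed
  have "cinner (V x) (V y) = sip x y" for x y
  proof (rule complex_eqI[OF re])
    show "Im (cinner (V x) (V y)) = Im (sip x y)"
      using re[of x "\<i> *\<^sub>C y"] by (simp add: clinearD[OF V] cinner_scaleC_right sip_simps)
  qed
  then show ?thesis using V by (auto simp: sip_def)
qed

end

lemma closure_sequence:
  assumes "x \<in> closure (range V)"
  obtains b where "(\<lambda>n. V (b n)) \<longlonglongrightarrow> (x :: 'h::real_normed_vector)"
proof -
  obtain f where f: "\<forall>n. f n \<in> range V" "f \<longlonglongrightarrow> x"
    using iffD1[OF closure_sequential assms] by (elim exE conjE)
  from f(1) have "\<forall>n. \<exists>b. f n = V b" by (simp add: image_iff)
  then obtain b where "\<forall>n. f n = V (b n)" by metis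
  then have "f = (\<lambda>n. V (b n))" by auto
  then show ?thesis using that f(2) by simp
qed

lemma closure_sequenceI:
  "(\<lambda>n. V (b n)) \<longlonglongrightarrow> (x :: 'h::real_normed_vector) \<Longrightarrow> x \<in> closure (range V)"
  unfolding closure_sequential by (intro exI[of _ "\<lambda>n. V (b n)"]) simp

lemma closed_csubspace_closure_range:
  fixes V :: "'a::complex_normed_vector \<Rightarrow> 'h::chilbert_space"
  assumes "clinear V"
  shows "closed_csubspace (closure (range V))"
  unfolding closed_csubspace_def csubspace_def[symmetric] complex_vector.subspace_def
proof (intro conjI ballI allI)
  have "0 \<in> range V" using clinearD(3)[OF assms] rangeI[of V 0] by simp
  then show "0 \<in> closure (range V)" by (rule subsetD[OF closure_subset])
  show "x + y \<in> closure (range V)" if "x \<in> closure (range V)" "y \<in> closure (range V)" for x y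
  proof -
    from that(1) obtain b where b: "(\<lambda>n. V (b n)) \<longlonglongrightarrow> x" by (rule closure_sequence)
    from that(2) obtain c where c: "(\<lambda>n. V (c n)) \<longlonglongrightarrow> y" by (rule closure_sequence)
    show ?thesis
      by (rule closure_sequenceI[of _ "\<lambda>n. b n + c n"])
        (use tendsto_add[OF b c] in \<open>simp add: clinearD[OF assms]\<close>)
  qed
  show "c *\<^sub>C x \<in> closure (range V)" if "x \<in> closure (range V)" for c x
  proof -
    from that obtain b where b: "(\<lambda>n. V (b n)) \<longlonglongrightarrow> x" by (rule closure_sequence)
    show ?thesis
      by (rule closure_sequenceI[of _ "\<lambda>n. c *\<^sub>C b n"])
        (use bounded_linear.tendsto[OF bounded_linear_scaleC b, of c] in \<open>simp add: clinearD[OF assms]\<close>)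
  qed
qed simp

text \<open>The value at \<open>h\<close> is the limit of \<open>T (b m)\<close> for any \<open>b\<close> such that \<open>V (b m)\<close> tends to the projection of
  \<open>h\<close> to \<open>L\<close>. The limit does not depend on the choice of \<open>b\<close>, which makes it linear in \<open>h\<close>.\<close>

lemma extend_from_dense_range:
  fixes V T :: "'a::complex_normed_vector \<Rightarrow> 'h::chilbert_space"
  assumes V: "clinear V" and T: "clinear T" and C: "C \<ge> 0" and le: "\<And>a. norm (T a) \<le> C * norm (V a)"
  defines "L \<equiv> closure (range V)"
  shows "\<exists>W. clinear (blinfun_apply W) \<and> (\<forall>a. blinfun_apply W (V a) = T a) \<and>
    (\<forall>h. blinfun_apply W h = blinfun_apply W (proj L h)) \<and>
    range (blinfun_apply W) \<subseteq> closure (range T) \<and> norm W \<le> C"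
proof -
  have L: "closed_csubspace L" unfolding L_def by (rule closed_csubspace_closure_range[OF V])
  have "\<exists>b. (\<lambda>m. V (b m)) \<longlonglongrightarrow> proj L h" for h
  proof -
    have "proj L h \<in> closure (range V)" using proj_in[OF L] by (simp add: L_def)
    then obtain b where "(\<lambda>n. V (b n)) \<longlonglongrightarrow> proj L h" by (rule closure_sequence)
    then show ?thesis by blast
  qed
  then obtain b where b: "\<And>h. (\<lambda>m. V (b h m)) \<longlonglongrightarrow> proj L h" by metis
  have "convergent (\<lambda>m. T (b h m))" for h
  proof (rule Cauchy_convergent, rule metric_CauchyI)
    fix e :: real assume e: "e > 0"
    then have "e / (C + 1) > 0" using C by simp
    then obtain M where M: "\<And>m n. m \<ge> M \<Longrightarrow> n \<ge> M \<Longrightarrow> dist (V (b h m)) (V (b h n)) < e / (C + 1)"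
      using metric_CauchyD[OF LIMSEQ_imp_Cauchy[OF b]] by metis
    show "\<exists>M. \<forall>m\<ge>M. \<forall>n\<ge>M. dist (T (b h m)) (T (b h n)) < e"
    proof (intro exI allI impI)
      fix m n assume mn: "m \<ge> M" "n \<ge> M"
      have "dist (T (b h m)) (T (b h n)) \<le> C * dist (V (b h m)) (V (b h n))"
        using le[of "b h m - b h n"] by (simp add: dist_norm clinearD[OF V] clinearD[OF T])
      also have "\<dots> \<le> C * (e / (C + 1))"
        using M[OF mn] C by (intro mult_left_mono) auto
      also have "\<dots> < e" using C e by (simp add: field_simps)
      finally show "dist (T (b h m)) (T (b h n)) < e" .
    qed
  qed
  then obtain w where w: "\<And>h. (\<lambda>m. T (b h m)) \<longlonglongrightarrow> w h" unfolding convergent_def by metis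
  have uniq: "w h = k" if c: "(\<lambda>m. V (c m)) \<longlonglongrightarrow> proj L h" "(\<lambda>m. T (c m)) \<longlonglongrightarrow> k" for h c k
  proof -
    have "(\<lambda>m. V (b h m) - V (c m)) \<longlonglongrightarrow> proj L h - proj L h" by (intro tendsto_diff b c)
    then have "(\<lambda>m. C * norm (V (b h m - c m))) \<longlonglongrightarrow> C * norm (0::'h)"
      by (intro tendsto_mult tendsto_norm tendsto_const) (simp add: clinearD[OF V])
    then have "(\<lambda>m. C * norm (V (b h m - c m))) \<longlonglongrightarrow> 0" by simp
    then have "(\<lambda>m. T (b h m - c m)) \<longlonglongrightarrow> 0"
      by (rule Lim_null_comparison[rotated]) (simp add: le)
    then have "(\<lambda>m. T (b h m) - T (c m)) \<longlonglongrightarrow> 0" by (simp add: clinearD[OF T])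
    moreover have "(\<lambda>m. T (b h m) - T (c m)) \<longlonglongrightarrow> w h - k" by (intro tendsto_diff w c)
    ultimately show ?thesis using LIMSEQ_unique by fastforce
  qed
  have add: "w (x + y) = w x + w y" for x y
  proof (rule uniq)
    show "(\<lambda>m. V (b x m + b y m)) \<longlonglongrightarrow> proj L (x + y)"
      using tendsto_add[OF b b, of x y] by (simp add: clinearD[OF V] clinearD[OF clinear_proj[OF L]])
    show "(\<lambda>m. T (b x m + b y m)) \<longlonglongrightarrow> w x + w y"
      using tendsto_add[OF w w, of x y] by (simp add: clinearD[OF T])
  qed
  have scale: "w (c *\<^sub>C x) = c *\<^sub>C w x" for c x
  proof (rule uniq)
    show "(\<lambda>m. V (c *\<^sub>C b x m)) \<longlonglongrightarrow> proj L (c *\<^sub>C x)"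
      using bounded_linear.tendsto[OF bounded_linear_scaleC b, of c x]
      by (simp add: clinearD[OF V] clinearD[OF clinear_proj[OF L]])
    show "(\<lambda>m. T (c *\<^sub>C b x m)) \<longlonglongrightarrow> c *\<^sub>C w x"
      using bounded_linear.tendsto[OF bounded_linear_scaleC w, of c x] by (simp add: clinearD[OF T])
  qed
  have norm_w: "norm (w h) \<le> C * norm h" for h
  proof -
    have "(\<lambda>m. norm (T (b h m))) \<longlonglongrightarrow> norm (w h)" by (intro tendsto_norm w)
    moreover have "(\<lambda>m. C * norm (V (b h m))) \<longlonglongrightarrow> C * norm (proj L h)"
      by (intro tendsto_mult tendsto_norm b tendsto_const)
    ultimately have "norm (w h) \<le> C * norm (proj L h)"
      by (rule LIMSEQ_le) (use le in blast)
    also have "\<dots> \<le> C * norm h" using C norm_proj_le[OF L] by (intro mult_left_mono) auto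
    finally show ?thesis .
  qed
  have bl: "bounded_linear w"
  proof (rule bounded_linear_intro[where K = C])
    show "norm (w x) \<le> norm x * C" for x using norm_w[of x] by (simp add: mult.commute)
  qed (simp_all only: add scaleR_scaleC scale)
  define W where "W = Blinfun w"
  have W: "blinfun_apply W = w" unfolding W_def by (rule bounded_linear_Blinfun_apply[OF bl])
  have "w (V a) = T a" for a
  proof (rule uniq[where c = "\<lambda>_. a"])
    have "V a \<in> L" unfolding L_def by (rule subsetD[OF closure_subset rangeI])
    then show "(\<lambda>m. V a) \<longlonglongrightarrow> proj L (V a)" using proj_of_mem[OF L] by simp
    show "(\<lambda>m. T a) \<longlonglongrightarrow> T a" by (rule tendsto_const)
  qed
  moreover have "w h = w (proj L h)" for h
  proof (rule uniq[where c = "b (proj L h)"])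
    show "(\<lambda>m. V (b (proj L h) m)) \<longlonglongrightarrow> proj L h"
      using b[of "proj L h"] proj_of_mem[OF L proj_in[OF L], of h] by simp
    show "(\<lambda>m. T (b (proj L h) m)) \<longlonglongrightarrow> w (proj L h)" by (rule w)
  qed
  moreover have "w h \<in> closure (range T)" for h
    by (rule closure_sequenceI[of T "b h", OF w])
  moreover have "norm W \<le> C"
    by (rule norm_blinfun_bound[OF C]) (simp add: W norm_w)
  moreover have "clinear w" unfolding clinear_iff using add scale by blast
  ultimately show ?thesis
    by (intro exI[of _ W] conjI) (simp_all only: W, blast+)
qed

section \<open>Representations\<close>

lemma unital_representationD:
  assumes "unital_representation L \<pi>"
  shows "closed_csubspace L" "clinear (blinfun_apply (\<pi> a))" "blinfun_apply (\<pi> a) x \<in> L"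
    "(\<And>y. y \<in> L \<Longrightarrow> cinner y x = 0) \<Longrightarrow> blinfun_apply (\<pi> a) x = 0"
    "clinear \<pi>" "blinfun_apply (\<pi> (a * b)) x = blinfun_apply (\<pi> a) (blinfun_apply (\<pi> b) x)"
    "\<pi> (star a) = adjoint_op (\<pi> a)" "x \<in> L \<Longrightarrow> blinfun_apply (\<pi> 1) x = x"
    "cinner (blinfun_apply (\<pi> a) x) y = cinner x (blinfun_apply (\<pi> (star a)) y)"
    "cinner x (blinfun_apply (\<pi> a) y) = cinner (blinfun_apply (\<pi> (star a)) x) y"
proof -
  have c: "\<And>a. \<pi> a \<in> carrier (bounded_operators L)" using assms by (auto simp: unital_representation_def)
  show "closed_csubspace L" "clinear \<pi>" "\<pi> (star a) = adjoint_op (\<pi> a)"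
    "x \<in> L \<Longrightarrow> blinfun_apply (\<pi> 1) x = x"
    "blinfun_apply (\<pi> (a * b)) x = blinfun_apply (\<pi> a) (blinfun_apply (\<pi> b) x)"
    using assms by (auto simp: unital_representation_def)
  show cl: "clinear (blinfun_apply (\<pi> a))" for a using c[of a] by (simp add: bounded_operators_def)
  show "blinfun_apply (\<pi> a) x \<in> L" using c[of a] by (auto simp: bounded_operators_def)
  show "(\<And>y. y \<in> L \<Longrightarrow> cinner y x = 0) \<Longrightarrow> blinfun_apply (\<pi> a) x = 0"
    using c[of a] by (auto simp: bounded_operators_def)
  have st: "\<pi> (star a) = adjoint_op (\<pi> a)" for a using assms by (auto simp: unital_representation_def)
  show "cinner (blinfun_apply (\<pi> a) x) y = cinner x (blinfun_apply (\<pi> (star a)) y)"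
    by (simp add: st cinner_adjoint_op[OF cl])
  show "cinner x (blinfun_apply (\<pi> a) y) = cinner (blinfun_apply (\<pi> (star a)) x) y"
    using cinner_adjoint_op[OF cl, of "star a" x y] st[of "star a"] by (simp add: star_star)
qed

lemma representation_proj:
  assumes "unital_representation L \<pi>"
  shows "blinfun_apply (\<pi> a) x = blinfun_apply (\<pi> a) (proj L x)"
proof -
  note D = unital_representationD[OF assms]
  have "blinfun_apply (\<pi> a) (x - proj L x) = 0"
    by (rule D(4)) (rule proj_orthogonal[OF D(1)])
  then show ?thesis by (simp add: blinfun.diff_right)
qed

context cstar_state
begin

text \<open>The Gelfand--Naimark--Segal representation, on the closure of the image of the algebra under an isometry into
  the given Hilbert space. The bound on left multiplication is \<open>F_conj_le\<close>.\<close>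

theorem gns_representation:
  fixes u :: "nat \<Rightarrow> 'h::chilbert_space" and a :: "nat \<Rightarrow> 'a"
  assumes u: "\<And>n. orthonormal n u" and dense: "closure (range a) = UNIV"
  obtains L and \<sigma> :: "'a \<Rightarrow> 'h \<Rightarrow>\<^sub>L 'h" and \<xi>
  where "unital_representation L \<sigma>" "\<And>x. norm (\<sigma> x) \<le> q x" "\<xi> \<in> L" "norm \<xi> = 1"
    "\<And>x. cinner \<xi> (blinfun_apply (\<sigma> x) \<xi>) = F x"
    "L = closure (range (\<lambda>x. blinfun_apply (\<sigma> x) \<xi>))"
proof -
  obtain V :: "'a \<Rightarrow> 'h" where V: "clinear V" and iso: "\<And>x y. cinner (V x) (V y) = F (star x * y)"
    using isometry_exists[OF u dense] by blast
  define L where "L = closure (range V)"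
  have L: "closed_csubspace L" unfolding L_def by (rule closed_csubspace_closure_range[OF V])
  have VL: "V b \<in> L" for b unfolding L_def by (rule subsetD[OF closure_subset rangeI])
  have "\<exists>W. clinear (blinfun_apply W) \<and> (\<forall>b. blinfun_apply W (V b) = V (x * b)) \<and>
      (\<forall>h. blinfun_apply W h = blinfun_apply W (proj L h)) \<and>
      range (blinfun_apply W) \<subseteq> closure (range (\<lambda>b. V (x * b))) \<and> norm W \<le> q x" for x
    unfolding L_def
  proof (rule extend_from_dense_range[OF V _ q_nonneg])
    show "clinear (\<lambda>b. V (x * b))"
      unfolding clinear_iff by (simp add: distrib_left mult_scaleC_right clinearD[OF V])
    show "norm (V (x * b)) \<le> q x * norm (V b)" for b
    proof (rule power2_le_imp_le)
      show "(norm (V (x * b)))\<^sup>2 \<le> (q x * norm (V b))\<^sup>2"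
        using F_conj_le[of x b] by (simp add: Re_cinner_self[symmetric] iso power_mult_distrib)
    qed (simp add: q_nonneg)
  qed
  then obtain \<sigma> where \<sigma>: "\<And>x. clinear (blinfun_apply (\<sigma> x))" "\<And>x b. blinfun_apply (\<sigma> x) (V b) = V (x * b)"
      "\<And>x h. blinfun_apply (\<sigma> x) h = blinfun_apply (\<sigma> x) (proj L h)"
      "\<And>x. range (blinfun_apply (\<sigma> x)) \<subseteq> closure (range (\<lambda>b. V (x * b)))" "\<And>x. norm (\<sigma> x) \<le> q x"
    by metis
  have \<sigma>L: "blinfun_apply (\<sigma> x) h \<in> L" for x h
  proof -
    have "closure (range (\<lambda>b. V (x * b))) \<subseteq> L" unfolding L_def by (rule closure_mono) auto
    then show ?thesis using \<sigma>(4)[of x] by auto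
  qed
  have seq: "\<exists>b. (\<lambda>n. V (b n)) \<longlonglongrightarrow> proj L h" for h
  proof -
    have "proj L h \<in> closure (range V)" using proj_in[OF L] by (simp add: L_def)
    then obtain b where "(\<lambda>n. V (b n)) \<longlonglongrightarrow> proj L h" by (rule closure_sequence)
    then show ?thesis by blast
  qed
  \<comment> \<open>Operators that vanish off \<open>L\<close> are determined by their values on the range of \<open>V\<close>.\<close>
  have eqI: "T = T'"
    if T: "\<And>h. blinfun_apply T h = blinfun_apply T (proj L h)" "\<And>h. blinfun_apply T' h = blinfun_apply T' (proj L h)"
      "\<And>b. blinfun_apply T (V b) = blinfun_apply T' (V b)" for T T' :: "'h \<Rightarrow>\<^sub>L 'h"
  proof (rule blinfun_eqI)
    fix h
    obtain b where b: "(\<lambda>n. V (b n)) \<longlonglongrightarrow> proj L h" using seq by blast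
    have "(\<lambda>n. blinfun_apply T (V (b n))) \<longlonglongrightarrow> blinfun_apply T (proj L h)"
      by (intro tendsto_intros b)
    moreover have "(\<lambda>n. blinfun_apply T (V (b n))) \<longlonglongrightarrow> blinfun_apply T' (proj L h)"
      unfolding T(3) by (intro tendsto_intros b)
    ultimately have "blinfun_apply T (proj L h) = blinfun_apply T' (proj L h)" by (rule LIMSEQ_unique)
    then show "blinfun_apply T h = blinfun_apply T' h" using T(1)[of h] T(2)[of h] by simp
  qed
  have mult: "\<sigma> (x * y) = \<sigma> x o\<^sub>L \<sigma> y" for x y
  proof (rule eqI)
    show "blinfun_apply (\<sigma> x o\<^sub>L \<sigma> y) h = blinfun_apply (\<sigma> x o\<^sub>L \<sigma> y) (proj L h)" for h
      using \<sigma>(3)[of y h] by simp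
  qed (rule \<sigma>(3), simp add: \<sigma>(2) mult.assoc)
  have adj: "cinner (blinfun_apply (\<sigma> x) h) k = cinner h (blinfun_apply (\<sigma> (star x)) k)" for x h k
  proof -
    obtain b where b: "(\<lambda>n. V (b n)) \<longlonglongrightarrow> proj L h" using seq by blast
    obtain c where c: "(\<lambda>n. V (c n)) \<longlonglongrightarrow> proj L k" using seq by blast
    have "(\<lambda>n. cinner (blinfun_apply (\<sigma> x) (V (b n))) (V (c n)))
        \<longlonglongrightarrow> cinner (blinfun_apply (\<sigma> x) (proj L h)) (proj L k)"
      by (intro tendsto_cinner tendsto_intros b c)
    moreover have "(\<lambda>n. cinner (V (b n)) (blinfun_apply (\<sigma> (star x)) (V (c n))))
        \<longlonglongrightarrow> cinner (proj L h) (blinfun_apply (\<sigma> (star x)) (proj L k))"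
      by (intro tendsto_cinner tendsto_intros b c)
    moreover have "cinner (blinfun_apply (\<sigma> x) (V (b n))) (V (c n))
        = cinner (V (b n)) (blinfun_apply (\<sigma> (star x)) (V (c n)))" for n
      by (simp add: \<sigma>(2) iso star_mult mult.assoc)
    ultimately have "cinner (blinfun_apply (\<sigma> x) (proj L h)) (proj L k)
        = cinner (proj L h) (blinfun_apply (\<sigma> (star x)) (proj L k))"
      using LIMSEQ_unique by simp
    then have "cinner (blinfun_apply (\<sigma> x) h) (proj L k) = cinner (proj L h) (blinfun_apply (\<sigma> (star x)) k)"
      using \<sigma>(3) by simp
    then show ?thesis using cinner_proj[OF L \<sigma>L] cinner_proj_left[OF L \<sigma>L] by simp
  qed
  have lin: "clinear \<sigma>"
    unfolding clinear_iff
  proof (intro conjI allI)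
    show "\<sigma> (x + y) = \<sigma> x + \<sigma> y" for x y
    proof (rule eqI)
      show "blinfun_apply (\<sigma> x + \<sigma> y) h = blinfun_apply (\<sigma> x + \<sigma> y) (proj L h)" for h
        using \<sigma>(3)[of x h] \<sigma>(3)[of y h] by (simp add: blinfun.add_left)
    qed (rule \<sigma>(3), simp add: \<sigma>(2) blinfun.add_left distrib_right clinearD[OF V])
    show "\<sigma> (c *\<^sub>C x) = c *\<^sub>C \<sigma> x" for c x
    proof (rule eqI)
      show "blinfun_apply (c *\<^sub>C \<sigma> x) h = blinfun_apply (c *\<^sub>C \<sigma> x) (proj L h)" for h
        using \<sigma>(3)[of x h] by (simp add: scaleC_blinfun_apply)
    qed (rule \<sigma>(3), simp add: \<sigma>(2) scaleC_blinfun_apply mult_scaleC_left clinearD[OF V])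
  qed
  have one: "blinfun_apply (\<sigma> 1) h = h" if "h \<in> L" for h
  proof -
    obtain b where b: "(\<lambda>n. V (b n)) \<longlonglongrightarrow> proj L h" using seq by blast
    have "(\<lambda>n. blinfun_apply (\<sigma> 1) (V (b n))) \<longlonglongrightarrow> blinfun_apply (\<sigma> 1) (proj L h)"
      by (intro tendsto_intros b)
    then show ?thesis
      using b proj_of_mem[OF L that] LIMSEQ_unique by (simp add: \<sigma>(2))
  qed
  have rep: "unital_representation L \<sigma>"
    unfolding unital_representation_def
  proof (intro conjI allI ballI)
    show "range \<sigma> \<subseteq> carrier (bounded_operators L)"
    proof clarify
      fix x
      have "blinfun_apply (\<sigma> x) h = 0" if "\<forall>y\<in>L. cinner y h = 0" for h
        using \<sigma>(3)[of x h] proj_of_orthogonal[OF L, of h] that by (simp add: blinfun.zero_right)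
      then show "\<sigma> x \<in> carrier (bounded_operators L)"
        using \<sigma>(1)[of x] \<sigma>L by (auto simp: bounded_operators_def)
    qed
    show "\<sigma> (star x) = adjoint_op (\<sigma> x)" for x by (rule adjoint_op_eqI[symmetric]) (rule adj)
  qed (use L lin mult one in auto)
  show ?thesis
  proof (rule that[OF rep \<sigma>(5)])
    show "V 1 \<in> L" by (rule VL)
    have "(norm (V 1))\<^sup>2 = 1" using iso[of 1 1] by (simp add: Re_cinner_self[symmetric] F_one)
    then show "norm (V 1) = 1" by (simp add: power2_eq_1_iff) (metis norm_ge_zero not_one_le_zero neg_0_le_iff_le)
    show "cinner (V 1) (blinfun_apply (\<sigma> x) (V 1)) = F x" for x by (simp add: \<sigma>(2) iso)
    show "L = closure (range (\<lambda>x. blinfun_apply (\<sigma> x) (V 1)))" by (simp add: \<sigma>(2) L_def)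
  qed
qed

end

context cstar_seminorm
begin

text \<open>A vector state takes the value \<open>1\<close> at the unit and is bounded by \<open>q\<close>, so its value at \<open>r + re_part x\<close> is at most
  \<open>q (r + re_part x)\<close> for every \<open>r\<close>.\<close>

lemma vector_state_le_smax:
  fixes \<sigma> :: "'a \<Rightarrow> 'h::chilbert_space \<Rightarrow>\<^sub>L 'h"
  assumes rep: "unital_representation L \<sigma>" and le: "\<And>x. norm (\<sigma> x) \<le> q x" and \<eta>: "\<eta> \<in> L" "\<eta> \<noteq> 0"
  shows "Re (cinner \<eta> (blinfun_apply (\<sigma> x) \<eta>)) / (norm \<eta>)\<^sup>2 \<le> smax x"
proof (rule smax_greatest)
  note D = unital_representationD[OF rep]
  fix r :: real assume "r \<ge> 0"
  have n: "(norm \<eta>)\<^sup>2 > 0" using \<eta> by simp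
  let ?y = "r *\<^sub>R 1 + re_part x"
  have "Re (cinner \<eta> (blinfun_apply (\<sigma> (star x)) \<eta>)) = Re (cinner \<eta> (blinfun_apply (\<sigma> x) \<eta>))"
    using D(9)[of x \<eta> \<eta>] by (metis cinner_commute complex_cnj(1) cnj.sel(1))
  then have "Re (cinner \<eta> (blinfun_apply (\<sigma> ?y) \<eta>)) = r * (norm \<eta>)\<^sup>2 + Re (cinner \<eta> (blinfun_apply (\<sigma> x) \<eta>))"
    by (simp add: re_part_def clinearD[OF D(5)] blinfun.add_left blinfun.scaleR_left D(8)[OF \<eta>(1)]
        cinner_add_right cinner_scaleR_right Re_cinner_self)
  moreover have "Re (cinner \<eta> (blinfun_apply (\<sigma> ?y) \<eta>)) \<le> norm \<eta> * norm (blinfun_apply (\<sigma> ?y) \<eta>)"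
    using complex_Re_le_cmod cinner_Cauchy_Schwarz order_trans by blast
  moreover have "norm \<eta> * norm (blinfun_apply (\<sigma> ?y) \<eta>) \<le> norm \<eta> * (q ?y * norm \<eta>)"
    using norm_blinfun[of "\<sigma> ?y" \<eta>] mult_right_mono[OF le[of ?y] norm_ge_zero[of \<eta>]]
    by (intro mult_left_mono) auto
  ultimately have "r * (norm \<eta>)\<^sup>2 + Re (cinner \<eta> (blinfun_apply (\<sigma> x) \<eta>)) \<le> q ?y * (norm \<eta>)\<^sup>2"
    by (simp add: power2_eq_square mult_ac)
  then show "Re (cinner \<eta> (blinfun_apply (\<sigma> x) \<eta>)) / (norm \<eta>)\<^sup>2 \<le> q ?y - r"
    using n by (simp add: divide_simps algebra_simps)
qed

text \<open>Let \<open>f\<close> be an extreme functional below \<open>smax\<close> with \<open>f (a\<^sup>* a) = (q a)\<^sup>2\<close>; it is the real part of a state, and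
  the representation of this state attains \<open>q a\<close> at the cyclic vector \<open>\<xi>\<close>. An invariant subspace \<open>K\<close> splits \<open>\<xi>\<close> into
  its component \<open>\<eta>\<close> in \<open>K\<close> and the orthogonal part \<open>\<zeta>\<close>, and \<open>f\<close> is a convex combination of the vector states of
  both. If neither of them vanishes, extremality makes the functional of \<open>\<eta>\<close> a multiple of \<open>f\<close>. As \<open>\<xi>\<close> is cyclic, \<open>\<eta>\<close>
  is then a multiple of \<open>\<xi>\<close>, and hence \<open>\<xi>\<close> itself belongs to \<open>K\<close>, a contradiction.\<close>

theorem irreducible_representation_attains:
  fixes u :: "nat \<Rightarrow> 'h::chilbert_space" and d :: "nat \<Rightarrow> 'a"
  assumes u: "\<And>n. orthonormal n u" and dense: "closure (range d) = UNIV"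
  obtains L and \<sigma> :: "'a \<Rightarrow> 'h \<Rightarrow>\<^sub>L 'h" and \<xi>
  where "irreducible_representation L \<sigma>" "\<And>x. norm (\<sigma> x) \<le> q x" "\<xi> \<in> L" "norm \<xi> = 1"
    "norm (blinfun_apply (\<sigma> a) \<xi>) = q a"
proof -
  \<comment> \<open>The element at which the maximum is to be attained comes first in the dense sequence.\<close>
  define d' where "d' = case_nat (star a * a) d"
  have "d k = d' (Suc k)" for k by (simp add: d'_def)
  then have "range d \<subseteq> range d'" by (metis image_subsetI rangeI)
  then have dense': "closure (range d') = UNIV" using dense closure_mono by blast
  have K: "smax x \<le> K * norm x" for x using smax_le_q[of x] q_le_norm[of x] by linarith
  obtain f where f: "linear f" "\<And>x. f x \<le> smax x" "f (d' 0) = smax (d' 0)" and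
    extreme: "\<forall>g h t. linear g \<longrightarrow> linear h \<longrightarrow> (\<forall>x. g x \<le> smax x) \<longrightarrow> (\<forall>x. h x \<le> smax x) \<longrightarrow>
       0 < t \<longrightarrow> t < 1 \<longrightarrow> (\<forall>x. f x = t * g x + (1 - t) * h x) \<longrightarrow> g = f"
    by (rule extreme_functional_exists[OF sublinear_smax K dense']) (rule that, assumption+)
  note flin = linear_add[OF f(1)] linear_scale[OF f(1)] linear_neg[OF f(1)] linear_diff[OF f(1)]
  have skew: "f x = 0" if "star x = - x" for x
  proof -
    have "smax y = 0" if "re_part y = 0" for y
    proof (rule antisym)
      show "smax y \<le> 0" using smax_le[of 0 y] that by simp
      show "0 \<le> smax y" by (rule smax_greatest) (simp add: that q_scaleR q_one)
    qed
    moreover have "re_part x = 0" "re_part (- x) = 0" using that by (simp_all add: re_part_simps)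
    ultimately have "f x \<le> 0" "f (- x) \<le> 0" using f(2)[of x] f(2)[of "- x"] by simp_all
    then show ?thesis by (simp add: flin)
  qed
  have fstar: "f (star x) = f x" for x
    using skew[of "x - star x"] by (simp add: star_diff star_star flin)
  define F where "F x = Complex (f x) (- f (\<i> *\<^sub>C x))" for x
  have F: "cstar_state q K F"
  proof unfold_locales
    show "F (x + y) = F x + F y" for x y by (simp add: F_def flin scaleC_add_right complex_eq_iff)
    show "F (c *\<^sub>C x) = c * F x" for c x
    proof -
      have sc: "c *\<^sub>C y = Re c *\<^sub>R y + Im c *\<^sub>R (\<i> *\<^sub>C y)" for y :: 'a
        by (simp add: scaleR_scaleC scaleC_scaleC complex_eq mult.commute flip: scaleC_add_left)
      have "\<i> *\<^sub>C (c *\<^sub>C x) = Re c *\<^sub>R (\<i> *\<^sub>C x) - Im c *\<^sub>R x"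
        by (subst sc) (simp add: scaleC_add_right scaleR_scaleC scaleC_scaleC mult.left_commute
            complex_vector.scale_minus_left mult.commute)
      then show ?thesis by (simp add: F_def complex_eq_iff sc[of x] flin)
    qed
    show "F (star x) = cnj (F x)" for x
      using fstar[of "\<i> *\<^sub>C x"]
      by (simp add: F_def fstar complex_eq_iff star_scaleC flin complex_vector.scale_minus_left)
    show "Re (F (star x * x)) \<ge> 0" for x
      using f(2)[of "- (star x * x)"] smax_minus_star_mult[of x] by (simp add: F_def flin)
    show "Re (F x) \<le> q x" for x using f(2)[of x] smax_le_q[of x] by (simp add: F_def)
    have "f 1 \<le> 1" using f(2)[of 1] smax_le_q[of 1] q_one by simp
    moreover have "f (- 1) \<le> - 1"
    proof -
      have "smax (- 1) \<le> q (1 *\<^sub>R 1 + re_part (- 1)) - 1" by (rule smax_le) simp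
      then show ?thesis using f(2)[of "- 1"] by (simp add: re_part_simps)
    qed
    moreover have "f (\<i> *\<^sub>C 1) = 0"
      by (rule skew) (simp add: star_scaleC complex_vector.scale_minus_left)
    ultimately show "F 1 = 1" by (simp add: F_def flin complex_eq_iff)
  qed
  have ReF: "Re (F x) = f x" for x by (simp add: F_def)
  obtain L and \<sigma> :: "'a \<Rightarrow> 'h \<Rightarrow>\<^sub>L 'h" and \<xi> where rep: "unital_representation L \<sigma>"
    and le: "\<And>x. norm (\<sigma> x) \<le> q x" and \<xi>: "\<xi> \<in> L" "norm \<xi> = 1"
    and F\<xi>: "\<And>x. cinner \<xi> (blinfun_apply (\<sigma> x) \<xi>) = F x"
    and Lcl: "L = closure (range (\<lambda>x. blinfun_apply (\<sigma> x) \<xi>))"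
    by (rule cstar_state.gns_representation[OF F u dense]) (rule that, assumption+)
  note D = unital_representationD[OF rep]
  have irr: "K = {0} \<or> K = L"
    if K: "closed_csubspace K" "K \<subseteq> L" "\<And>a. blinfun_apply (\<sigma> a) ` K \<subseteq> K" for K
  proof -
    have KD: "h \<in> K \<Longrightarrow> blinfun_apply (\<sigma> x) h \<in> K" for x h using K(3)[of x] by blast
    have perp: "cinner k (blinfun_apply (\<sigma> x) (h - proj K h)) = 0" if "k \<in> K" for k x h
      using proj_orthogonal[OF K(1) KD[OF that, of "star x"], of h] D(10) by simp
    have comm: "proj K (blinfun_apply (\<sigma> x) h) = blinfun_apply (\<sigma> x) (proj K h)" for x h
    proof (rule proj_unique[OF K(1)])
      show "blinfun_apply (\<sigma> x) (proj K h) \<in> K" by (rule KD[OF proj_in[OF K(1)]])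
      show "cinner k (blinfun_apply (\<sigma> x) h - blinfun_apply (\<sigma> x) (proj K h)) = 0" if "k \<in> K" for k
        using perp[OF that, of x h] by (simp add: blinfun.diff_right)
    qed
    define \<eta> \<zeta> where "\<eta> = proj K \<xi>" and "\<zeta> = \<xi> - \<eta>"
    have \<eta>K: "\<eta> \<in> K" unfolding \<eta>_def by (rule proj_in[OF K(1)])
    have \<zeta>L: "\<zeta> \<in> L" unfolding \<zeta>_def using \<eta>K K(2) \<xi>(1) closed_csubspaceD(4)[OF D(1)] by blast
    have cross: "cinner \<eta> (blinfun_apply (\<sigma> x) \<zeta>) = 0" for x
      unfolding \<zeta>_def \<eta>_def by (rule perp[OF proj_in[OF K(1)]])
    have cross': "cinner \<zeta> (blinfun_apply (\<sigma> x) \<eta>) = 0" for x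
      using cross[of "star x"] D(10)[of \<zeta> x \<eta>] cinner_commute[of "blinfun_apply (\<sigma> (star x)) \<zeta>" \<eta>] by simp
    have split: "f x = Re (cinner \<eta> (blinfun_apply (\<sigma> x) \<eta>)) + Re (cinner \<zeta> (blinfun_apply (\<sigma> x) \<zeta>))" for x
    proof -
      have "\<xi> = \<eta> + \<zeta>" by (simp add: \<zeta>_def)
      then show ?thesis
        unfolding ReF[symmetric] F\<xi>[symmetric]
        by (simp add: blinfun.add_right cinner_add_left cinner_add_right cross cross')
    qed
    have sq: "(norm \<eta>)\<^sup>2 + (norm \<zeta>)\<^sup>2 = 1"
    proof -
      have "cinner \<eta> \<zeta> = 0" unfolding \<zeta>_def using proj_orthogonal[OF K(1) \<eta>K] by (simp add: \<eta>_def)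
      from norm_pythagoras[OF this] show ?thesis using \<xi>(2) by (simp add: \<zeta>_def)
    qed
    consider "\<eta> = 0" | "\<zeta> = 0" | "\<eta> \<noteq> 0" "\<zeta> \<noteq> 0" by blast
    then show ?thesis
    proof cases
      case 1
      have "proj K h = 0" if "h \<in> L" for h
      proof -
        have "closed {h. proj K h = 0}"
          by (intro closed_Collect_eq continuous_intros
              bounded_linear.continuous_on[OF bounded_linear_proj[OF K(1)]])
        moreover have "range (\<lambda>x. blinfun_apply (\<sigma> x) \<xi>) \<subseteq> {h. proj K h = 0}"
          using 1 by (auto simp: comm \<eta>_def blinfun.zero_right)
        ultimately have "L \<subseteq> {h. proj K h = 0}" unfolding Lcl by (rule closure_minimal[rotated])
        then show ?thesis using that by blast
      qed
      then have "K \<subseteq> {0}" using proj_of_mem[OF K(1)] K(2) by force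
      then show ?thesis using closed_csubspaceD(1)[OF K(1)] by blast
    next
      case 2
      then have "\<xi> \<in> K" using \<eta>K by (simp add: \<zeta>_def)
      then have "range (\<lambda>x. blinfun_apply (\<sigma> x) \<xi>) \<subseteq> K" using KD by blast
      then have "L \<subseteq> K" unfolding Lcl using closed_csubspaceD(6)[OF K(1)] by (rule closure_minimal)
      then show ?thesis using K(2) by blast
    next
      case 3
      define t where "t = (norm \<eta>)\<^sup>2"
      have t: "0 < t" "t < 1" "(norm \<zeta>)\<^sup>2 = 1 - t"
        using 3 sq by (auto simp: t_def) (smt (verit) zero_less_norm_iff zero_less_power)
      define g h where "g x = Re (cinner \<eta> (blinfun_apply (\<sigma> x) \<eta>)) / t"
        and "h x = Re (cinner \<zeta> (blinfun_apply (\<sigma> x) \<zeta>)) / (1 - t)" for x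
      have lin: "linear (\<lambda>x. Re (cinner k (blinfun_apply (\<sigma> x) k)) / c)" for k c
        by (rule linearI)
          (simp_all add: clinearD[OF D(5)] blinfun.add_left blinfun.scaleR_left cinner_add_right
            cinner_scaleR_right add_divide_distrib)
      have "g = f"
      proof (rule extreme[rule_format])
        show "linear g" "linear h" unfolding g_def[abs_def] h_def[abs_def] by (rule lin)+
        show "g x \<le> smax x" for x
          using vector_state_le_smax[OF rep le subsetD[OF K(2) \<eta>K] 3(1)] by (simp add: g_def t_def)
        show "h x \<le> smax x" for x
          using vector_state_le_smax[OF rep le \<zeta>L 3(2)] by (simp add: h_def t(3))
        show "f x = t * g x + (1 - t) * h x" for x using split[of x] t by (simp add: g_def h_def)
      qed (use t in auto)
      then have re: "Re (cinner \<eta> (blinfun_apply (\<sigma> x) \<eta>)) = t * Re (cinner \<xi> (blinfun_apply (\<sigma> x) \<xi>))" for x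
        using t(1) ReF[of x] F\<xi>[of x] by (auto simp: g_def fun_eq_iff field_simps)
      have cpx: "cinner \<eta> (blinfun_apply (\<sigma> x) \<eta>) = t * cinner \<xi> (blinfun_apply (\<sigma> x) \<xi>)" for x
      proof (rule complex_eqI)
        show "Im (cinner \<eta> (blinfun_apply (\<sigma> x) \<eta>)) = Im (t * cinner \<xi> (blinfun_apply (\<sigma> x) \<xi>))"
          using re[of "\<i> *\<^sub>C x"]
          by (simp add: clinearD[OF D(5)] scaleC_blinfun_apply cinner_scaleC_right)
      qed (simp add: re)
      have z: "cinner (blinfun_apply (\<sigma> x) \<xi>) (\<eta> - t *\<^sub>R \<xi>) = 0" for x
      proof -
        have "cinner (blinfun_apply (\<sigma> x) \<xi>) \<eta> = cinner \<xi> (blinfun_apply (\<sigma> (star x)) \<eta>)" by (rule D(9))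
        also have "\<dots> = cinner \<eta> (blinfun_apply (\<sigma> (star x)) \<eta>)"
          using cross'[of "star x"] by (simp add: \<zeta>_def cinner_diff_left)
        also have "\<dots> = t * cinner \<xi> (blinfun_apply (\<sigma> (star x)) \<xi>)" by (rule cpx)
        also have "\<dots> = t * cinner (blinfun_apply (\<sigma> x) \<xi>) \<xi>" by (simp add: D(9))
        finally show ?thesis by (simp add: cinner_diff_right cinner_scaleR_right)
      qed
      have "closed {h. cinner h (\<eta> - t *\<^sub>R \<xi>) = 0}"
        by (intro closed_Collect_eq continuous_intros bounded_bilinear.continuous_on[OF bounded_bilinear_cinner])
      then have "L \<subseteq> {h. cinner h (\<eta> - t *\<^sub>R \<xi>) = 0}"
        unfolding Lcl by (rule closure_minimal[rotated]) (use z in auto)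
      moreover have "\<eta> - t *\<^sub>R \<xi> \<in> L"
        by (rule closed_csubspaceD(4)[OF D(1) subsetD[OF K(2) \<eta>K] closed_csubspaceD(5)[OF D(1) \<xi>(1)]])
      ultimately have "cinner (\<eta> - t *\<^sub>R \<xi>) (\<eta> - t *\<^sub>R \<xi>) = 0" by blast
      then have e: "\<eta> = t *\<^sub>R \<xi>" by simp
      then have "proj K \<eta> = t *\<^sub>R \<eta>" by (simp add: clinearD[OF clinear_proj[OF K(1)]] \<eta>_def[symmetric])
      then have "\<eta> = t *\<^sub>R \<eta>" using proj_of_mem[OF K(1) \<eta>K] by simp
      then have "(1 - t) *\<^sub>R \<eta> = 0" by (simp add: scaleR_diff_left)
      then show ?thesis using t 3 by simp
    qed
  qed
  have "L \<noteq> {0}" using \<xi> by auto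
  then have I: "irreducible_representation L \<sigma>"
    unfolding irreducible_representation_def using rep irr by blast
  have "(norm (blinfun_apply (\<sigma> a) \<xi>))\<^sup>2 = Re (cinner \<xi> (blinfun_apply (\<sigma> (star a * a)) \<xi>))"
    by (simp add: D(6) D(9)[symmetric] Re_cinner_self)
  also have "\<dots> = f (star a * a)" by (simp add: F\<xi> ReF)
  also have "\<dots> = (q a)\<^sup>2" using f(3) smax_star_mult[of a] by (simp add: d'_def)
  finally have "norm (blinfun_apply (\<sigma> a) \<xi>) = q a" using q_nonneg by (simp add: power2_eq_iff_nonneg)
  then show ?thesis using that[OF I le \<xi>] by blast
qed

end

section \<open>Seminorms given by representations\<close>

lemma cstar_seminorm_norm: "cstar_seminorm (norm :: 'a::cstar_algebra \<Rightarrow> real) 1"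
proof unfold_locales
  show "norm (r *\<^sub>R 1 - star x * x) \<le> r" if "(norm x)\<^sup>2 \<le> r" for x :: 'a and r
    by (rule pos_norm_diff[OF pos_star_mult]) (simp add: norm_star_mult that)
  show "r + (norm x)\<^sup>2 \<le> norm (r *\<^sub>R 1 + star x * x)" if "r \<ge> 0" for x :: 'a and r
    using norm_add_real_pos[OF pos_star_mult that, of x] by (simp add: norm_star_mult)
qed (simp_all add: norm_triangle_ineq norm_scaleC norm_mult_ineq)

text \<open>Write \<open>(norm x)\<^sup>2 - x\<^sup>* x\<close> as \<open>c\<^sup>* c\<close> and apply \<open>\<pi>\<close>.\<close>

lemma representation_contractive:
  fixes \<pi> :: "'a::cstar_algebra \<Rightarrow> 'h::chilbert_space \<Rightarrow>\<^sub>L 'h"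
  assumes "unital_representation L \<pi>"
  shows "norm (\<pi> x) \<le> norm x"
proof (rule norm_blinfun_bound)
  note D = unital_representationD[OF assms]
  fix h
  define k where "k = proj L h"
  have kL: "k \<in> L" unfolding k_def by (rule proj_in[OF D(1)])
  have inner: "cinner k (blinfun_apply (\<pi> (star y * y)) k) = of_real ((norm (blinfun_apply (\<pi> y) k))\<^sup>2)" for y
    by (simp only: D(6) D(9)[symmetric] cinner_self)
  obtain c where c: "star x * x + star c * c = (norm x)\<^sup>2 *\<^sub>R 1"
    using star_mult_complement[of x "(norm x)\<^sup>2"] by auto
  have "Re (cinner k (blinfun_apply (\<pi> (star x * x + star c * c)) k)) = (norm x)\<^sup>2 * (norm k)\<^sup>2"
    unfolding c by (simp add: clinearD[OF D(5)] blinfun.scaleR_left D(8)[OF kL] cinner_scaleR_right cinner_self)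
  then have "(norm (blinfun_apply (\<pi> x) k))\<^sup>2 + (norm (blinfun_apply (\<pi> c) k))\<^sup>2 = (norm x)\<^sup>2 * (norm k)\<^sup>2"
    by (simp add: clinearD[OF D(5)] blinfun.add_left cinner_add_right inner del: of_real_power)
  then have "(norm (blinfun_apply (\<pi> x) k))\<^sup>2 \<le> (norm x * norm k)\<^sup>2"
    by (simp add: power_mult_distrib) (smt (verit) zero_le_power2)
  then have "norm (blinfun_apply (\<pi> x) k) \<le> norm x * norm k" by (rule power2_le_imp_le) simp
  also have "\<dots> \<le> norm x * norm h"
    unfolding k_def by (intro mult_left_mono norm_proj_le[OF D(1)]) simp
  finally show "norm (blinfun_apply (\<pi> x) h) \<le> norm x * norm h"
    using representation_proj[OF assms, of x h] by (simp add: k_def)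
qed simp

text \<open>The conditions on \<open>x\<^sup>* x\<close> are proved on vectors of \<open>L\<close>, where \<open>\<langle>k, \<pi> (x\<^sup>* x) k\<rangle>\<close> is the square of the norm of
  \<open>\<pi> x k\<close>.\<close>

lemma cstar_seminorm_representation:
  fixes \<pi> :: "'a::cstar_algebra \<Rightarrow> 'h::chilbert_space \<Rightarrow>\<^sub>L 'h"
  assumes rep: "unital_representation L \<pi>" and L: "L \<noteq> {0}"
  shows "cstar_seminorm (\<lambda>x. norm (\<pi> x)) 1"
proof -
  note D = unital_representationD[OF rep]
  have star_le: "norm (\<pi> (star x)) \<le> norm (\<pi> x)" for x
  proof (rule norm_blinfun_bound)
    fix h
    let ?k = "blinfun_apply (\<pi> (star x)) h"
    have "(norm ?k)\<^sup>2 = Re (cinner ?k ?k)" by (simp add: Re_cinner_self)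
    also have "\<dots> = Re (cinner h (blinfun_apply (\<pi> x) ?k))" by (simp add: D(9) star_star)
    also have "\<dots> \<le> norm h * norm (blinfun_apply (\<pi> x) ?k)"
      using complex_Re_le_cmod cinner_Cauchy_Schwarz order_trans by blast
    also have "\<dots> \<le> norm h * (norm (\<pi> x) * norm ?k)" by (intro mult_left_mono norm_blinfun) simp
    finally have "norm ?k * norm ?k \<le> (norm (\<pi> x) * norm h) * norm ?k"
      by (simp add: power2_eq_square mult_ac)
    then show "norm ?k \<le> norm (\<pi> x) * norm h" by (cases "norm ?k = 0") simp_all
  qed simp
  have inner: "cinner k (blinfun_apply (\<pi> (star y * y)) k) = of_real ((norm (blinfun_apply (\<pi> y) k))\<^sup>2)" for y k
    by (simp only: D(6) D(9)[symmetric] cinner_self)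
  obtain l where l: "l \<in> L" "l \<noteq> 0" using L closed_csubspaceD(1)[OF D(1)] by blast
  show ?thesis
  proof unfold_locales
    show "norm (\<pi> (x + y)) \<le> norm (\<pi> x) + norm (\<pi> y)" for x y
      by (simp add: clinearD[OF D(5)] norm_triangle_ineq)
    show "norm (\<pi> (c *\<^sub>C x)) = cmod c * norm (\<pi> x)" for c x
      by (simp add: clinearD[OF D(5)] norm_scaleC)
    show "norm (\<pi> (x * y)) \<le> norm (\<pi> x) * norm (\<pi> y)" for x y
    proof -
      have "\<pi> (x * y) = \<pi> x o\<^sub>L \<pi> y" by (rule blinfun_eqI) (simp add: D(6))
      then show ?thesis using norm_blinfun_compose by metis
    qed
    show "norm (\<pi> (star x)) = norm (\<pi> x)" for x
      using star_le[of x] star_le[of "star x"] by (simp add: star_star)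
    show "norm (\<pi> x) \<le> 1 * norm x" for x using representation_contractive[OF rep, of x] by simp
    have "norm l \<le> norm (\<pi> 1) * norm l" using norm_blinfun[of "\<pi> 1" l] D(8)[OF l(1)] by simp
    then show "norm (\<pi> 1) = 1" using l representation_contractive[OF rep, of 1] by simp
    show "norm (\<pi> (r *\<^sub>R 1 - star x * x)) \<le> r" if r: "(norm (\<pi> x))\<^sup>2 \<le> r" for x r
    proof (rule norm_blinfun_bound)
      show r0: "r \<ge> 0" using r by (smt (verit) zero_le_power2)
      fix h
      define k where "k = proj L h"
      have kL: "k \<in> L" unfolding k_def by (rule proj_in[OF D(1)])
      let ?T = "blinfun_apply (\<pi> (star x * x)) k"
      have "norm ?T \<le> norm (\<pi> x) * norm (blinfun_apply (\<pi> x) k)"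
        using norm_blinfun[of "\<pi> (star x)" "blinfun_apply (\<pi> x) k"]
          mult_right_mono[OF star_le[of x] norm_ge_zero[of "blinfun_apply (\<pi> x) k"]] by (simp add: D(6))
      then have "(norm ?T)\<^sup>2 \<le> (norm (\<pi> x) * norm (blinfun_apply (\<pi> x) k))\<^sup>2" by (rule power_mono) simp
      also have "\<dots> \<le> r * (norm (blinfun_apply (\<pi> x) k))\<^sup>2"
        by (simp add: power_mult_distrib mult_right_mono r)
      finally have T: "(norm ?T)\<^sup>2 \<le> r * (norm (blinfun_apply (\<pi> x) k))\<^sup>2" .
      have "blinfun_apply (\<pi> (r *\<^sub>R 1 - star x * x)) k = r *\<^sub>R k - ?T"
        by (simp add: clinearD[OF D(5)] blinfun.diff_left blinfun.scaleR_left D(8)[OF kL])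
      then have "(norm (blinfun_apply (\<pi> (r *\<^sub>R 1 - star x * x)) k))\<^sup>2
          = (r * norm k)\<^sup>2 - 2 * (r * (norm (blinfun_apply (\<pi> x) k))\<^sup>2) + (norm ?T)\<^sup>2"
        using inner[of k x] by (simp add: norm_diff_square cinner_scaleR_left power_mult_distrib
            del: of_real_power)
      also have "\<dots> \<le> (r * norm k)\<^sup>2"
        using T mult_nonneg_nonneg[OF r0 zero_le_power2[of "norm (blinfun_apply (\<pi> x) k)"]] by linarith
      finally have "norm (blinfun_apply (\<pi> (r *\<^sub>R 1 - star x * x)) k) \<le> r * norm k"
        by (rule power2_le_imp_le) (simp add: r0)
      also have "\<dots> \<le> r * norm h" unfolding k_def by (intro mult_left_mono norm_proj_le[OF D(1)] r0)
      finally show "norm (blinfun_apply (\<pi> (r *\<^sub>R 1 - star x * x)) h) \<le> r * norm h"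
        using representation_proj[OF rep, of _ h] by (simp add: k_def)
    qed
    show "r + (norm (\<pi> x))\<^sup>2 \<le> norm (\<pi> (r *\<^sub>R 1 + star x * x))" if r: "r \<ge> 0" for x r
    proof -
      define s where "s = norm (\<pi> (r *\<^sub>R 1 + star x * x))"
      have le: "(norm (blinfun_apply (\<pi> x) k))\<^sup>2 \<le> (s - r) * (norm k)\<^sup>2" if kL: "k \<in> L" for k
      proof -
        have "r * (norm k)\<^sup>2 + (norm (blinfun_apply (\<pi> x) k))\<^sup>2
            = Re (cinner k (blinfun_apply (\<pi> (r *\<^sub>R 1 + star x * x)) k))"
          using inner[of k x]
          by (simp add: clinearD[OF D(5)] blinfun.add_left blinfun.scaleR_left D(8)[OF kL]
              cinner_add_right cinner_scaleR_right Re_cinner_self del: of_real_power)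
        also have "\<dots> \<le> norm k * norm (blinfun_apply (\<pi> (r *\<^sub>R 1 + star x * x)) k)"
          using complex_Re_le_cmod cinner_Cauchy_Schwarz order_trans by blast
        also have "\<dots> \<le> norm k * (s * norm k)"
          unfolding s_def by (intro mult_left_mono norm_blinfun) simp
        finally show ?thesis by (simp add: algebra_simps power2_eq_square)
      qed
      have "0 \<le> (s - r) * (norm l)\<^sup>2" using le[OF l(1)] by (smt (verit) zero_le_power2)
      moreover have "(norm l)\<^sup>2 > 0" using l(2) by simp
      ultimately have sr: "s - r \<ge> 0" by (meson mult_neg_pos not_less)
      have "norm (\<pi> x) \<le> sqrt (s - r)"
      proof (rule norm_blinfun_bound)
        show "0 \<le> sqrt (s - r)" using sr by simp
        fix h
        have "norm (blinfun_apply (\<pi> x) (proj L h)) \<le> sqrt ((s - r) * (norm (proj L h))\<^sup>2)"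
          by (rule real_le_rsqrt) (rule le[OF proj_in[OF D(1)]])
        also have "\<dots> = sqrt (s - r) * norm (proj L h)" by (simp add: real_sqrt_mult)
        also have "\<dots> \<le> sqrt (s - r) * norm h"
          by (intro mult_left_mono norm_proj_le[OF D(1)]) (use sr in simp)
        finally show "norm (blinfun_apply (\<pi> x) h) \<le> sqrt (s - r) * norm h"
          using representation_proj[OF rep, of x h] by simp
      qed
      then have "(norm (\<pi> x))\<^sup>2 \<le> (sqrt (s - r))\<^sup>2" by (rule power_mono) simp
      then show ?thesis using sr by (simp add: s_def)
    qed
  qed
qed

section \<open>Operators on a finite-dimensional space as matrices\<close>

definition op_of :: "nat \<Rightarrow> (nat \<Rightarrow> 'h::chilbert_space) \<Rightarrow> (nat \<Rightarrow> nat \<Rightarrow> complex) \<Rightarrow> 'h \<Rightarrow>\<^sub>L 'h"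
  where "op_of n e M = Blinfun (\<lambda>h. comb n e (\<lambda>i. \<Sum>j<n. M i j * cinner (e j) h))"

definition matrix_of :: "(nat \<Rightarrow> 'h::chilbert_space) \<Rightarrow> ('h \<Rightarrow>\<^sub>L 'h) \<Rightarrow> nat \<Rightarrow> nat \<Rightarrow> complex"
  where "matrix_of e T i j = cinner (e i) (blinfun_apply T (e j))"

lemma cmod_matrix_of_le:
  assumes "orthonormal n e" "i < n" "j < n"
  shows "cmod (matrix_of e T i j) \<le> norm T"
  using cinner_Cauchy_Schwarz[of "e i" "blinfun_apply T (e j)"] norm_blinfun[of T "e j"]
    norm_orthonormal[OF assms(1,2)] norm_orthonormal[OF assms(1,3)]
  unfolding matrix_of_def by simp

lemma op_of_apply: "blinfun_apply (op_of n e M) h = comb n e (\<lambda>i. \<Sum>j<n. M i j * cinner (e j) h)"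
proof -
  have "bounded_linear (\<lambda>h. comb n e (\<lambda>i. \<Sum>j<n. M i j * cinner (e j) h))"
    unfolding comb_def
    by (intro bounded_linear_sum bounded_linear_compose[OF bounded_bilinear.bounded_linear_left[OF bounded_bilinear_scaleC]]
        bounded_linear_mult_right[THEN bounded_linear_compose]
        bounded_bilinear.bounded_linear_right[OF bounded_bilinear_cinner])
  then show ?thesis by (simp add: op_of_def bounded_linear_Blinfun_apply)
qed

lemma op_of_cong: "(\<And>i j. i < n \<Longrightarrow> j < n \<Longrightarrow> M i j = N i j) \<Longrightarrow> op_of n e M = op_of n e N"
  by (rule blinfun_eqI) (auto simp: op_of_apply comb_def intro!: sum.cong arg_cong2[where f = scaleC])

lemma op_of_add: "op_of n e (\<lambda>i j. M i j + N i j) = op_of n e M + op_of n e N"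
  by (rule blinfun_eqI) (simp add: op_of_apply blinfun.add_left distrib_right sum.distrib comb_add)

lemma op_of_scaleC: "op_of n e (\<lambda>i j. c * M i j) = c *\<^sub>C op_of n e M"
  by (rule blinfun_eqI) (simp add: op_of_apply scaleC_blinfun_apply comb_scaleC[symmetric] sum_distrib_left mult.assoc)

lemma clinear_op_of: "clinear (blinfun_apply (op_of n e M))"
  unfolding clinear_iff
  by (auto simp: blinfun.add_right op_of_apply cinner_scaleC_right comb_scaleC[symmetric]
      sum_distrib_left mult.left_commute)

context
  fixes n :: nat and e :: "nat \<Rightarrow> 'h::chilbert_space"
  assumes on: "orthonormal n e"
begin

lemma op_of_basis: "j < n \<Longrightarrow> blinfun_apply (op_of n e M) (e j) = comb n e (\<lambda>i. M i j)"
proof -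
  assume j: "j < n"
  have "(\<Sum>k<n. M i k * cinner (e k) (e j)) = (\<Sum>k<n. if k = j then M i j else 0)" for i
    using on j by (intro sum.cong) (auto simp: orthonormal_def)
  then show ?thesis using j by (simp add: op_of_apply)
qed

lemma matrix_of_op_of: "i < n \<Longrightarrow> j < n \<Longrightarrow> matrix_of e (op_of n e M) i j = M i j"
  by (simp add: matrix_of_def op_of_basis cinner_comb_right[OF on])

lemma op_of_carrier: "op_of n e M \<in> carrier (bounded_operators (cspan (e ` {..<n})))"
  unfolding bounded_operators_def
proof (simp, intro conjI allI impI)
  show "clinear (blinfun_apply (op_of n e M))" by (rule clinear_op_of)
  show "range (blinfun_apply (op_of n e M)) \<subseteq> cspan (e ` {..<n})"
    by (auto simp: op_of_apply cspan_eq_range_comb)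
  fix x assume "\<forall>y\<in>cspan (e ` {..<n}). cinner y x = 0"
  then have "cinner (e j) x = 0" if "j < n" for j using that by (simp add: complex_vector.span_base)
  then show "blinfun_apply (op_of n e M) x = 0" by (simp add: op_of_apply comb_def)
qed

lemma op_of_matrix_of:
  assumes T: "T \<in> carrier (bounded_operators (cspan (e ` {..<n})))"
  shows "op_of n e (matrix_of e T) = T"
proof (rule blinfun_eqI)
  fix h
  let ?L = "cspan (e ` {..<n})"
  have TD: "clinear (blinfun_apply T)" "blinfun_apply T x \<in> ?L"
    "(\<And>y. y \<in> ?L \<Longrightarrow> cinner y x = 0) \<Longrightarrow> blinfun_apply T x = 0" for x
    using T by (auto simp: bounded_operators_def)
  have "blinfun_apply T (h - proj ?L h) = 0"
    by (rule TD(3)) (rule proj_orthogonal[OF closed_csubspace_cspan[OF on]])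
  then have "blinfun_apply T h = blinfun_apply T (proj ?L h)" by (simp add: blinfun.diff_right)
  also have "\<dots> = (\<Sum>j<n. cinner (e j) h *\<^sub>C blinfun_apply T (e j))"
    by (simp add: proj_cspan[OF on] comb_def clinearD[OF TD(1)])
  also have "\<dots> = (\<Sum>j<n. cinner (e j) h *\<^sub>C comb n e (\<lambda>i. matrix_of e T i j))"
    using orthonormal_expansion[OF on] TD(2) by (simp add: matrix_of_def)
  also have "\<dots> = blinfun_apply (op_of n e (matrix_of e T)) h"
    by (simp add: op_of_apply comb_def complex_vector.scale_sum_right complex_vector.scale_sum_left
        scaleC_scaleC) (subst sum.swap, simp add: mult.commute)
  finally show "blinfun_apply (op_of n e (matrix_of e T)) h = blinfun_apply T h" ..
qed

lemma matrix_of_comp: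
  assumes S: "S \<in> carrier (bounded_operators (cspan (e ` {..<n})))"
    and T: "T \<in> carrier (bounded_operators (cspan (e ` {..<n})))"
  shows "matrix_of e (S o\<^sub>L T) i j = (\<Sum>k<n. matrix_of e S i k * matrix_of e T k j)"
proof -
  have S1: "clinear (blinfun_apply S)" using S by (simp add: bounded_operators_def)
  have "blinfun_apply T (e j) \<in> cspan (e ` {..<n})" using T by (auto simp: bounded_operators_def)
  then have "blinfun_apply T (e j) = comb n e (\<lambda>k. matrix_of e T k j)"
    using orthonormal_expansion[OF on] by (simp add: matrix_of_def)
  then have "matrix_of e (S o\<^sub>L T) i j = cinner (e i) (blinfun_apply S (comb n e (\<lambda>k. matrix_of e T k j)))"
    by (simp add: matrix_of_def[of e "S o\<^sub>L T"])
  then show ?thesis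
    by (simp add: matrix_of_def[of e S] comb_def clinearD[OF S1] cinner_sum_right cinner_scaleC_right
        mult.commute)
qed

lemma op_of_mult: "op_of n e M o\<^sub>L op_of n e N = op_of n e (\<lambda>i j. \<Sum>k<n. M i k * N k j)"
proof -
  have c: "op_of n e M o\<^sub>L op_of n e N \<in> carrier (bounded_operators (cspan (e ` {..<n})))"
    using op_of_carrier[of M] op_of_carrier[of N]
    by (auto simp: bounded_operators_def clinear_iff blinfun.add_right blinfun.zero_right)
  have "op_of n e M o\<^sub>L op_of n e N = op_of n e (matrix_of e (op_of n e M o\<^sub>L op_of n e N))"
    by (rule op_of_matrix_of[OF c, symmetric])
  also have "\<dots> = op_of n e (\<lambda>i j. \<Sum>k<n. M i k * N k j)"
    by (rule op_of_cong) (simp add: matrix_of_comp[OF op_of_carrier op_of_carrier] matrix_of_op_of)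
  finally show ?thesis .
qed

lemma op_of_adjoint: "adjoint_op (op_of n e M) = op_of n e (\<lambda>i j. cnj (M j i))"
proof (rule adjoint_op_eqI)
  fix x y
  have "cinner (blinfun_apply (op_of n e M) x) y
      = (\<Sum>i<n. \<Sum>j<n. cnj (M i j) * cnj (cinner (e j) x) * cinner (e i) y)"
    by (simp add: op_of_apply comb_def cinner_sum_left cinner_scaleC_left sum_distrib_right)
  also have "\<dots> = (\<Sum>j<n. \<Sum>i<n. cnj (M i j) * cnj (cinner (e j) x) * cinner (e i) y)"
    by (rule sum.swap)
  also have "\<dots> = cinner x (blinfun_apply (op_of n e (\<lambda>i j. cnj (M j i))) y)"
    by (simp add: op_of_apply comb_def cinner_sum_right cinner_scaleC_right sum_distrib_left
        mult_ac flip: cinner_commute)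
  finally show "cinner (blinfun_apply (op_of n e M) x) y
      = cinner x (blinfun_apply (op_of n e (\<lambda>i j. cnj (M j i))) y)" .
qed

lemma op_of_identity:
  assumes "h \<in> cspan (e ` {..<n})" "\<And>i j. i < n \<Longrightarrow> j < n \<Longrightarrow> M i j = (if i = j then 1 else 0)"
  shows "blinfun_apply (op_of n e M) h = h"
proof -
  have "op_of n e M = op_of n e (\<lambda>i j. if i = j then 1 else 0)" by (rule op_of_cong) (rule assms(2))
  then have "blinfun_apply (op_of n e M) h = comb n e (\<lambda>i. cinner (e i) h)"
    by (simp add: op_of_apply comb_def if_distrib[of "\<lambda>c. c * _"] cong: if_cong)
  then show ?thesis using assms(1) orthonormal_expansion[OF on] by simp
qed

end

definition matrix_representation :: "nat \<Rightarrow> ('a::cstar_algebra \<Rightarrow> nat \<Rightarrow> nat \<Rightarrow> complex) \<Rightarrow> bool"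
  where "matrix_representation n R \<longleftrightarrow> (\<forall>i<n. \<forall>j<n.
    (\<forall>x y. R (x + y) i j = R x i j + R y i j) \<and> (\<forall>c x. R (c *\<^sub>C x) i j = c * R x i j) \<and>
    (\<forall>x y. R (x * y) i j = (\<Sum>k<n. R x i k * R y k j)) \<and> (\<forall>x. R (star x) i j = cnj (R x j i)) \<and>
    R 1 i j = (if i = j then 1 else 0))"

lemma unital_representation_op_of:
  assumes on: "orthonormal n e" and R: "matrix_representation n R"
  shows "unital_representation (cspan (e ` {..<n})) (\<lambda>x. op_of n e (R x))"
  unfolding unital_representation_def
proof (intro conjI allI ballI)
  note RD = R[unfolded matrix_representation_def, rule_format]
  show "closed_csubspace (cspan (e ` {..<n}))" by (rule closed_csubspace_cspan[OF on])
  show "range (\<lambda>x. op_of n e (R x)) \<subseteq> carrier (bounded_operators (cspan (e ` {..<n})))"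
    using op_of_carrier[OF on] by blast
  show "clinear (\<lambda>x. op_of n e (R x))"
    unfolding clinear_iff op_of_add[symmetric] op_of_scaleC[symmetric]
    using RD by (auto intro!: op_of_cong)
  show "op_of n e (R (x * y)) = op_of n e (R x) o\<^sub>L op_of n e (R y)" for x y
    unfolding op_of_mult[OF on] using RD by (intro op_of_cong) auto
  show "op_of n e (R (star x)) = adjoint_op (op_of n e (R x))" for x
    unfolding op_of_adjoint[OF on] using RD by (intro op_of_cong) auto
  show "blinfun_apply (op_of n e (R 1)) h = h" if "h \<in> cspan (e ` {..<n})" for h
    using op_of_identity[OF on that] RD by auto
qed

lemma matrix_representation_matrix_of:
  assumes on: "orthonormal n e" and rep: "unital_representation (cspan (e ` {..<n})) \<pi>"
  shows "matrix_representation n (\<lambda>x. matrix_of e (\<pi> x))"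
  unfolding matrix_representation_def
proof (intro allI impI conjI)
  note D = unital_representationD[OF rep]
  have c: "\<pi> x \<in> carrier (bounded_operators (cspan (e ` {..<n})))" for x
    using rep by (auto simp: unital_representation_def)
  fix i j assume ij: "i < n" "j < n"
  show "matrix_of e (\<pi> (x + y)) i j = matrix_of e (\<pi> x) i j + matrix_of e (\<pi> y) i j" for x y
    by (simp add: matrix_of_def clinearD[OF D(5)] blinfun.add_left cinner_add_right)
  show "matrix_of e (\<pi> (a *\<^sub>C x)) i j = a * matrix_of e (\<pi> x) i j" for a x
    by (simp add: matrix_of_def clinearD[OF D(5)] scaleC_blinfun_apply cinner_scaleC_right)
  have "\<pi> (x * y) = \<pi> x o\<^sub>L \<pi> y" for x y by (rule blinfun_eqI) (simp add: D(6))
  then show "matrix_of e (\<pi> (x * y)) i j = (\<Sum>k<n. matrix_of e (\<pi> x) i k * matrix_of e (\<pi> y) k j)" for x y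
    using matrix_of_comp[OF on c c] by simp
  show "matrix_of e (\<pi> (star x)) i j = cnj (matrix_of e (\<pi> x) j i)" for x
    unfolding matrix_of_def D(9)[symmetric] by (rule cinner_commute)
  have "e j \<in> cspan (e ` {..<n})" using ij by (simp add: complex_vector.span_base)
  then show "matrix_of e (\<pi> 1) i j = (if i = j then 1 else 0)"
    using on ij by (simp add: matrix_of_def D(8) orthonormal_def)
qed

section \<open>Irreducible representations on finite-dimensional spaces\<close>

lemma csubspace_of_finite_dim_closed:
  assumes "csubspace K" "K \<subseteq> cspan (e ` {..<n::nat})"
  shows "closed_csubspace (K :: 'h::chilbert_space set)"
proof -
  obtain m f where f: "orthonormal m f" "cspan (f ` {..<m}) = K"
    using finite_dim_orthonormal_basis[OF assms finite_imageI[OF finite_lessThan]] by blast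
  then show ?thesis using closed_csubspace_cspan[OF f(1)] by simp
qed

lemma orthonormal_spans:
  assumes f: "orthonormal m f" and e: "orthonormal n e"
    and sub: "f ` {..<m} \<subseteq> cspan (e ` {..<n})" and le: "n \<le> m"
  shows "cspan (f ` {..<m}) = cspan (e ` {..<n})"
proof (rule ccontr)
  assume ne: "cspan (f ` {..<m}) \<noteq> cspan (e ` {..<n})"
  have "cspan (f ` {..<m}) \<subseteq> cspan (e ` {..<n})"
    by (rule complex_vector.span_minimal[OF sub complex_vector.subspace_span])
  with ne obtain x where x: "x \<in> cspan (e ` {..<n})" "x \<notin> cspan (f ` {..<m})" by blast
  obtain v where v: "orthonormal (Suc m) (f(m := v))" "v \<in> cspan (insert x (f ` {..<m}))"
    by (rule orthonormal_extend[OF f x(2)])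
  have "cspan (insert x (f ` {..<m})) \<subseteq> cspan (e ` {..<n})"
    by (rule complex_vector.span_minimal[OF _ complex_vector.subspace_span]) (use x(1) sub in simp)
  then have "(f(m := v)) ` {..<Suc m} \<subseteq> cspan (e ` {..<n})"
    using v(2) sub by (auto simp: less_Suc_eq)
  then have "Suc m \<le> card (e ` {..<n})" by (rule orthonormal_card_le[OF v(1)]) simp
  also have "\<dots> \<le> n" using card_image_le[of "{..<n}" e] by simp
  finally show False using le by simp
qed

text \<open>The restriction is extended by zero, that is, composed with the projection onto \<open>K\<close>. It respects adjoints since
  the orthogonal complement of \<open>K\<close> is invariant as well.\<close>

lemma unital_representation_restrict:
  fixes \<pi> :: "'a::cstar_algebra \<Rightarrow> 'h::chilbert_space \<Rightarrow>\<^sub>L 'h"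
  assumes rep: "unital_representation L \<pi>" and K: "closed_csubspace K" "K \<subseteq> L"
    and inv: "\<And>a. blinfun_apply (\<pi> a) ` K \<subseteq> K"
  obtains \<sigma> where "unital_representation K \<sigma>" "\<And>a x. x \<in> K \<Longrightarrow> blinfun_apply (\<sigma> a) x = blinfun_apply (\<pi> a) x"
proof -
  note D = unital_representationD[OF rep]
  define P where "P = Blinfun (proj K)"
  have P: "blinfun_apply P = proj K"
    unfolding P_def by (rule bounded_linear_Blinfun_apply[OF bounded_linear_proj[OF K(1)]])
  define \<sigma> where "\<sigma> a = \<pi> a o\<^sub>L P" for a
  have \<sigma>: "blinfun_apply (\<sigma> a) x = blinfun_apply (\<pi> a) (proj K x)" for a x by (simp add: \<sigma>_def P)
  have \<sigma>K: "blinfun_apply (\<sigma> a) x \<in> K" for a x using inv[of a] proj_in[OF K(1), of x] by (auto simp: \<sigma>)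
  have "unital_representation K \<sigma>"
    unfolding unital_representation_def
  proof (intro conjI allI ballI)
    show "closed_csubspace K" by (rule K(1))
    show "range \<sigma> \<subseteq> carrier (bounded_operators K)"
    proof clarify
      fix a
      have "clinear (blinfun_apply (\<sigma> a))"
        unfolding clinear_iff by (simp add: \<sigma> clinearD[OF clinear_proj[OF K(1)]] clinearD[OF D(2)])
      moreover have "blinfun_apply (\<sigma> a) x = 0" if "\<forall>y\<in>K. cinner y x = 0" for x
        using proj_of_orthogonal[OF K(1), of x] that by (simp add: \<sigma> blinfun.zero_right)
      ultimately show "\<sigma> a \<in> carrier (bounded_operators K)" using \<sigma>K by (auto simp: bounded_operators_def)
    qed
    show "clinear \<sigma>"
      unfolding clinear_iff
      by (auto intro!: blinfun_eqI simp: \<sigma> clinearD[OF D(5)] blinfun.add_left scaleC_blinfun_apply)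
    show "\<sigma> (a * b) = \<sigma> a o\<^sub>L \<sigma> b" for a b
      by (rule blinfun_eqI) (simp add: \<sigma>(1)[of "a * b"] \<sigma>(1)[of a] proj_of_mem[OF K(1) \<sigma>K], simp add: \<sigma> D(6))
    show "\<sigma> (star a) = adjoint_op (\<sigma> a)" for a
    proof (rule adjoint_op_eqI[symmetric])
      fix x y
      have "cinner (blinfun_apply (\<sigma> a) x) y = cinner (blinfun_apply (\<sigma> a) x) (proj K y)"
        by (rule cinner_proj[OF K(1) \<sigma>K, symmetric])
      also have "\<dots> = cinner (proj K x) (blinfun_apply (\<sigma> (star a)) y)" by (simp add: \<sigma> D(9))
      also have "\<dots> = cinner x (blinfun_apply (\<sigma> (star a)) y)" by (rule cinner_proj_left[OF K(1) \<sigma>K])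
      finally show "cinner (blinfun_apply (\<sigma> a) x) y = cinner x (blinfun_apply (\<sigma> (star a)) y)" .
    qed
    show "blinfun_apply (\<sigma> 1) x = x" if "x \<in> K" for x
      using that K(2) D(8) by (auto simp: \<sigma> proj_of_mem[OF K(1)])
  qed
  then show ?thesis by (rule that) (simp add: \<sigma> proj_of_mem[OF K(1)])
qed

text \<open>If all irreducible representations have dimension \<open>n\<close>, then so has a minimal nonzero
  invariant subspace of an \<open>n\<close>-dimensional representation, which is therefore the whole space.\<close>

lemma irreducible_of_homogeneous:
  fixes \<pi> :: "'a::cstar_algebra \<Rightarrow> 'h::chilbert_space \<Rightarrow>\<^sub>L 'h"
  assumes hom: "\<And>L (\<sigma> :: 'a \<Rightarrow> 'h \<Rightarrow>\<^sub>L 'h). irreducible_representation L \<sigma> \<Longrightarrow> has_cdim L n"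
    and on: "orthonormal n e" and n: "n > 0" and rep: "unital_representation (cspan (e ` {..<n})) \<pi>"
  shows "irreducible_representation (cspan (e ` {..<n})) \<pi>"
proof -
  let ?L = "cspan (e ` {..<n})"
  have "e 0 \<in> ?L" "e 0 \<noteq> 0" using n orthonormal_nonzero[OF on] by (simp_all add: complex_vector.span_base)
  then have L0: "?L \<noteq> {0}" by blast
  have "K = ?L"
    if K: "closed_csubspace K" "K \<subseteq> ?L" "\<forall>a. blinfun_apply (\<pi> a) ` K \<subseteq> K" "K \<noteq> {0}" for K
  proof -
    define Q where "Q m \<longleftrightarrow> (\<exists>f. orthonormal m f \<and> m > 0 \<and> cspan (f ` {..<m}) \<subseteq> K \<and>
        (\<forall>a. blinfun_apply (\<pi> a) ` cspan (f ` {..<m}) \<subseteq> cspan (f ` {..<m})))" for m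
    have basis: "\<exists>m f. orthonormal m f \<and> m > 0 \<and> cspan (f ` {..<m}) = M"
      if M: "closed_csubspace M" "M \<subseteq> ?L" "M \<noteq> {0}" for M
    proof -
      have "csubspace M" using M(1) by (simp add: closed_csubspace_def)
      then obtain m f where f: "orthonormal m f" "cspan (f ` {..<m}) = M"
        using finite_dim_orthonormal_basis[OF _ M(2)] by blast
      have "m > 0" using f(2) M(3) by (cases m) auto
      then show ?thesis using f by blast
    qed
    have "\<exists>m. Q m" using basis[OF K(1,2,4)] K(3) unfolding Q_def by blast
    then obtain m where m: "Q m" "\<And>l. Q l \<Longrightarrow> m \<le> l" by (metis LeastI_ex Least_le)
    then obtain f where f: "orthonormal m f" "m > 0" "cspan (f ` {..<m}) \<subseteq> K"
      "\<And>a. blinfun_apply (\<pi> a) ` cspan (f ` {..<m}) \<subseteq> cspan (f ` {..<m})"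
      unfolding Q_def by blast
    let ?M = "cspan (f ` {..<m})"
    have subL: "?M \<subseteq> ?L" using f(3) K(2) by blast
    obtain \<sigma> where \<sigma>: "unital_representation ?M \<sigma>"
      "\<And>a x. x \<in> ?M \<Longrightarrow> blinfun_apply (\<sigma> a) x = blinfun_apply (\<pi> a) x"
      using unital_representation_restrict[OF rep closed_csubspace_cspan[OF f(1)] subL f(4)] by metis
    have "f 0 \<in> ?M" "f 0 \<noteq> 0" using f(2) orthonormal_nonzero[OF f(1)] by (simp_all add: complex_vector.span_base)
    then have M0: "?M \<noteq> {0}" by blast
    have "N = {0} \<or> N = ?M"
      if N: "closed_csubspace N" "N \<subseteq> ?M" "\<forall>a. blinfun_apply (\<sigma> a) ` N \<subseteq> N" for N
    proof (rule disjCI)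
      assume N0: "\<not> N = ?M"
      show "N = {0}"
      proof (rule ccontr)
        assume "N \<noteq> {0}"
        then obtain l g where g: "orthonormal l g" "l > 0" "cspan (g ` {..<l}) = N"
          using basis[OF N(1)] N(2) subL by blast
        have "blinfun_apply (\<pi> a) ` N \<subseteq> N" for a
          using N(2,3) \<sigma>(2) by (metis image_cong subsetD)
        then have "Q l" unfolding Q_def using g N(2) f(3) by blast
        then have "m \<le> l" by (rule m(2))
        moreover have "g ` {..<l} \<subseteq> ?M"
          using g(3) N(2) complex_vector.span_superset[of "g ` {..<l}"] by simp
        ultimately have "N = ?M" using orthonormal_spans[OF g(1) f(1)] g(3) by simp
        then show False using N0 by simp
      qed
    qed
    then have "irreducible_representation ?M \<sigma>"
      unfolding irreducible_representation_def using \<sigma>(1) M0 by blast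
    then have "has_cdim ?M n" by (rule hom)
    then have "m = n" using has_cdim_unique orthonormal_has_cdim[OF f(1)] by blast
    moreover have "f ` {..<m} \<subseteq> ?L" using subL complex_vector.span_superset[of "f ` {..<m}"] by blast
    ultimately have "?M = ?L" using orthonormal_spans[OF f(1) on] by simp
    then show ?thesis using f(3) K(2) by simp
  qed
  then show ?thesis unfolding irreducible_representation_def using rep L0 by blast
qed

section \<open>Burnside's theorem\<close>

text \<open>An endomorphism of a finite-dimensional space has an eigenvector: take a polynomial \<open>p\<close> of
  minimal degree with \<open>p(T) v = 0\<close> and split off a linear factor.\<close>

lemma eigenvector_exists:
  fixes T :: "'h::chilbert_space \<Rightarrow> 'h"
  assumes T: "clinear T" and L: "L = cspan (e ` {..<n::nat})" "\<And>x. x \<in> L \<Longrightarrow> T x \<in> L"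
    and v: "v \<in> L" "v \<noteq> 0"
  shows "\<exists>c w. w \<in> L \<and> w \<noteq> 0 \<and> T w = c *\<^sub>C w"
proof -
  define ev where "ev p = (\<Sum>k\<le>degree p. coeff p k *\<^sub>C (T ^^ k) v)" for p :: "complex poly"
  have ev_bound: "ev p = (\<Sum>k\<le>N. coeff p k *\<^sub>C (T ^^ k) v)" if "degree p \<le> N" for p N
    unfolding ev_def by (rule sum.mono_neutral_left) (use that in \<open>auto simp: coeff_eq_0\<close>)
  have TkL: "(T ^^ k) v \<in> L" for k by (induction k) (simp_all add: v L(2))
  have subL: "csubspace L" unfolding L(1) by (rule complex_vector.subspace_span)
  have evL: "ev p \<in> L" for p
    unfolding ev_def by (intro complex_vector.subspace_sum[OF subL] complex_vector.subspace_scale[OF subL] TkL)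
  have ev_pCons: "ev (pCons a p) = a *\<^sub>C v + T (ev p)" for a p
  proof -
    have "ev (pCons a p) = (\<Sum>k\<le>Suc (degree p). coeff (pCons a p) k *\<^sub>C (T ^^ k) v)"
      by (rule ev_bound) (rule degree_pCons_le)
    also have "\<dots> = a *\<^sub>C v + (\<Sum>k\<le>degree p. coeff p k *\<^sub>C T ((T ^^ k) v))"
      by (subst sum.atMost_Suc_shift) simp
    finally show ?thesis by (simp add: ev_def clinearD[OF T])
  qed
  have ev_add: "ev (p + r) = ev p + ev r" for p r
  proof -
    have "degree (p + r) \<le> max (degree p) (degree r)" by (rule degree_add_le_max)
    then show ?thesis
      using ev_bound[of "p + r" "max (degree p) (degree r)"] ev_bound[of p "max (degree p) (degree r)"]
        ev_bound[of r "max (degree p) (degree r)"]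
      by (simp add: scaleC_add_left sum.distrib)
  qed
  have ev_smult: "ev (smult c p) = c *\<^sub>C ev p" for c p
    using ev_bound[of "smult c p" "degree p"] by (simp add: ev_def complex_vector.scale_sum_right scaleC_scaleC degree_smult_le)
  have "\<exists>p. p \<noteq> 0 \<and> ev p = 0"
  proof (cases "inj_on (\<lambda>k. (T ^^ k) v) {..n}")
    case False
    then obtain j k where jk: "j < k" "(T ^^ j) v = (T ^^ k) v"
      unfolding inj_on_def by (metis linorder_neqE_nat)
    have ev_monom: "ev (monom 1 i) = (T ^^ i) v" for i
    proof -
      have "(if i = k then 1 else 0) *\<^sub>C (T ^^ k) v = (if k = i then (T ^^ i) v else 0)" for k
        by (simp add: scaleC_one)
      then show ?thesis using ev_bound[OF degree_monom_le, of 1 i] by simp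
    qed
    have "ev (monom 1 k + smult (- 1) (monom 1 j)) = 0"
      unfolding ev_add ev_smult ev_monom using jk by (simp add: complex_vector.scale_minus_left scaleC_one)
    moreover have "coeff (monom 1 k + smult (- 1) (monom (1::complex) j)) k = 1" using jk by simp
    then have "monom 1 k + smult (- 1) (monom (1::complex) j) \<noteq> 0" by (metis coeff_0 zero_neq_one)
    ultimately show ?thesis by blast
  next
    case True
    let ?S = "(\<lambda>k. (T ^^ k) v) ` {..n}"
    have "cdependent ?S"
    proof (rule ccontr)
      assume "\<not> cdependent ?S"
      then have "card ?S \<le> card (e ` {..<n})"
        using complex_vector.independent_span_bound[of "e ` {..<n}" ?S] TkL L(1) by auto
      also have "\<dots> \<le> n" using card_image_le[of "{..<n}" e] by simp
      finally show False using card_image[OF True] by simp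
    qed
    then obtain c where c: "\<exists>x\<in>?S. c x \<noteq> 0" "(\<Sum>x\<in>?S. c x *\<^sub>C x) = 0"
      by (subst (asm) complex_vector.dependent_finite) auto
    define p where "p = (\<Sum>k\<le>n. monom (c ((T ^^ k) v)) k)"
    have cp: "coeff p k = (if k \<le> n then c ((T ^^ k) v) else 0)" for k
      by (simp add: p_def coeff_sum sum.delta)
    have "degree p \<le> n" by (rule degree_le) (simp add: cp)
    then have "ev p = (\<Sum>k\<le>n. c ((T ^^ k) v) *\<^sub>C (T ^^ k) v)" using ev_bound by (simp add: cp)
    then have "ev p = 0" using c(2) sum.reindex[OF True, of "\<lambda>x. c x *\<^sub>C x"] by simp
    moreover obtain k where "k \<le> n" "c ((T ^^ k) v) \<noteq> 0" using c(1) by auto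
    then have "p \<noteq> 0" using cp[of k] by auto
    ultimately show ?thesis by blast
  qed
  then obtain p where p: "p \<noteq> 0" "ev p = 0" and min: "\<And>r. r \<noteq> 0 \<Longrightarrow> ev r = 0 \<Longrightarrow> degree p \<le> degree r"
    using ex_has_least_nat[of "\<lambda>p. p \<noteq> 0 \<and> ev p = 0" _ degree] by metis
  have "degree p \<noteq> 0"
  proof
    assume "degree p = 0"
    then obtain a where a: "p = [:a:]" by (metis degree_eq_zeroE)
    then show False using p v(2) ev_pCons[of a 0] by (simp add: ev_def clinearD[OF T])
  qed
  then have "\<not> constant (poly p)" by (simp add: constant_degree)
  then obtain z where "poly p z = 0" using fundamental_theorem_of_algebra by blast
  then obtain r where r: "p = [:- z, 1:] * r" unfolding poly_eq_0_iff_dvd by (elim dvdE)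
  have r0: "r \<noteq> 0" using p(1) r by auto
  have "degree p = Suc (degree r)" unfolding r by (subst degree_mult_eq) (use r0 in auto)
  then have w0: "ev r \<noteq> 0" using min[OF r0] by auto
  have "p = smult (- z) r + pCons 0 r" unfolding r by simp
  then have "0 = ev (smult (- z) r + pCons 0 r)" using p(2) by metis
  also have "\<dots> = - z *\<^sub>C ev r + T (ev r)" unfolding ev_add ev_smult ev_pCons by simp
  finally have "0 = - z *\<^sub>C ev r + T (ev r)" .
  then have "T (ev r) = z *\<^sub>C ev r" by (simp add: complex_vector.scale_minus_left add_eq_0_iff)
  then show ?thesis using evL w0 by blast
qed

context
  fixes \<pi> :: "'a::cstar_algebra \<Rightarrow> 'h::chilbert_space \<Rightarrow>\<^sub>L 'h" and L n e
  assumes irr: "irreducible_representation L \<pi>" and L: "L = cspan (e ` {..<n::nat})"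
begin

lemma irreducible_rep: "unital_representation L \<pi>"
  using irr by (simp add: irreducible_representation_def)

lemmas irrD = unital_representationD[OF irreducible_rep]

lemma invariant_subspace_full:
  assumes "csubspace K" "K \<subseteq> L" "\<And>a x. x \<in> K \<Longrightarrow> blinfun_apply (\<pi> a) x \<in> K" "K \<noteq> {0}"
  shows "K = L"
proof -
  have "closed_csubspace K" using csubspace_of_finite_dim_closed[OF assms(1)] assms(2) L by blast
  then show ?thesis using irr assms unfolding irreducible_representation_def by blast
qed

lemma schur:
  fixes T :: "'h \<Rightarrow> 'h"
  assumes T: "clinear T" "\<And>x. x \<in> L \<Longrightarrow> T x \<in> L"
    and comm: "\<And>a x. x \<in> L \<Longrightarrow> T (blinfun_apply (\<pi> a) x) = blinfun_apply (\<pi> a) (T x)"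
  shows "\<exists>c. \<forall>x\<in>L. T x = c *\<^sub>C x"
proof -
  have "L \<noteq> {0}" using irr by (simp add: irreducible_representation_def)
  then obtain v where "v \<in> L" "v \<noteq> 0" using closed_csubspaceD(1)[OF irrD(1)] by blast
  then obtain c w where w: "w \<in> L" "w \<noteq> 0" "T w = c *\<^sub>C w" using eigenvector_exists[OF T(1) L T(2)] by blast
  have "{x \<in> L. T x = c *\<^sub>C x} = L"
  proof (rule invariant_subspace_full)
    show "csubspace {x \<in> L. T x = c *\<^sub>C x}"
      unfolding complex_vector.subspace_def
      by (auto simp: closed_csubspaceD[OF irrD(1)] clinearD[OF T(1)] scaleC_add_right scaleC_scaleC mult.commute)
    show "blinfun_apply (\<pi> a) x \<in> {x \<in> L. T x = c *\<^sub>C x}" if "x \<in> {x \<in> L. T x = c *\<^sub>C x}" for a x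
      using that by (auto simp: irrD(3) comm clinearD[OF irrD(2)])
    show "{x \<in> L. T x = c *\<^sub>C x} \<noteq> {0}" using w by blast
  qed auto
  then show ?thesis by blast
qed

text \<open>Jacobson's density argument. If every element that kills \<open>B\<close> and \<open>y\<close> also kills \<open>x\<close>, then
  \<open>\<pi> a y \<mapsto> \<pi> a x\<close>, for \<open>a\<close> killing \<open>B\<close>, is a well-defined intertwiner, hence a scalar \<open>c\<close>, and
  \<open>x - c y\<close> is killed by everything that kills \<open>B\<close>.\<close>

lemma separating_element:
  assumes "finite B" "B \<subseteq> L" "x \<in> L" "x \<notin> cspan B"
  shows "\<exists>a. (\<forall>b\<in>B. blinfun_apply (\<pi> a) b = 0) \<and> blinfun_apply (\<pi> a) x \<noteq> 0"
  using assms
proof (induction B arbitrary: x rule: finite_induct)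
  case empty
  then show ?case using irrD(8) by (intro exI[of _ 1]) auto
next
  case (insert y B)
  define I where "I = {a. \<forall>b\<in>B. blinfun_apply (\<pi> a) b = 0}"
  have I: "0 \<in> I" "a \<in> I \<Longrightarrow> b \<in> I \<Longrightarrow> a + b \<in> I" "a \<in> I \<Longrightarrow> c *\<^sub>C a \<in> I" "a \<in> I \<Longrightarrow> d * a \<in> I" for a b c d
    by (auto simp: I_def clinearD[OF irrD(5)] blinfun.add_left scaleC_blinfun_apply irrD(6) blinfun.zero_right)
  have yL: "y \<in> L" and BL: "B \<subseteq> L" and xL: "x \<in> L" using insert.prems by auto
  show ?case
  proof (cases "y \<in> cspan B")
    case True
    then have "cspan (insert y B) = cspan B" by (rule complex_vector.span_redundant)
    then obtain a where a: "\<forall>b\<in>B. blinfun_apply (\<pi> a) b = 0" "blinfun_apply (\<pi> a) x \<noteq> 0"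
      using insert.IH[OF BL xL] insert.prems(3) by auto
    have "cspan B \<subseteq> {z. blinfun_apply (\<pi> a) z = 0}"
    proof (rule complex_vector.span_minimal)
      show "csubspace {z. blinfun_apply (\<pi> a) z = 0}"
        unfolding complex_vector.subspace_def by (auto simp: clinearD[OF irrD(2)])
    qed (use a(1) in auto)
    then show ?thesis using a True by (intro exI[of _ a]) auto
  next
    case False
    have "\<exists>a. a \<in> I \<and> blinfun_apply (\<pi> a) y \<noteq> 0"
      using insert.IH[OF BL yL False] by (auto simp: I_def)
    then obtain a0 where a0: "a0 \<in> I" "blinfun_apply (\<pi> a0) y \<noteq> 0" by blast
    have "(\<lambda>a. blinfun_apply (\<pi> a) y) ` I = L"
    proof (rule invariant_subspace_full)
      show "csubspace ((\<lambda>a. blinfun_apply (\<pi> a) y) ` I)"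
        unfolding complex_vector.subspace_def
      proof (intro conjI ballI allI)
        show "0 \<in> (\<lambda>a. blinfun_apply (\<pi> a) y) ` I"
          by (rule image_eqI[of _ _ 0]) (simp_all add: I clinearD[OF irrD(5)])
        fix u assume u: "u \<in> (\<lambda>a. blinfun_apply (\<pi> a) y) ` I"
        then obtain a where a: "a \<in> I" "u = blinfun_apply (\<pi> a) y" by blast
        show "u + w \<in> (\<lambda>a. blinfun_apply (\<pi> a) y) ` I" if "w \<in> (\<lambda>a. blinfun_apply (\<pi> a) y) ` I" for w
        proof -
          from that obtain b where "b \<in> I" "w = blinfun_apply (\<pi> b) y" by blast
          then show ?thesis using a I(2)
            by (intro image_eqI[of _ _ "a + b"]) (simp_all add: clinearD[OF irrD(5)] blinfun.add_left)
        qed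
        show "c *\<^sub>C u \<in> (\<lambda>a. blinfun_apply (\<pi> a) y) ` I" for c
          using a I(3) by (intro image_eqI[of _ _ "c *\<^sub>C a"]) (simp_all add: clinearD[OF irrD(5)] scaleC_blinfun_apply)
      qed
      show "blinfun_apply (\<pi> d) u \<in> (\<lambda>a. blinfun_apply (\<pi> a) y) ` I"
        if u: "u \<in> (\<lambda>a. blinfun_apply (\<pi> a) y) ` I" for d u
      proof -
        from u obtain a where a: "a \<in> I" "u = blinfun_apply (\<pi> a) y" by blast
        then show ?thesis using I(4) by (intro image_eqI[of _ _ "d * a"]) (simp_all add: irrD(6))
      qed
      show "(\<lambda>a. blinfun_apply (\<pi> a) y) ` I \<noteq> {0}" using a0 by blast
    qed (auto simp: irrD(3))
    then have surj: "\<exists>a. a \<in> I \<and> blinfun_apply (\<pi> a) y = z" if "z \<in> L" for z using that by blast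
    show ?thesis
    proof (rule ccontr)
      assume "\<not> ?thesis"
      then have kill: "blinfun_apply (\<pi> a) x = 0" if "a \<in> I" "blinfun_apply (\<pi> a) y = 0" for a
        using that by (auto simp: I_def)
      define s where "s z = (SOME a. a \<in> I \<and> blinfun_apply (\<pi> a) y = z)" for z
      have s: "s z \<in> I" "blinfun_apply (\<pi> (s z)) y = z" if "z \<in> L" for z
        unfolding s_def using someI_ex[OF surj[OF that]] by auto
      define T where "T z = blinfun_apply (\<pi> (s (proj L z))) x" for z
      have T: "T (blinfun_apply (\<pi> a) y) = blinfun_apply (\<pi> a) x" if a: "a \<in> I" for a
      proof -
        let ?z = "blinfun_apply (\<pi> a) y"
        have zL: "?z \<in> L" by (rule irrD(3))
        have "s ?z + (- 1) *\<^sub>C a \<in> I" using s(1)[OF zL] a I by blast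
        moreover have "blinfun_apply (\<pi> (s ?z + (- 1) *\<^sub>C a)) y = 0"
          using s(2)[OF zL] by (simp add: clinearD[OF irrD(5)] blinfun.add_left scaleC_blinfun_apply
              complex_vector.scale_minus_left scaleC_one blinfun.diff_left)
        ultimately have "blinfun_apply (\<pi> (s ?z + (- 1) *\<^sub>C a)) x = 0" by (rule kill)
        then show ?thesis
          by (simp add: T_def proj_of_mem[OF irrD(1) zL] clinearD[OF irrD(5)] blinfun.add_left
              scaleC_blinfun_apply complex_vector.scale_minus_left scaleC_one blinfun.diff_left)
      qed
      have Tproj: "T z = T (proj L z)" for z
        by (simp add: T_def proj_of_mem[OF irrD(1) proj_in[OF irrD(1)]])
      have "clinear T"
        unfolding clinear_iff
      proof (intro conjI allI)
        fix z w
        let ?a = "s (proj L z)" and ?b = "s (proj L w)"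
        note sz = s[OF proj_in[OF irrD(1)], of z] and sw = s[OF proj_in[OF irrD(1)], of w]
        have "T (z + w) = T (blinfun_apply (\<pi> (?a + ?b)) y)"
          by (subst Tproj) (simp add: clinearD[OF clinear_proj[OF irrD(1)]] clinearD[OF irrD(5)] blinfun.add_left sz sw)
        also have "\<dots> = blinfun_apply (\<pi> (?a + ?b)) x" by (rule T) (simp add: I sz sw)
        finally show "T (z + w) = T z + T w" by (simp add: clinearD[OF irrD(5)] blinfun.add_left T_def)
        fix c
        have "T (c *\<^sub>C z) = T (blinfun_apply (\<pi> (c *\<^sub>C ?a)) y)"
          by (subst Tproj) (simp add: clinearD[OF clinear_proj[OF irrD(1)]] clinearD[OF irrD(5)] scaleC_blinfun_apply sz)
        also have "\<dots> = blinfun_apply (\<pi> (c *\<^sub>C ?a)) x" by (rule T) (simp add: I sz)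
        finally show "T (c *\<^sub>C z) = c *\<^sub>C T z" by (simp add: clinearD[OF irrD(5)] scaleC_blinfun_apply T_def)
      qed
      moreover have "T z \<in> L" for z unfolding T_def by (rule irrD(3))
      moreover have "T (blinfun_apply (\<pi> a) z) = blinfun_apply (\<pi> a) (T z)" if z: "z \<in> L" for a z
      proof -
        have "T (blinfun_apply (\<pi> a) z) = T (blinfun_apply (\<pi> (a * s z)) y)" by (simp add: irrD(6) s[OF z])
        also have "\<dots> = blinfun_apply (\<pi> (a * s z)) x" by (rule T) (simp add: I s[OF z])
        finally show ?thesis by (simp add: irrD(6) T_def proj_of_mem[OF irrD(1) z])
      qed
      ultimately obtain c where c: "\<And>z. z \<in> L \<Longrightarrow> T z = c *\<^sub>C z" using schur by metis
      have "blinfun_apply (\<pi> a) (x - c *\<^sub>C y) = 0" if "a \<in> I" for a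
        using T[OF that] c[OF irrD(3), of a y] by (simp add: clinearD[OF irrD(2)])
      then have "x - c *\<^sub>C y \<in> cspan B"
        using insert.IH[OF BL, of "x - c *\<^sub>C y"] closed_csubspaceD[OF irrD(1)] xL yL
        unfolding I_def by blast
      then have "x - c *\<^sub>C y \<in> cspan (insert y B)" using complex_vector.span_mono[of B "insert y B"] by blast
      moreover have "c *\<^sub>C y \<in> cspan (insert y B)"
        by (intro complex_vector.span_scale complex_vector.span_base) simp
      ultimately have "(x - c *\<^sub>C y) + c *\<^sub>C y \<in> cspan (insert y B)" by (rule complex_vector.span_add)
      then show False using insert.prems(3) by simp
    qed
  qed
qed

text \<open>An element that kills all vectors of the basis except \<open>e j\<close>, followed by one that sends the image of \<open>e j\<close> to
  \<open>e i\<close>, acts as a matrix unit.\<close>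

theorem irreducible_matrix_surj:
  assumes on: "orthonormal n e"
  obtains a where "\<And>i j. i < n \<Longrightarrow> j < n \<Longrightarrow> matrix_of e (\<pi> a) i j = M i j"
proof -
  have eL: "e j \<in> L" if "j < n" for j using that by (simp add: L complex_vector.span_base)
  have unit: "\<exists>a. \<forall>k<n. blinfun_apply (\<pi> a) (e k) = (if k = j then e i else 0)" if ij: "i < n" "j < n" for i j
  proof -
    let ?B = "e ` ({..<n} - {j})"
    have "e ` {..<n} - {e j} = ?B"
      using ij(2) inj_onD[OF orthonormal_inj[OF on]] by auto
    moreover have "e j \<notin> cspan (e ` {..<n} - {e j})"
      using orthonormal_independent[OF on] ij(2) unfolding complex_vector.dependent_def by auto
    ultimately have "e j \<notin> cspan ?B" by simp
    moreover have "?B \<subseteq> L" using eL by auto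
    ultimately obtain a where a: "\<forall>b\<in>?B. blinfun_apply (\<pi> a) b = 0" "blinfun_apply (\<pi> a) (e j) \<noteq> 0"
      using separating_element[OF _ _ eL[OF ij(2)], of ?B] by auto
    let ?z = "blinfun_apply (\<pi> a) (e j)"
    have "range (\<lambda>b. blinfun_apply (\<pi> b) ?z) = L"
    proof (rule invariant_subspace_full)
      show "csubspace (range (\<lambda>b. blinfun_apply (\<pi> b) ?z))"
        unfolding complex_vector.subspace_def
      proof (intro conjI ballI allI)
        show "0 \<in> range (\<lambda>b. blinfun_apply (\<pi> b) ?z)"
          by (rule range_eqI[of _ _ 0]) (simp add: clinearD[OF irrD(5)])
        show "u + w \<in> range (\<lambda>b. blinfun_apply (\<pi> b) ?z)"
          if "u \<in> range (\<lambda>b. blinfun_apply (\<pi> b) ?z)" "w \<in> range (\<lambda>b. blinfun_apply (\<pi> b) ?z)" for u w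
        proof -
          from that obtain b c where "u = blinfun_apply (\<pi> b) ?z" "w = blinfun_apply (\<pi> c) ?z" by blast
          then show ?thesis by (intro range_eqI[of _ _ "b + c"]) (simp add: clinearD[OF irrD(5)] blinfun.add_left)
        qed
        show "c *\<^sub>C u \<in> range (\<lambda>b. blinfun_apply (\<pi> b) ?z)" if "u \<in> range (\<lambda>b. blinfun_apply (\<pi> b) ?z)" for c u
        proof -
          from that obtain b where "u = blinfun_apply (\<pi> b) ?z" by blast
          then show ?thesis by (intro range_eqI[of _ _ "c *\<^sub>C b"]) (simp add: clinearD[OF irrD(5)] scaleC_blinfun_apply)
        qed
      qed
      show "blinfun_apply (\<pi> d) u \<in> range (\<lambda>b. blinfun_apply (\<pi> b) ?z)"
        if "u \<in> range (\<lambda>b. blinfun_apply (\<pi> b) ?z)" for d u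
      proof -
        from that obtain b where "u = blinfun_apply (\<pi> b) ?z" by blast
        then show ?thesis by (intro range_eqI[of _ _ "d * b"]) (simp add: irrD(6))
      qed
      have "blinfun_apply (\<pi> 1) ?z = ?z" by (rule irrD(8)[OF irrD(3)])
      then show "range (\<lambda>b. blinfun_apply (\<pi> b) ?z) \<noteq> {0}" using a(2) by (metis rangeI singletonD)
    qed (auto simp: irrD(3))
    then have "e i \<in> range (\<lambda>b. blinfun_apply (\<pi> b) ?z)" using eL[OF ij(1)] by simp
    then obtain b where "e i = blinfun_apply (\<pi> b) ?z" by (rule rangeE)
    then have "\<forall>k<n. blinfun_apply (\<pi> (b * a)) (e k) = (if k = j then e i else 0)"
      using a(1) by (auto simp: irrD(6) blinfun.zero_right)
    then show ?thesis by blast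
  qed
  then obtain E where E: "\<And>i j k. i < n \<Longrightarrow> j < n \<Longrightarrow> k < n \<Longrightarrow> blinfun_apply (\<pi> (E i j)) (e k) = (if k = j then e i else 0)"
    by metis
  define a where "a = (\<Sum>i<n. \<Sum>j<n. M i j *\<^sub>C E i j)"
  have "matrix_of e (\<pi> a) k l = M k l" if kl: "k < n" "l < n" for k l
  proof -
    have ap: "blinfun_apply (\<Sum>i\<in>I. f i) x = (\<Sum>i\<in>I. blinfun_apply (f i) x)" for I and f :: "nat \<Rightarrow> 'h \<Rightarrow>\<^sub>L 'h" and x
      by (rule blinfun.sum_left)
    have "blinfun_apply (\<pi> a) (e l) = (\<Sum>i<n. \<Sum>j<n. M i j *\<^sub>C (if l = j then e i else 0))"
      unfolding a_def clinearD(7)[OF irrD(5)] ap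
      by (intro sum.cong refl) (simp add: clinearD(2)[OF irrD(5)] scaleC_blinfun_apply E kl(2))
    also have "\<dots> = comb n e (\<lambda>i. M i l)"
      unfolding comb_def using kl(2) by (intro sum.cong refl) (simp add: if_distrib[of "\<lambda>x. _ *\<^sub>C x"] cong: if_cong)
    finally show ?thesis by (simp add: matrix_of_def cinner_comb_right[OF on kl(1)])
  qed
  then show ?thesis by (rule that)
qed

lemma irreducible_range:
  assumes on: "orthonormal n e"
  shows "range \<pi> = carrier (bounded_operators L)"
proof
  show "range \<pi> \<subseteq> carrier (bounded_operators L)"
    using irreducible_rep by (simp add: unital_representation_def)
  show "carrier (bounded_operators L) \<subseteq> range \<pi>"
  proof
    fix T assume T: "T \<in> carrier (bounded_operators L)"
    obtain a where a: "\<And>i j. i < n \<Longrightarrow> j < n \<Longrightarrow> matrix_of e (\<pi> a) i j = matrix_of e T i j"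
      using irreducible_matrix_surj[OF on] by blast
    have "\<pi> a \<in> carrier (bounded_operators L)" using irreducible_rep by (auto simp: unital_representation_def)
    then have "\<pi> a = op_of n e (matrix_of e (\<pi> a))" using op_of_matrix_of[OF on] L by metis
    also have "\<dots> = op_of n e (matrix_of e T)" by (rule op_of_cong) (rule a)
    also have "\<dots> = T" using op_of_matrix_of[OF on] L T by metis
    finally show "T \<in> range \<pi>" by blast
  qed
qed

end

section \<open>Limits of matrix-valued maps along nets\<close>

text \<open>Tychonoff's theorem in the form of a common convergent refinement.\<close>

lemma bounded_family_cluster:
  fixes f :: "'i \<Rightarrow> 'j \<Rightarrow> complex"
  assumes "G \<noteq> bot" and bound: "eventually (\<lambda>d. \<forall>j. cmod (f d j) \<le> C j) G"
  obtains G' l where "G' \<le> G" "G' \<noteq> bot" "\<And>j. ((\<lambda>d. f d j) \<longlongrightarrow> l j) G'"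
proof -
  let ?K = "PiE UNIV (\<lambda>j. cball (0::complex) (C j))"
  have "compactin (product_topology (\<lambda>j. euclidean) UNIV) ?K"
    by (simp add: compactin_PiE del: euclidean_product_topology)
  then have "compact ?K" by (simp add: euclidean_product_topology)
  moreover have "filtermap f G \<noteq> bot" using assms(1) by (simp add: filtermap_bot_iff)
  moreover have "eventually (\<lambda>x. x \<in> ?K) (filtermap f G)"
    using bound by (simp add: eventually_filtermap PiE_iff)
  ultimately obtain l where l: "inf (nhds l) (filtermap f G) \<noteq> bot"
    unfolding compact_filter by blast
  define G' where "G' = inf G (filtercomap f (nhds l))"
  have "G' \<noteq> bot"
  proof
    assume "G' = bot"
    then have "eventually (\<lambda>_. False) G'" by simp
    then obtain P Q where PQ: "eventually P G" "eventually Q (filtercomap f (nhds l))" "\<And>d. P d \<Longrightarrow> Q d \<Longrightarrow> False"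
      unfolding G'_def eventually_inf by auto
    then obtain N where N: "eventually N (nhds l)" "\<And>d. N (f d) \<Longrightarrow> Q d"
      unfolding eventually_filtercomap by blast
    have "eventually (\<lambda>x. \<not> N x) (filtermap f G)"
      unfolding eventually_filtermap using PQ(1) by (rule eventually_mono) (use PQ(3) N(2) in blast)
    then have "eventually (\<lambda>_. False) (inf (nhds l) (filtermap f G))"
      unfolding eventually_inf using N(1) by blast
    then show False using l by (simp add: trivial_limit_def)
  qed
  moreover have "G' \<le> G" by (simp add: G'_def)
  moreover have "((\<lambda>d. f d j) \<longlongrightarrow> l j) G'" for j
  proof -
    have lim: "filterlim f (nhds l) G'"
      unfolding G'_def by (rule filterlim_mono[OF filterlim_filtercomap order_refl]) simp
    show ?thesis
    proof (rule topological_tendstoI)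
      fix U assume U: "open U" "l j \<in> U"
      have "open ((\<lambda>x :: 'j \<Rightarrow> complex. x j) -` U)"
        by (rule open_vimage[OF U(1) continuous_on_product_coordinates])
      then have "eventually (\<lambda>x. x j \<in> U) (nhds l)" using U(2) by (auto simp: eventually_nhds)
      then show "eventually (\<lambda>d. f d j \<in> U) G'" using lim unfolding filterlim_iff by blast
    qed
  qed
  ultimately show ?thesis using that by blast
qed

text \<open>The Hilbert--Schmidt norm dominates the operator norm. In contrast to the latter it is visibly a continuous
  function of the matrix entries.\<close>

lemma (in cstar_seminorm) matrix_representation_attains:
  fixes u :: "nat \<Rightarrow> 'h::chilbert_space" and d :: "nat \<Rightarrow> 'a"
  assumes u: "\<And>n. orthonormal n u" and dense: "closure (range d) = UNIV"
    and hom: "\<And>L (\<sigma> :: 'a \<Rightarrow> 'h \<Rightarrow>\<^sub>L 'h). irreducible_representation L \<sigma> \<Longrightarrow> has_cdim L n"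
  shows "n > 0 \<and> (\<exists>R. matrix_representation n R \<and> (\<forall>x. \<forall>i<n. \<forall>j<n. cmod (R x i j) \<le> q x) \<and>
    (q b)\<^sup>2 \<le> (\<Sum>i<n. \<Sum>j<n. (cmod (R b i j))\<^sup>2))"
proof -
  obtain L and \<sigma> :: "'a \<Rightarrow> 'h \<Rightarrow>\<^sub>L 'h" and \<xi> where irr: "irreducible_representation L \<sigma>"
    and le: "\<And>x. norm (\<sigma> x) \<le> q x" and \<xi>: "\<xi> \<in> L" "norm \<xi> = 1" "norm (blinfun_apply (\<sigma> b) \<xi>) = q b"
    by (rule irreducible_representation_attains[OF u dense]) (rule that, assumption+)
  obtain e where e: "orthonormal n e" "cspan (e ` {..<n}) = L"
    by (rule has_cdim_orthonormal_basis[OF hom[OF irr]])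
  have rep: "unital_representation (cspan (e ` {..<n})) \<sigma>"
    using irr e(2) by (simp add: irreducible_representation_def)
  note D = unital_representationD[OF rep]
  define R where "R x = matrix_of e (\<sigma> x)" for x
  have "n > 0"
  proof (rule ccontr)
    assume "\<not> n > 0"
    then have "L = {0}" using e(2) by simp
    then show False using \<xi> by simp
  qed
  moreover have "matrix_representation n R"
    unfolding R_def[abs_def] by (rule matrix_representation_matrix_of[OF e(1) rep])
  moreover have "cmod (R x i j) \<le> q x" if "i < n" "j < n" for x i j
    unfolding R_def by (rule order_trans[OF cmod_matrix_of_le[OF e(1) that] le])
  moreover have "(q b)\<^sup>2 \<le> (\<Sum>i<n. \<Sum>j<n. (cmod (R b i j))\<^sup>2)"
  proof -
    define c where "c j = cinner (e j) \<xi>" for j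
    have \<xi>c: "\<xi> = comb n e c" using orthonormal_expansion[OF e(1), of \<xi>] \<xi>(1) e(2) by (simp add: c_def[abs_def])
    have c1: "(\<Sum>j<n. (cmod (c j))\<^sup>2) = 1" using norm_comb[OF e(1), of c] \<xi>(2) \<xi>c by simp
    have co: "cinner (e i) (blinfun_apply (\<sigma> b) \<xi>) = (\<Sum>j<n. c j * R b i j)" for i
      by (simp add: \<xi>c comb_def clinearD[OF D(2)] cinner_sum_right cinner_scaleC_right R_def matrix_of_def)
    have "blinfun_apply (\<sigma> b) \<xi> = comb n e (\<lambda>i. \<Sum>j<n. c j * R b i j)"
      using orthonormal_expansion[OF e(1), of "blinfun_apply (\<sigma> b) \<xi>"] D(3) by (simp add: co)
    then have "(q b)\<^sup>2 = (\<Sum>i<n. (cmod (\<Sum>j<n. c j * R b i j))\<^sup>2)"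
      using norm_comb[OF e(1)] \<xi>(3) by metis
    also have "\<dots> \<le> (\<Sum>i<n. \<Sum>j<n. (cmod (R b i j))\<^sup>2)"
    proof (rule sum_mono)
      fix i
      have "cmod (\<Sum>j<n. c j * R b i j) \<le> (\<Sum>j<n. cmod (c j) * cmod (R b i j))"
        by (rule order_trans[OF norm_sum]) (simp add: norm_mult)
      then have "(cmod (\<Sum>j<n. c j * R b i j))\<^sup>2 \<le> (\<Sum>j<n. cmod (c j) * cmod (R b i j))\<^sup>2"
        by (rule power_mono) simp
      also have "\<dots> \<le> (\<Sum>j<n. (cmod (c j))\<^sup>2) * (\<Sum>j<n. (cmod (R b i j))\<^sup>2)"
        by (rule Cauchy_Schwarz_ineq_sum)
      finally show "(cmod (\<Sum>j<n. c j * R b i j))\<^sup>2 \<le> (\<Sum>j<n. (cmod (R b i j))\<^sup>2)" by (simp add: c1)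
    qed
    finally show ?thesis .
  qed
  ultimately show ?thesis by blast
qed

lemma op_of_sum: "op_of n e (\<lambda>i j. \<Sum>l\<in>I. M l i j) = (\<Sum>l\<in>I. op_of n e (M l))"
proof (induction I rule: infinite_finite_induct)
  case (insert l I)
  then show ?case using op_of_add[of n e "M l" "\<lambda>i j. \<Sum>l\<in>I. M l i j"] by simp
qed (use op_of_scaleC[of n e 0 "\<lambda>_ _. 0"] in \<open>simp_all\<close>)

text \<open>Every element is a combination of four elements \<open>v\<^sup>* v\<close>, so the values of positive maps at the latter bound all
  values.\<close>

lemma polarization_one:
  fixes y :: "'a::cstar_algebra"
  shows "4 *\<^sub>R y = (star (1 + y) * (1 + y) - star (1 - y) * (1 - y))
    - \<i> *\<^sub>C (star (1 + \<i> *\<^sub>C y) * (1 + \<i> *\<^sub>C y) - star (1 - \<i> *\<^sub>C y) * (1 - \<i> *\<^sub>C y))"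
proof -
  have 1: "star (1 + y) * (1 + y) - star (1 - y) * (1 - y) = 2 *\<^sub>R (y + star y)"
    by (simp add: star_add star_diff algebra_simps scaleR_2)
  have 2: "star (1 + \<i> *\<^sub>C y) * (1 + \<i> *\<^sub>C y) - star (1 - \<i> *\<^sub>C y) * (1 - \<i> *\<^sub>C y)
      = 2 *\<^sub>R (\<i> *\<^sub>C (y - star y))"
    by (simp add: star_add star_diff star_scaleC algebra_simps scaleR_2 scaleC_add_right
        complex_vector.scale_right_diff_distrib complex_vector.scale_minus_left)
  have i2: "\<i> * (complex_of_real 2 * \<i>) = - complex_of_real 2" by (simp add: complex_eq_iff)
  have 3: "\<i> *\<^sub>C 2 *\<^sub>R (\<i> *\<^sub>C (y - star y)) = - (2 *\<^sub>R (y - star y))"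
    by (simp only: scaleR_scaleC scaleC_scaleC i2 complex_vector.scale_minus_left)
  have "4 *\<^sub>R y = 2 *\<^sub>R y + 2 *\<^sub>R y" by (simp flip: scaleR_add_left)
  then show ?thesis unfolding 1 2 3 by (simp add: scaleR_add_right scaleR_diff_right)
qed

text \<open>Suppose that the net does not converge at \<open>a\<close>. The maps \<open>\<psi> d\<close> below are \<open>\<phi> d\<close> followed by the matrix
  representation \<open>R d\<close>, which factors through \<open>\<theta>\<close>. Both families are bounded in each matrix entry, so they
  converge along a refinement \<open>G'\<close> of the net. The limit of the \<open>\<psi> d\<close> is completely positive because the factors of a
  positive matrix are bounded too, and converge along a further refinement.\<close>

theorem strong_korovkin_of_boundary:
  fixes \<theta> :: "'a::cstar_algebra \<Rightarrow> 'b::complex_normed_vector" and B :: "'b star_algebra"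
    and u :: "nat \<Rightarrow> 'h::chilbert_space" and s :: "nat \<Rightarrow> 'a"
  assumes u: "\<And>n. orthonormal n u" and dense: "closure (range s) = UNIV"
    and hom: "\<And>L (\<sigma> :: 'a \<Rightarrow> 'h \<Rightarrow>\<^sub>L 'h). irreducible_representation L \<sigma> \<Longrightarrow> has_cdim L n"
    and sem: "cstar_seminorm (\<lambda>x. norm (\<theta> x)) K"
    and lin: "clinear \<theta>" and mult: "\<And>x y. product B (\<theta> x) (\<theta> y) = \<theta> (x * y)"
    and inv: "\<And>x. involution B (\<theta> x) = \<theta> (star x)"
    and uep: "\<And>L (\<rho> :: 'a \<Rightarrow> 'h \<Rightarrow>\<^sub>L 'h). irreducible_representation L \<rho> \<Longrightarrow> unique_extension_property S L \<rho>"
  shows "strong_korovkin TYPE('i) B S \<theta>"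
  unfolding strong_korovkin_def
proof (intro allI impI, elim conjE)
  fix D :: "'i set" and r \<phi> and a :: 'a
  assume dir: "directed_on D r" and ucp: "\<forall>d\<in>D. ucp (B\<lparr>carrier := range \<theta>\<rparr>) (\<phi> d)"
    and conv: "\<forall>s\<in>S. ((\<lambda>d. norm (\<phi> d s - \<theta> s)) \<longlongrightarrow> 0) (net_filter D r)"
  interpret cstar_seminorm "\<lambda>x. norm (\<theta> x)" K by (rule sem)
  note \<theta>D = clinearD[OF lin]
  have att: "n > 0 \<and> (\<exists>R. matrix_representation n R \<and> (\<forall>x. \<forall>i<n. \<forall>j<n. cmod (R x i j) \<le> norm (\<theta> x)) \<and>
      (norm (\<theta> b))\<^sup>2 \<le> (\<Sum>i<n. \<Sum>j<n. (cmod (R b i j))\<^sup>2))" for b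
    by (rule matrix_representation_attains[OF u dense]) (rule hom)
  have n0: "n > 0" using att by blast
  show "((\<lambda>d. norm (\<phi> d a - \<theta> a)) \<longlongrightarrow> 0) (net_filter D r)"
  proof (rule ccontr)
    assume "\<not> ?thesis"
    then obtain \<epsilon> where \<epsilon>: "\<epsilon> > 0" "\<not> eventually (\<lambda>d. norm (\<phi> d a - \<theta> a) < \<epsilon>) (net_filter D r)"
      unfolding tendsto_iff dist_real_def by auto
    \<comment> \<open>The part of the net on which the distance at \<open>a\<close> stays at least \<open>\<epsilon>\<close>.\<close>
    define G where "G = inf (net_filter D r) (principal {d. \<epsilon> \<le> norm (\<phi> d a - \<theta> a)})"
    have evD: "eventually (\<lambda>d. d \<in> D) (net_filter D r)"
      using eventually_net_filter[OF dir] dir by (auto simp: directed_on_def)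
    have G0: "G \<noteq> bot"
      using \<epsilon>(2) by (simp add: G_def trivial_limit_def eventually_inf_principal not_le)
    have GD: "eventually (\<lambda>d. d \<in> D) G" using evD unfolding G_def by (simp add: eventually_inf_principal eventually_mono)
    have G\<epsilon>: "eventually (\<lambda>d. \<epsilon> \<le> norm (\<phi> d a - \<theta> a)) G"
      by (simp add: G_def eventually_inf_principal)
    have Gle: "G \<le> net_filter D r" by (simp add: G_def)
    have ulin: "clinear (\<phi> d)" and urange: "range (\<phi> d) \<subseteq> range \<theta>" if "d \<in> D" for d
      using ucp that by (auto simp: ucp_def completely_positive_def)
    note uD = clinearD[OF ulin]
    have upos: "\<exists>w. \<forall>i<k. \<forall>j<k. \<phi> d (x i j) = \<theta> (\<Sum>l<k. star (w l i) * w l j)"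
      if d: "d \<in> D" and x: "positive_matrix full_algebra k x" for d k x
    proof -
      have "positive_matrix (B\<lparr>carrier := range \<theta>\<rparr>) k (\<lambda>i j. \<phi> d (x i j))"
        using ucp d x by (auto simp: ucp_def completely_positive_def)
      then obtain z where "\<forall>i<k. \<forall>j<k. z i j \<in> range \<theta>"
        and z': "\<forall>i<k. \<forall>j<k. \<phi> d (x i j) = (\<Sum>l<k. product B (involution B (z l i)) (z l j))"
        unfolding positive_matrix_def by auto
      then have "\<exists>w. i < k \<longrightarrow> j < k \<longrightarrow> z i j = \<theta> w" for i j by blast
      then obtain w where w: "\<And>i j. i < k \<Longrightarrow> j < k \<Longrightarrow> z i j = \<theta> (w i j)" by metis
      have z: "\<phi> d (x i j) = (\<Sum>l<k. product B (involution B (z l i)) (z l j))" if "i < k" "j < k" for i j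
        using z' that by blast
      have "\<phi> d (x i j) = \<theta> (\<Sum>l<k. star (w l i) * w l j)" if "i < k" "j < k" for i j
        unfolding z[OF that] \<theta>D(7) by (rule sum.cong) (simp_all add: w that inv mult)
      then show ?thesis by blast
    qed
    have uone: "\<phi> d 1 = \<theta> 1" if d: "d \<in> D" for d
    proof -
      obtain y where y: "\<phi> d 1 = \<theta> y" using urange[OF d] by blast
      have "product B (\<phi> d 1) (\<theta> 1) = \<theta> 1" using ucp d by (auto simp: ucp_def)
      then show ?thesis by (simp add: y mult)
    qed
    \<comment> \<open>A preimage under \<open>\<theta>\<close>. The choice does not matter, because \<open>R d\<close> vanishes on the kernel of \<open>\<theta>\<close>.\<close>
    define w where "w d x = (SOME y. \<theta> y = \<phi> d x)" for d x
    have w: "\<theta> (w d x) = \<phi> d x" if "d \<in> D" for d x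
      unfolding w_def by (rule someI_ex) (use urange[OF that] in \<open>metis imageE rangeI subsetD\<close>)
    have "\<exists>R. matrix_representation n R \<and> (\<forall>x. \<forall>i<n. \<forall>j<n. cmod (R x i j) \<le> norm (\<theta> x)) \<and>
        (norm (\<theta> (w d a - a)))\<^sup>2 \<le> (\<Sum>i<n. \<Sum>j<n. (cmod (R (w d a - a) i j))\<^sup>2)" for d
      using att by blast
    then obtain R where R: "\<And>d. matrix_representation n (R d)"
      and Rle: "\<And>d x i j. i < n \<Longrightarrow> j < n \<Longrightarrow> cmod (R d x i j) \<le> norm (\<theta> x)"
      and Ratt: "\<And>d. (norm (\<theta> (w d a - a)))\<^sup>2 \<le> (\<Sum>i<n. \<Sum>j<n. (cmod (R d (w d a - a) i j))\<^sup>2)"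
      by metis
    have Radd: "R d (x + y) i j = R d x i j + R d y i j"
      and Rscale: "R d (c *\<^sub>C x) i j = c * R d x i j"
      and Rmult: "R d (x * y) i j = (\<Sum>k<n. R d x i k * R d y k j)"
      and Rstar: "R d (star x) i j = cnj (R d x j i)"
      and Rone: "R d 1 i j = (if i = j then 1 else 0)" if "i < n" "j < n" for d x y c i j
      using R[of d] that unfolding matrix_representation_def by blast+
    have Rdiff: "R d (x - y) i j = R d x i j - R d y i j" if "i < n" "j < n" for d x y i j
      using Radd[OF that, of d "x - y" y] by simp
    have Rsum: "R d (\<Sum>l\<in>I. f l) i j = (\<Sum>l\<in>I. R d (f l) i j)" if "i < n" "j < n" for d i j I and f :: "nat \<Rightarrow> 'a"
      by (induction I rule: infinite_finite_induct)
        (use Rscale[OF that, of d 0 0] in \<open>auto simp: Radd that\<close>)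
    have Req: "R d x i j = R d y i j" if "\<theta> x = \<theta> y" "i < n" "j < n" for d x y i j
      using Rle[OF that(2,3), of d "x - y"] that by (simp add: \<theta>D Rdiff)
    define \<psi> where "\<psi> d x i j = R d (w d x) i j" for d x i j
    have \<psi>: "\<psi> d x i j = R d y i j" if "d \<in> D" "\<phi> d x = \<theta> y" "i < n" "j < n" for d x y i j
      unfolding \<psi>_def by (rule Req) (use that w in auto)
    have \<psi>add: "\<psi> d (x + y) i j = \<psi> d x i j + \<psi> d y i j" if "d \<in> D" "i < n" "j < n" for d x y i j
    proof -
      have "\<psi> d (x + y) i j = R d (w d x + w d y) i j"
        by (rule \<psi>) (use that w in \<open>auto simp: uD \<theta>D\<close>)
      then show ?thesis by (simp add: Radd that \<psi>_def)
    qed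
    have \<psi>scale: "\<psi> d (c *\<^sub>C x) i j = c * \<psi> d x i j" if "d \<in> D" "i < n" "j < n" for d x c i j
    proof -
      have "\<psi> d (c *\<^sub>C x) i j = R d (c *\<^sub>C w d x) i j"
        by (rule \<psi>) (use that w in \<open>auto simp: uD \<theta>D\<close>)
      then show ?thesis by (simp add: Rscale that \<psi>_def)
    qed
    have \<psi>diff: "\<psi> d (x - y) i j = \<psi> d x i j - \<psi> d y i j" if "d \<in> D" "i < n" "j < n" for d x y i j
      using \<psi>add[OF that, of "x - y" y] by simp
    have \<psi>one: "\<psi> d 1 i j = (if i = j then 1 else 0)" if "d \<in> D" "i < n" "j < n" for d i j
      using \<psi>[OF that(1) uone[OF that(1)] that(2,3)] Rone[OF that(2,3)] by simp
    have \<psi>pos: "\<exists>Z. \<forall>i<k. \<forall>j<k. \<forall>p<n. \<forall>q<n. \<psi> d (x i j) p q = (\<Sum>l<k. \<Sum>c<n. cnj (Z l i c p) * Z l j c q)"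
      if d: "d \<in> D" and x: "positive_matrix full_algebra k x" for d k x
    proof -
      obtain z where z: "\<And>i j. i < k \<Longrightarrow> j < k \<Longrightarrow> \<phi> d (x i j) = \<theta> (\<Sum>l<k. star (z l i) * z l j)"
        using upos[OF d x] by blast
      have "\<psi> d (x i j) p q = (\<Sum>l<k. \<Sum>c<n. cnj (R d (z l i) c p) * R d (z l j) c q)"
        if "i < k" "j < k" "p < n" "q < n" for i j p q
        using \<psi>[OF d z[OF that(1,2)] that(3,4)] by (simp add: Rsum that Rmult Rstar)
      then show ?thesis by (intro exI[of _ "\<lambda>l i. R d (z l i)"]) simp
    qed
    have sq: "cmod (\<psi> d (star y * y) i j) \<le> (norm y)\<^sup>2" if d: "d \<in> D" and ij: "i < n" "j < n" for d y i j
    proof -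
      have p1: "positive_matrix full_algebra 1 (\<lambda>_ _. star v * v)" for v :: 'a
        unfolding positive_matrix_def full_algebra_def by (intro exI[of _ "\<lambda>_ _. v"]) simp
      obtain c where c: "star y * y + star c * c = (norm y)\<^sup>2 *\<^sub>R 1"
        using star_mult_complement[of y "(norm y)\<^sup>2"] by auto
      have "\<exists>Z. \<forall>p<n. \<forall>q<n. \<psi> d (star v * v) p q = (\<Sum>c<n. cnj (Z c p) * Z c q)" for v
        using \<psi>pos[OF d p1[of v]] by (auto intro: exI[of _ "_ 0 0"])
      then obtain Z where Z: "\<And>v p q. p < n \<Longrightarrow> q < n \<Longrightarrow> \<psi> d (star v * v) p q = (\<Sum>c<n. cnj (Z v c p) * Z v c q)"
        by metis
      have diag: "\<psi> d (star v * v) p p = of_real (\<Sum>c<n. (cmod (Z v c p))\<^sup>2)" if "p < n" for v p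
        using Z[OF that that] by (simp add: complex_norm_square mult.commute del: of_real_power)
      have le: "(\<Sum>c<n. (cmod (Z y c p))\<^sup>2) \<le> (norm y)\<^sup>2" if p: "p < n" for p
      proof -
        have "\<psi> d (star y * y) p p + \<psi> d (star c * c) p p = \<psi> d (of_real ((norm y)\<^sup>2) *\<^sub>C 1) p p"
          using \<psi>add[OF d p p, of "star y * y" "star c * c"] by (simp only: c scaleR_scaleC)
        also have "\<dots> = of_real ((norm y)\<^sup>2)" by (simp only: \<psi>scale[OF d p p] \<psi>one[OF d p p]) simp
        finally have "(\<Sum>c<n. (cmod (Z y c p))\<^sup>2) + (\<Sum>l<n. (cmod (Z c l p))\<^sup>2) = (norm y)\<^sup>2"
          unfolding diag[OF p] of_real_add[symmetric] of_real_eq_iff .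
        moreover have "(\<Sum>l<n. (cmod (Z c l p))\<^sup>2) \<ge> 0" by (rule sum_nonneg) simp
        ultimately show ?thesis by simp
      qed
      have "cmod (\<psi> d (star y * y) i j) \<le> (\<Sum>c<n. cmod (Z y c i) * cmod (Z y c j))"
        unfolding Z[OF ij] by (rule order_trans[OF norm_sum]) (simp add: norm_mult)
      also have "\<dots> \<le> (\<Sum>c<n. ((cmod (Z y c i))\<^sup>2 + (cmod (Z y c j))\<^sup>2) / 2)"
      proof (rule sum_mono)
        fix c
        show "cmod (Z y c i) * cmod (Z y c j) \<le> ((cmod (Z y c i))\<^sup>2 + (cmod (Z y c j))\<^sup>2) / 2"
          using sum_squares_bound[of "cmod (Z y c i)" "cmod (Z y c j)"] by simp
      qed
      also have "\<dots> = ((\<Sum>c<n. (cmod (Z y c i))\<^sup>2) + (\<Sum>c<n. (cmod (Z y c j))\<^sup>2)) / 2"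
        by (simp add: sum.distrib sum_divide_distrib[symmetric])
      also have "\<dots> \<le> (norm y)\<^sup>2" using le[OF ij(1)] le[OF ij(2)] by simp
      finally show ?thesis .
    qed
    have \<psi>bound: "cmod (\<psi> d y i j) \<le> (1 + norm y)\<^sup>2" if d: "d \<in> D" and ij: "i < n" "j < n" for d y i j
    proof -
      have b: "cmod (\<psi> d (star v * v) i j) \<le> (1 + norm y)\<^sup>2" if "norm v \<le> 1 + norm y" for v
        using sq[OF d ij, of v] power_mono[OF that norm_ge_zero, of 2] by linarith
      have nb: "norm (1 + y) \<le> 1 + norm y" "norm (1 - y) \<le> 1 + norm y"
        "norm (1 + \<i> *\<^sub>C y) \<le> 1 + norm y" "norm (1 - \<i> *\<^sub>C y) \<le> 1 + norm y"
        using norm_triangle_ineq[of 1 y] norm_triangle_ineq4[of 1 y]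
          norm_triangle_ineq[of 1 "\<i> *\<^sub>C y"] norm_triangle_ineq4[of 1 "\<i> *\<^sub>C y"] by (simp_all add: norm_scaleC)
      define A1 A2 A3 A4 where "A1 = \<psi> d (star (1 + y) * (1 + y)) i j" and "A2 = \<psi> d (star (1 - y) * (1 - y)) i j"
        and "A3 = \<psi> d (star (1 + \<i> *\<^sub>C y) * (1 + \<i> *\<^sub>C y)) i j" and "A4 = \<psi> d (star (1 - \<i> *\<^sub>C y) * (1 - \<i> *\<^sub>C y)) i j"
      have A: "cmod A1 \<le> (1 + norm y)\<^sup>2" "cmod A2 \<le> (1 + norm y)\<^sup>2" "cmod A3 \<le> (1 + norm y)\<^sup>2" "cmod A4 \<le> (1 + norm y)\<^sup>2"
        unfolding A1_def A2_def A3_def A4_def by (rule b, rule nb)+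
      have "4 * \<psi> d y i j = \<psi> d (4 *\<^sub>R y) i j" unfolding scaleR_scaleC \<psi>scale[OF d ij] by simp
      also have "\<dots> = (A1 - A2) - \<i> * (A3 - A4)"
        unfolding A1_def A2_def A3_def A4_def by (subst polarization_one) (simp only: \<psi>diff[OF d ij] \<psi>scale[OF d ij])
      finally have "cmod (4 * \<psi> d y i j) = cmod ((A1 - A2) - \<i> * (A3 - A4))" by simp
      also have "\<dots> \<le> cmod (A1 - A2) + cmod (\<i> * (A3 - A4))" by (rule norm_triangle_ineq4)
      also have "\<dots> \<le> (cmod A1 + cmod A2) + (cmod A3 + cmod A4)"
        using norm_triangle_ineq4[of A1 A2] norm_triangle_ineq4[of A3 A4] by (simp add: norm_mult)
      finally show ?thesis using A by (simp add: norm_mult)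
    qed
    \<comment> \<open>the representations \<open>R d\<close> and the maps \<open>\<psi> d\<close> converge along a common refinement of the net\<close>
    define f where "f d = (\<lambda>(t, x, i, j). if i < n \<and> j < n then (if t then R d x i j else \<psi> d x i j) else 0)" for d
    define C where "C = (\<lambda>(t::bool, x, i::nat, j::nat). norm (\<theta> x) + (1 + norm x)\<^sup>2)"
    have "eventually (\<lambda>d. \<forall>j. cmod (f d j) \<le> C j) G"
      using GD
    proof (rule eventually_mono, intro allI)
      fix d :: 'i and m :: "bool \<times> 'a \<times> nat \<times> nat" assume d: "d \<in> D"
      obtain t x i j where m: "m = (t, x, i, j)" by (cases m)
      show "cmod (f d m) \<le> C m"
        using Rle[of i j d x] \<psi>bound[OF d, of i j x] by (auto simp: m f_def C_def add_increasing add_increasing2)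
    qed
    from bounded_family_cluster[OF G0 this] obtain G' l where G': "G' \<le> G" "G' \<noteq> bot"
      and lim: "\<And>m. ((\<lambda>d. f d m) \<longlongrightarrow> l m) G'" by metis
    define Rlim where "Rlim x i j = l (True, x, i, j)" for x i j
    define \<psi>lim where "\<psi>lim x i j = l (False, x, i, j)" for x i j
    have limR: "((\<lambda>d. R d x i j) \<longlongrightarrow> Rlim x i j) G'" if "i < n" "j < n" for x i j
      using lim[of "(True, x, i, j)"] that by (simp add: f_def Rlim_def)
    have lim\<psi>: "((\<lambda>d. \<psi> d x i j) \<longlongrightarrow> \<psi>lim x i j) G'" if "i < n" "j < n" for x i j
      using lim[of "(False, x, i, j)"] that by (simp add: f_def \<psi>lim_def)
    have G'D: "eventually (\<lambda>d. d \<in> D) G'" using filter_leD[OF G'(1) GD] .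
    have uniq: "l1 = l2" if "(g \<longlongrightarrow> l1) G'" "(h \<longlongrightarrow> l2) G'" "\<And>d. d \<in> D \<Longrightarrow> g d = h d" for g h and l1 l2 :: complex
      by (rule tendsto_unique[OF G'(2) that(1)])
        (rule Lim_transform_eventually[OF that(2) eventually_mono[OF G'D]], simp add: that(3))
    have Rrep: "matrix_representation n Rlim"
      unfolding matrix_representation_def
    proof (intro allI impI conjI)
      fix i j assume ij: "i < n" "j < n"
      show "Rlim (x + y) i j = Rlim x i j + Rlim y i j" for x y
        by (rule uniq[OF limR[OF ij] tendsto_add[OF limR[OF ij] limR[OF ij]]]) (rule Radd[OF ij])
      show "Rlim (c *\<^sub>C x) i j = c * Rlim x i j" for c x
        by (rule uniq[OF limR[OF ij] tendsto_mult[OF tendsto_const limR[OF ij]]]) (rule Rscale[OF ij])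
      have "((\<lambda>d. \<Sum>k<n. R d x i k * R d y k j) \<longlongrightarrow> (\<Sum>k<n. Rlim x i k * Rlim y k j)) G'" for x y
        by (intro tendsto_sum tendsto_mult limR) (use ij in auto)
      then show "Rlim (x * y) i j = (\<Sum>k<n. Rlim x i k * Rlim y k j)" for x y
        by (rule uniq[OF limR[OF ij]]) (rule Rmult[OF ij])
      show "Rlim (star x) i j = cnj (Rlim x j i)" for x
        by (rule uniq[OF limR[OF ij] tendsto_cnj[OF limR[OF ij(2,1)]]]) (rule Rstar[OF ij])
      show "Rlim 1 i j = (if i = j then 1 else 0)"
        by (rule uniq[OF limR[OF ij] tendsto_const]) (rule Rone[OF ij])
    qed
    let ?L = "cspan (u ` {..<n})"
    define \<rho> where "\<rho> x = op_of n u (Rlim x)" for x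
    define \<Psi> where "\<Psi> x = op_of n u (\<psi>lim x)" for x
    have rep: "unital_representation ?L \<rho>"
      unfolding \<rho>_def[abs_def] by (rule unital_representation_op_of[OF u Rrep])
    have "irreducible_representation ?L \<rho>"
      by (rule irreducible_of_homogeneous[OF _ u n0 rep]) (rule hom)
    then have UEP: "unique_extension_property S ?L \<rho>" by (rule uep)
    have "ucp (bounded_operators ?L) \<Psi>"
      unfolding ucp_def completely_positive_def
    proof (intro conjI allI impI ballI)
      show "clinear \<Psi>"
        unfolding clinear_iff \<Psi>_def op_of_add[symmetric] op_of_scaleC[symmetric]
      proof (intro conjI allI op_of_cong)
        fix i j assume ij: "i < n" "j < n"
        show "\<psi>lim (x + y) i j = \<psi>lim x i j + \<psi>lim y i j" for x y
          by (rule uniq[OF lim\<psi>[OF ij] tendsto_add[OF lim\<psi>[OF ij] lim\<psi>[OF ij]]]) (rule \<psi>add[OF _ ij])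
        show "\<psi>lim (c *\<^sub>C x) i j = c * \<psi>lim x i j" for c x
          by (rule uniq[OF lim\<psi>[OF ij] tendsto_mult[OF tendsto_const lim\<psi>[OF ij]]]) (rule \<psi>scale[OF _ ij])
      qed
      show "range \<Psi> \<subseteq> carrier (bounded_operators ?L)" using op_of_carrier[OF u] by (auto simp: \<Psi>_def)
      have one: "\<psi>lim 1 i j = (if i = j then 1 else 0)" if ij: "i < n" "j < n" for i j
        by (rule uniq[OF lim\<psi>[OF ij] tendsto_const]) (rule \<psi>one[OF _ ij])
      fix T assume T: "T \<in> carrier (bounded_operators ?L)"
      have T': "T = op_of n u (matrix_of u T)" using op_of_matrix_of[OF u T] ..
      have "\<Psi> 1 o\<^sub>L T = op_of n u (\<lambda>i j. \<Sum>k<n. \<psi>lim 1 i k * matrix_of u T k j)"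
        unfolding \<Psi>_def by (subst T') (rule op_of_mult[OF u])
      also have "\<dots> = op_of n u (matrix_of u T)"
        by (rule op_of_cong) (simp add: one if_distrib[of "\<lambda>c. c * _"] cong: if_cong)
      finally show "product (bounded_operators ?L) (\<Psi> 1) T = T" using T' by (simp add: bounded_operators_def)
      have "T o\<^sub>L \<Psi> 1 = op_of n u (\<lambda>i j. \<Sum>k<n. matrix_of u T i k * \<psi>lim 1 k j)"
        unfolding \<Psi>_def by (subst T') (rule op_of_mult[OF u])
      also have "\<dots> = op_of n u (matrix_of u T)"
        by (rule op_of_cong) (simp add: one if_distrib[of "\<lambda>c. _ * c"] cong: if_cong)
      finally show "product (bounded_operators ?L) T (\<Psi> 1) = T" using T' by (simp add: bounded_operators_def)
    next
      fix k x assume x: "positive_matrix (full_algebra :: 'a star_algebra) k x"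
      have "\<forall>d. \<exists>Z. d \<in> D \<longrightarrow> (\<forall>i<k. \<forall>j<k. \<forall>p<n. \<forall>q<n. \<psi> d (x i j) p q = (\<Sum>l<k. \<Sum>c<n. cnj (Z l i c p) * Z l j c q))"
        using \<psi>pos[OF _ x] by blast
      from choice[OF this] obtain Z where Z': "\<forall>d. d \<in> D \<longrightarrow> (\<forall>i<k. \<forall>j<k. \<forall>p<n. \<forall>q<n.
          \<psi> d (x i j) p q = (\<Sum>l<k. \<Sum>c<n. cnj (Z d l i c p) * Z d l j c q))" ..
      have Z: "\<psi> d (x i j) p q = (\<Sum>l<k. \<Sum>c<n. cnj (Z d l i c p) * Z d l j c q)"
        if "d \<in> D" "i < k" "j < k" "p < n" "q < n" for d i j p q
        using Z' that by blast
      have Zle: "(cmod (Z d l i c p))\<^sup>2 \<le> (1 + norm (x i i))\<^sup>2" if d: "d \<in> D" and i: "l < k" "i < k" "c < n" "p < n" for d l i c p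
      proof -
        have "\<psi> d (x i i) p p = of_real (\<Sum>l<k. \<Sum>c<n. (cmod (Z d l i c p))\<^sup>2)"
          using Z[OF d i(2,2,4,4)] by (simp add: complex_norm_square mult.commute del: of_real_power)
        then have "cmod (\<psi> d (x i i) p p) = (\<Sum>l<k. \<Sum>c<n. (cmod (Z d l i c p))\<^sup>2)"
          by (simp del: of_real_sum of_real_power add: sum_nonneg)
        moreover have "(\<Sum>c<n. (cmod (Z d l i c p))\<^sup>2) \<le> (\<Sum>l<k. \<Sum>c<n. (cmod (Z d l i c p))\<^sup>2)"
          using i by (intro member_le_sum[where f = "\<lambda>l. \<Sum>c<n. (cmod (Z d l i c p))\<^sup>2"]) (auto intro: sum_nonneg)
        moreover have "(cmod (Z d l i c p))\<^sup>2 \<le> (\<Sum>c<n. (cmod (Z d l i c p))\<^sup>2)"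
          using i by (intro member_le_sum) auto
        ultimately show ?thesis using \<psi>bound[OF d i(4,4), of "x i i"] by linarith
      qed
      define g where "g d = (\<lambda>(l, i, c, p). if l < k \<and> i < k \<and> c < n \<and> p < n then Z d l i c p else 0)" for d
      have "eventually (\<lambda>d. \<forall>j. cmod (g d j) \<le> (\<lambda>(l::nat, i, c::nat, p::nat). 1 + norm (x i i)) j) G'"
        using G'D
      proof (rule eventually_mono, intro allI)
        fix d :: 'i and m :: "nat \<times> nat \<times> nat \<times> nat" assume d: "d \<in> D"
        obtain l i c p where m: "m = (l, i, c, p)" by (cases m)
        show "cmod (g d m) \<le> (\<lambda>(l, i, c, p). 1 + norm (x i i)) m"
        proof (cases "l < k \<and> i < k \<and> c < n \<and> p < n")
          case True
          then have "(cmod (Z d l i c p))\<^sup>2 \<le> (1 + norm (x i i))\<^sup>2" by (simp only: Zle[OF d])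
          then have "cmod (Z d l i c p) \<le> 1 + norm (x i i)" by (rule power2_le_imp_le) simp
          then show ?thesis using True by (simp add: m g_def)
        next
          case False
          then have "g d m = 0" by (simp only: m g_def prod.case if_False)
          then show ?thesis by (simp add: m)
        qed
      qed
      from bounded_family_cluster[OF G'(2) this] obtain G'' z where G'': "G'' \<le> G'" "G'' \<noteq> bot"
        and limz: "\<And>m. ((\<lambda>d. g d m) \<longlongrightarrow> z m) G''" by metis
      define Y where "Y l i c p = z (l, i, c, p)" for l i c p
      have limY: "((\<lambda>d. Z d l i c p) \<longlongrightarrow> Y l i c p) G''" if "l < k" "i < k" "c < n" "p < n" for l i c p
        using limz[of "(l, i, c, p)"] that by (simp add: g_def Y_def)
      have eq: "\<psi>lim (x i j) p q = (\<Sum>l<k. \<Sum>c<n. cnj (Y l i c p) * Y l j c q)"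
        if ij: "i < k" "j < k" "p < n" "q < n" for i j p q
      proof (rule tendsto_unique[OF G''(2)])
        show "((\<lambda>d. \<psi> d (x i j) p q) \<longlongrightarrow> \<psi>lim (x i j) p q) G''"
          by (rule tendsto_mono[OF G''(1) lim\<psi>[OF ij(3,4)]])
        have "((\<lambda>d. \<Sum>l<k. \<Sum>c<n. cnj (Z d l i c p) * Z d l j c q) \<longlongrightarrow> (\<Sum>l<k. \<Sum>c<n. cnj (Y l i c p) * Y l j c q)) G''"
          by (intro tendsto_sum tendsto_mult tendsto_cnj limY) (use ij in auto)
        then show "((\<lambda>d. \<psi> d (x i j) p q) \<longlongrightarrow> (\<Sum>l<k. \<Sum>c<n. cnj (Y l i c p) * Y l j c q)) G''"
          by (rule Lim_transform_eventually) (rule eventually_mono[OF filter_leD[OF G''(1) G'D]], simp add: Z ij)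
      qed
      show "positive_matrix (bounded_operators ?L) k (\<lambda>i j. \<Psi> (x i j))"
        unfolding positive_matrix_def
      proof (intro exI[of _ "\<lambda>l i. op_of n u (Y l i)"] conjI allI impI)
        show "op_of n u (Y i j) \<in> carrier (bounded_operators ?L)" for i j by (rule op_of_carrier[OF u])
        fix i j assume ij: "i < k" "j < k"
        have "\<Psi> (x i j) = op_of n u (\<lambda>p q. \<Sum>l<k. \<Sum>c<n. cnj (Y l i c p) * Y l j c q)"
          unfolding \<Psi>_def by (rule op_of_cong) (rule eq[OF ij])
        then show "\<Psi> (x i j) = (\<Sum>l<k. product (bounded_operators ?L) (involution (bounded_operators ?L) (op_of n u (Y l i))) (op_of n u (Y l j)))"
          by (simp add: bounded_operators_def op_of_adjoint[OF u] op_of_mult[OF u] op_of_sum)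
      qed
    qed
    moreover have "\<Psi> v = \<rho> v" if v: "v \<in> S" for v
      unfolding \<Psi>_def \<rho>_def
    proof (rule op_of_cong)
      fix i j assume ij: "i < n" "j < n"
      have "((\<lambda>d. norm (\<phi> d v - \<theta> v)) \<longlongrightarrow> 0) G'"
        using conv v tendsto_mono[OF order_trans[OF G'(1) Gle]] by blast
      then have "((\<lambda>d. \<psi> d v i j - R d v i j) \<longlongrightarrow> 0) G'"
      proof (rule Lim_null_comparison[rotated])
        show "eventually (\<lambda>d. cmod (\<psi> d v i j - R d v i j) \<le> norm (\<phi> d v - \<theta> v)) G'"
          using G'D
        proof (rule eventually_mono)
          fix d assume d: "d \<in> D"
          have "cmod (\<psi> d v i j - R d v i j) \<le> norm (\<theta> (w d v - v))"
            using Rle[OF ij, of d "w d v - v"] by (simp add: \<psi>_def Rdiff ij)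
          then show "cmod (\<psi> d v i j - R d v i j) \<le> norm (\<phi> d v - \<theta> v)" by (simp add: \<theta>D w[OF d])
        qed
      qed
      moreover have "((\<lambda>d. \<psi> d v i j - R d v i j) \<longlongrightarrow> \<psi>lim v i j - Rlim v i j) G'"
        by (intro tendsto_diff lim\<psi> limR ij)
      ultimately show "\<psi>lim v i j = Rlim v i j" using tendsto_unique[OF G'(2)] by fastforce
    qed
    ultimately have "\<Psi> = \<rho>" using UEP unfolding unique_extension_property_def by blast
    then have eq: "\<psi>lim a i j = Rlim a i j" if "i < n" "j < n" for i j
      using matrix_of_op_of[OF u that, of "\<psi>lim a"] matrix_of_op_of[OF u that, of "Rlim a"]
      unfolding \<Psi>_def \<rho>_def by metis
    have "((\<lambda>d. \<Sum>i<n. \<Sum>j<n. (cmod (\<psi> d a i j - R d a i j))\<^sup>2) \<longlongrightarrow> (\<Sum>i<n. \<Sum>j<n. (cmod (\<psi>lim a i j - Rlim a i j))\<^sup>2)) G'"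
      by (intro tendsto_sum tendsto_power tendsto_norm tendsto_diff lim\<psi> limR) auto
    moreover have "eventually (\<lambda>d. \<epsilon>\<^sup>2 \<le> (\<Sum>i<n. \<Sum>j<n. (cmod (\<psi> d a i j - R d a i j))\<^sup>2)) G'"
      using eventually_conj[OF G'D filter_leD[OF G'(1) G\<epsilon>]]
    proof (rule eventually_mono, elim conjE)
      fix d assume d: "d \<in> D" "\<epsilon> \<le> norm (\<phi> d a - \<theta> a)"
      have "\<epsilon>\<^sup>2 \<le> (norm (\<theta> (w d a - a)))\<^sup>2"
        using d \<epsilon>(1) by (intro power_mono) (simp_all add: \<theta>D w[OF d(1)])
      also have "\<dots> \<le> (\<Sum>i<n. \<Sum>j<n. (cmod (R d (w d a - a) i j))\<^sup>2)" by (rule Ratt)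
      also have "\<dots> = (\<Sum>i<n. \<Sum>j<n. (cmod (\<psi> d a i j - R d a i j))\<^sup>2)"
        by (intro sum.cong) (simp_all add: Rdiff \<psi>_def)
      finally show "\<epsilon>\<^sup>2 \<le> (\<Sum>i<n. \<Sum>j<n. (cmod (\<psi> d a i j - R d a i j))\<^sup>2)" .
    qed
    ultimately have "\<epsilon>\<^sup>2 \<le> (\<Sum>i<n. \<Sum>j<n. (cmod (\<psi>lim a i j - Rlim a i j))\<^sup>2)"
      by (rule tendsto_lowerbound) (rule G'(2))
    also have "\<dots> = 0" by (simp add: eq)
    finally show False using \<epsilon>(1) by simp
  qed
qed

section \<open>Sums of positive matrices\<close>

definition mapply :: "nat \<Rightarrow> (nat \<Rightarrow> nat \<Rightarrow> 'a::cstar_algebra) \<Rightarrow> (nat \<Rightarrow> 'a) \<Rightarrow> nat \<Rightarrow> 'a"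
  where "mapply k x \<xi> i = (\<Sum>j<k. x i j * \<xi> j)"

text \<open>The inner product of the Hilbert module \<open>A\<^sup>k\<close>, with values in the algebra.\<close>

definition vip :: "nat \<Rightarrow> (nat \<Rightarrow> 'a::cstar_algebra) \<Rightarrow> (nat \<Rightarrow> 'a) \<Rightarrow> 'a"
  where "vip k \<xi> \<eta> = (\<Sum>i<k. star (\<xi> i) * \<eta> i)"

primrec mpow :: "nat \<Rightarrow> (nat \<Rightarrow> nat \<Rightarrow> 'a::cstar_algebra) \<Rightarrow> nat \<Rightarrow> nat \<Rightarrow> nat \<Rightarrow> 'a" where
  "mpow k x 0 = (\<lambda>i j. if i = j then 1 else 0)"
| "mpow k x (Suc m) = (\<lambda>i j. \<Sum>l<k. x i l * mpow k x m l j)"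

lemma delta_sum:
  fixes f :: "nat \<Rightarrow> 'a::ring_1"
  shows "i < k \<Longrightarrow> (\<Sum>l<k. (if i = l then 1 else 0) * f l) = f i"
    "i < k \<Longrightarrow> (\<Sum>l<k. f l * (if l = i then 1 else 0)) = f i"
  by (simp_all add: if_distrib[of "\<lambda>c. c * _"] if_distrib[of "\<lambda>c. _ * c"] cong: if_cong)

lemma mpow_add: "i < k \<Longrightarrow> (\<Sum>l<k. mpow k x r i l * mpow k x s l j) = mpow k x (r + s) i j"
proof (induction r arbitrary: i)
  case (Suc r)
  have "(\<Sum>l<k. mpow k x (Suc r) i l * mpow k x s l j)
      = (\<Sum>l<k. \<Sum>p<k. x i p * (mpow k x r p l * mpow k x s l j))"
    by (simp add: sum_distrib_right mult.assoc)
  also have "\<dots> = (\<Sum>p<k. x i p * (\<Sum>l<k. mpow k x r p l * mpow k x s l j))"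
    by (subst sum.swap) (simp add: sum_distrib_left)
  also have "\<dots> = (\<Sum>p<k. x i p * mpow k x (r + s) p j)"
    by (intro sum.cong) (simp_all add: Suc.IH)
  finally show ?case by simp
qed (simp add: delta_sum)

context
  fixes k :: nat and x :: "nat \<Rightarrow> nat \<Rightarrow> 'a::cstar_algebra"
  assumes sa: "\<And>i j. i < k \<Longrightarrow> j < k \<Longrightarrow> star (x i j) = x j i"
begin

lemma star_mpow: "i < k \<Longrightarrow> j < k \<Longrightarrow> star (mpow k x m i j) = mpow k x m j i"
proof (induction m arbitrary: i j)
  case (Suc m)
  have "star (mpow k x (Suc m) i j) = (\<Sum>l<k. mpow k x m j l * x l i)"
    using Suc by (simp add: star_sum star_mult sa)
  also have "\<dots> = (\<Sum>l<k. mpow k x m j l * mpow k x 1 l i)"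
    using Suc.prems by (intro sum.cong) (simp_all add: delta_sum)
  finally show ?case using mpow_add[OF Suc.prems(2), of x m 1 i] by simp
qed simp

lemma vip_selfadjoint: "vip k (mapply k x \<xi>) \<eta> = vip k \<xi> (mapply k x \<eta>)"
proof -
  have "vip k (mapply k x \<xi>) \<eta> = (\<Sum>i<k. \<Sum>j<k. star (\<xi> j) * star (x i j) * \<eta> i)"
    by (simp add: vip_def mapply_def star_sum star_mult sum_distrib_right)
  also have "\<dots> = (\<Sum>i<k. \<Sum>j<k. star (\<xi> j) * x j i * \<eta> i)"
    by (intro sum.cong) (simp_all add: sa)
  also have "\<dots> = (\<Sum>j<k. \<Sum>i<k. star (\<xi> j) * x j i * \<eta> i)" by (rule sum.swap)
  finally show ?thesis by (simp add: vip_def mapply_def sum_distrib_left mult.assoc)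
qed

text \<open>\<open>0 \<le> x \<le> 1\<close> implies \<open>x\<^sup>2 \<le> 1\<close>, because \<open>x - x\<^sup>2 = (1 - x) x (1 - x) + x (1 - x) x\<close>.\<close>

lemma mapply_contraction:
  assumes pos: "\<And>\<xi>. pos (vip k \<xi> (mapply k x \<xi>))"
    and le1: "\<And>\<xi>. pos (vip k \<xi> \<xi> - vip k \<xi> (mapply k x \<xi>))"
  shows "pos (vip k \<xi> \<xi> - vip k (mapply k x \<xi>) (mapply k x \<xi>))"
proof -
  define b where "b = mapply k x \<xi>"
  have lin: "mapply k x (\<lambda>i. \<xi> i - b i) = (\<lambda>i. b i - mapply k x b i)"
    by (rule ext) (simp add: b_def mapply_def[of k x "\<lambda>i. \<xi> i - mapply k x \<xi> i"] right_diff_distrib sum_subtractf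
        mapply_def[symmetric])
  have "vip k (\<lambda>i. \<xi> i - b i) (mapply k x (\<lambda>i. \<xi> i - b i))
      = (vip k \<xi> b - vip k b b) - (vip k \<xi> (mapply k x b) - vip k b (mapply k x b))"
    unfolding lin by (simp add: vip_def star_diff algebra_simps sum.distrib sum_subtractf)
  also have "vip k \<xi> (mapply k x b) = vip k b b"
    using vip_selfadjoint[of \<xi> b] by (simp add: b_def)
  finally have "pos ((vip k \<xi> b - vip k b b) - (vip k b b - vip k b (mapply k x b)))"
    using pos[of "\<lambda>i. \<xi> i - b i"] by simp
  from pos_add[OF this le1[of b]] have "pos (vip k \<xi> b - vip k b b)" by simp
  from pos_add[OF le1[of \<xi>] this[unfolded b_def]] show ?thesis by simp
qed

text \<open>Each column of a power of \<open>x\<close> is a vector of \<open>A\<^sup>k\<close>, the image of a standard basis vector under contractions.\<close>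

lemma norm_mpow_le_1:
  assumes pos: "\<And>\<xi>. pos (vip k \<xi> (mapply k x \<xi>))"
    and le1: "\<And>\<xi>. pos (vip k \<xi> \<xi> - vip k \<xi> (mapply k x \<xi>))"
    and ij: "i < k" "j < k"
  shows "norm (mpow k x m i j) \<le> 1"
proof -
  define \<delta> :: "nat \<Rightarrow> 'a" where "\<delta> i = (if i = j then 1 else 0)" for i
  have 1: "vip k \<delta> \<delta> = 1"
    using ij by (simp add: vip_def \<delta>_def if_distrib[of star] if_distrib[of "\<lambda>c. c * _"] cong: if_cong)
  have "pos (1 - vip k (\<lambda>i. mpow k x m i j) (\<lambda>i. mpow k x m i j))"
  proof (induction m)
    case 0
    then show ?case using 1 by (simp add: \<delta>_def[abs_def])
  next
    case (Suc m)
    let ?v = "\<lambda>i. mpow k x m i j"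
    have "mapply k x ?v = (\<lambda>i. mpow k x (Suc m) i j)" by (rule ext) (simp add: mapply_def)
    then show ?case using pos_add[OF Suc mapply_contraction[OF pos le1, of ?v]] by simp
  qed
  then have "pos ((1 - (\<Sum>i<k. star (mpow k x m i j) * mpow k x m i j))
      + (\<Sum>l\<in>{..<k} - {i}. star (mpow k x m l j) * mpow k x m l j))"
    by (intro pos_add pos_sum pos_star_mult) (simp add: vip_def)
  moreover have "(\<Sum>l<k. star (mpow k x m l j) * mpow k x m l j)
      = star (mpow k x m i j) * mpow k x m i j + (\<Sum>l\<in>{..<k} - {i}. star (mpow k x m l j) * mpow k x m l j)"
    using ij by (intro sum.remove) auto
  ultimately have "pos (1 *\<^sub>R 1 - star (mpow k x m i j) * mpow k x m i j)" by (simp add: algebra_simps)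
  from norm_le_of_pos[OF pos_star_mult this] show ?thesis
    by (simp add: norm_star_mult power_le_one_iff abs_square_le_1)
qed

text \<open>The entries of the powers of \<open>x\<close> are bounded, so the square root series converges entrywise.\<close>

lemma matrix_sqrt:
  assumes le: "\<And>i j m. i < k \<Longrightarrow> j < k \<Longrightarrow> norm (mpow k x m i j) \<le> 1"
  shows "\<exists>y. \<forall>i<k. \<forall>j<k. star (y i j) = y j i \<and>
    (\<Sum>l<k. y i l * y l j) = (if i = j then 1 else 0) - x i j"
proof -
  define t where "t i j m = sqrt_coeff m *\<^sub>R mpow k x m i j" for i j m
  define y where "y i j = (\<Sum>m. t i j m)" for i j
  have s: "summable (\<lambda>m. norm (t i j m))" if "i < k" "j < k" for i j
    by (rule summable_comparison_test'[OF sqrt_coeff_abs_summable])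
      (use le[OF that] in \<open>simp add: t_def mult_left_le\<close>)
  have "star (y i j) = y j i \<and> (\<Sum>l<k. y i l * y l j) = (if i = j then 1 else 0) - x i j"
    if ij: "i < k" "j < k" for i j
  proof -
    have "star (y i j) = (\<Sum>m. star (t i j m))"
      unfolding y_def by (rule bounded_linear.suminf[OF bounded_linear_star summable_norm_cancel[OF s[OF ij]]])
    also have "\<dots> = y j i" unfolding y_def by (simp add: t_def[abs_def] star_scaleR star_mpow ij)
    finally have y_star: "star (y i j) = y j i" .
    have "(\<lambda>m. \<Sum>l<k. \<Sum>r\<le>m. t i l r * t l j (m - r)) sums (\<Sum>l<k. y i l * y l j)"
      unfolding y_def by (intro sums_sum Cauchy_product_sums s) (use ij in auto)
    moreover have "(\<Sum>l<k. \<Sum>r\<le>m. t i l r * t l j (m - r))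
        = (if m \<in> {0, 1} then (if m = 0 then (if i = j then 1 else 0) else - x i j) else 0)" for m
    proof -
      have "(\<Sum>l<k. \<Sum>r\<le>m. t i l r * t l j (m - r))
          = (\<Sum>r\<le>m. (sqrt_coeff r * sqrt_coeff (m - r)) *\<^sub>R (\<Sum>l<k. mpow k x r i l * mpow k x (m - r) l j))"
        by (subst sum.swap) (simp add: t_def scaleR_sum_right mult.commute)
      also have "\<dots> = (\<Sum>r\<le>m. sqrt_coeff r * sqrt_coeff (m - r)) *\<^sub>R mpow k x m i j"
        by (simp add: mpow_add ij scaleR_sum_left)
      finally show ?thesis using ij by (auto simp: sqrt_coeff_convolution delta_sum)
    qed
    ultimately have "(\<lambda>m. if m \<in> {0, 1} then (if m = (0::nat) then (if i = j then 1 else 0) else - x i j) else 0)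
        sums (\<Sum>l<k. y i l * y l j)" by simp
    moreover have "(\<lambda>m. if m \<in> {0, 1} then (if m = (0::nat) then (if i = j then 1 else 0) else - x i j) else 0)
        sums (\<Sum>m\<in>{0, 1::nat}. if m = 0 then (if i = j then 1 else 0) else - x i j)"
      by (rule sums_If_finite_set) simp
    ultimately have "(\<Sum>l<k. y i l * y l j) = (\<Sum>m\<in>{0, 1::nat}. if m = 0 then (if i = j then 1 else 0) else - x i j)"
      by (rule sums_unique2)
    then show ?thesis using y_star by simp
  qed
  then show ?thesis by blast
qed

end

lemma of_nat_mult_scaleR: "of_nat k * v = real k *\<^sub>R (v :: 'a::real_algebra_1)"
  by (simp add: scaleR_conv_of_real)

lemma pos_sum_square_le:
  fixes a :: "nat \<Rightarrow> 'a::cstar_algebra"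
  shows "pos (real k *\<^sub>R (\<Sum>j<k. star (a j) * a j) - star (\<Sum>j<k. a j) * (\<Sum>j<k. a j))"
proof -
  have "(\<Sum>i<k. \<Sum>j<k. star (a i - a j) * (a i - a j))
      = 2 *\<^sub>R (real k *\<^sub>R (\<Sum>j<k. star (a j) * a j)) - 2 *\<^sub>R (star (\<Sum>j<k. a j) * (\<Sum>j<k. a j))"
  proof -
    have "(\<Sum>i<k. \<Sum>j<k. star (a i - a j) * (a i - a j))
        = (\<Sum>i<k. \<Sum>j<k. star (a i) * a i) + (\<Sum>i<k. \<Sum>j<k. star (a j) * a j)
          - (\<Sum>i<k. \<Sum>j<k. star (a i) * a j) - (\<Sum>i<k. \<Sum>j<k. star (a j) * a i)"
      by (simp add: star_diff algebra_simps sum.distrib sum_subtractf)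
    also have "(\<Sum>i<k. \<Sum>j<k. star (a j) * a i) = (\<Sum>i<k. \<Sum>j<k. star (a i) * a j)" by (rule sum.swap)
    also have "(\<Sum>i<k. \<Sum>j<k. star (a i) * a j) = star (\<Sum>j<k. a j) * (\<Sum>j<k. a j)"
      by (simp add: star_sum sum_product)
    also have "(\<Sum>i<k. \<Sum>j<k. star (a i) * a i) = real k *\<^sub>R (\<Sum>j<k. star (a j) * a j)"
      by (simp add: scaleR_sum_right of_nat_mult_scaleR[where 'a = 'a])
    also have "(\<Sum>i<k. \<Sum>j<k. star (a j) * a j) = real k *\<^sub>R (\<Sum>j<k. star (a j) * a j)"
      by (simp add: of_nat_mult_scaleR[where 'a = 'a])
    finally show ?thesis by (simp only: scaleR_2 diff_diff_eq diff_add_eq)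
  qed
  then have "real k *\<^sub>R (\<Sum>j<k. star (a j) * a j) - star (\<Sum>j<k. a j) * (\<Sum>j<k. a j)
      = (1/2) *\<^sub>R (\<Sum>i<k. \<Sum>j<k. star (a i - a j) * (a i - a j))"
    by (simp add: scaleR_diff_right)
  then show ?thesis by (simp only:) (intro pos_scaleR pos_sum pos_star_mult, simp)
qed

text \<open>Boundedness of a matrix as an operator on \<open>A\<^sup>k\<close>.\<close>

lemma vip_mapply_bound:
  fixes z :: "nat \<Rightarrow> nat \<Rightarrow> 'a::cstar_algebra"
  shows "\<exists>M\<ge>0. \<forall>\<xi>. pos (M *\<^sub>R vip k \<xi> \<xi> - vip k (mapply k z \<xi>) (mapply k z \<xi>))"
proof -
  define C where "C = (\<Sum>l<k. \<Sum>j<k. (norm (z l j))\<^sup>2)"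
  have C0: "C \<ge> 0" unfolding C_def by (intro sum_nonneg) simp
  have zC: "(norm (z l j))\<^sup>2 \<le> C" if "l < k" "j < k" for l j
  proof -
    have "(norm (z l j))\<^sup>2 \<le> (\<Sum>j<k. (norm (z l j))\<^sup>2)" using that by (intro member_le_sum) auto
    also have "\<dots> \<le> C" unfolding C_def
      using that by (intro member_le_sum[where f = "\<lambda>l. \<Sum>j<k. (norm (z l j))\<^sup>2"]) (auto intro: sum_nonneg)
    finally show ?thesis .
  qed
  have row: "pos ((real k * C) *\<^sub>R vip k \<xi> \<xi> - star (mapply k z \<xi> l) * mapply k z \<xi> l)" if l: "l < k" for \<xi> l
  proof -
    have "pos (C *\<^sub>R (star (\<xi> j) * \<xi> j) - star (z l j * \<xi> j) * (z l j * \<xi> j))" if j: "j < k" for j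
    proof -
      have "pos (star (\<xi> j) * (C *\<^sub>R 1 - star (z l j) * z l j) * \<xi> j)"
        by (rule pos_conj[OF pos_diff_star_mult[OF zC[OF l j]]])
      then show ?thesis by (simp add: star_mult algebra_simps)
    qed
    then have "pos (\<Sum>j<k. C *\<^sub>R (star (\<xi> j) * \<xi> j) - star (z l j * \<xi> j) * (z l j * \<xi> j))"
      by (intro pos_sum) auto
    then have "pos (real k *\<^sub>R (\<Sum>j<k. C *\<^sub>R (star (\<xi> j) * \<xi> j) - star (z l j * \<xi> j) * (z l j * \<xi> j)))"
      by (rule pos_scaleR) simp
    from pos_add[OF this pos_sum_square_le[of k "\<lambda>j. z l j * \<xi> j"]]
    show ?thesis by (simp add: vip_def mapply_def sum_subtractf scaleR_diff_right scaleR_sum_right[symmetric])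
  qed
  have "pos ((real k * (real k * C)) *\<^sub>R vip k \<xi> \<xi> - vip k (mapply k z \<xi>) (mapply k z \<xi>))" for \<xi>
  proof -
    have "pos (\<Sum>l<k. (real k * C) *\<^sub>R vip k \<xi> \<xi> - star (mapply k z \<xi> l) * mapply k z \<xi> l)"
      by (intro pos_sum row) simp
    then show ?thesis
      by (simp add: sum_subtractf vip_def[of k "mapply k z \<xi>"] mult_ac of_nat_mult_scaleR[where 'a = 'a])
  qed
  then show ?thesis using C0 by (intro exI[of _ "real k * (real k * C)"]) auto
qed

lemma vip_gram:
  fixes z :: "nat \<Rightarrow> nat \<Rightarrow> 'a::cstar_algebra"
  assumes "\<And>i j. i < k \<Longrightarrow> j < k \<Longrightarrow> P i j = (\<Sum>l<k. star (z l i) * z l j)"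
  shows "vip k \<xi> (mapply k P \<xi>) = vip k (mapply k z \<xi>) (mapply k z \<xi>)"
proof -
  have "vip k \<xi> (mapply k P \<xi>) = (\<Sum>i<k. \<Sum>j<k. \<Sum>l<k. star (\<xi> i) * (star (z l i) * (z l j * \<xi> j)))"
    by (simp add: vip_def mapply_def assms sum_distrib_left sum_distrib_right mult.assoc)
  also have "\<dots> = (\<Sum>i<k. \<Sum>l<k. \<Sum>j<k. star (\<xi> i) * (star (z l i) * (z l j * \<xi> j)))"
    by (rule sum.cong[OF refl]) (rule sum.swap)
  also have "\<dots> = (\<Sum>l<k. \<Sum>i<k. \<Sum>j<k. star (\<xi> i) * (star (z l i) * (z l j * \<xi> j)))"
    by (rule sum.swap)
  also have "\<dots> = vip k (mapply k z \<xi>) (mapply k z \<xi>)"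
    by (simp add: vip_def mapply_def star_sum star_mult sum_product mult.assoc)
  finally show ?thesis .
qed

lemma positive_matrix_full_algebra:
  "positive_matrix full_algebra k P \<longleftrightarrow>
    (\<exists>z. \<forall>i<k. \<forall>j<k. P i j = (\<Sum>l<k. star (z l i) * (z l j :: 'a::cstar_algebra)))"
  by (simp add: positive_matrix_def full_algebra_def)

text \<open>A positive matrix is given by a single factor, so that a sum of two positive matrices requires a square root.
  After division by a bound \<open>M\<close> the sum becomes \<open>1 - x\<close> with \<open>0 \<le> x \<le> 1\<close> on the Hilbert module \<open>A\<^sup>k\<close>, and the
  square root series applies to \<open>x\<close>.\<close>

lemma positive_matrix_add:
  fixes P Q :: "nat \<Rightarrow> nat \<Rightarrow> 'a::cstar_algebra"
  assumes "positive_matrix full_algebra k P" "positive_matrix full_algebra k Q"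
  shows "positive_matrix full_algebra k (\<lambda>i j. P i j + Q i j)"
proof -
  obtain z where z: "\<And>i j. i < k \<Longrightarrow> j < k \<Longrightarrow> P i j = (\<Sum>l<k. star (z l i) * z l j)"
    using assms(1) unfolding positive_matrix_full_algebra by blast
  obtain w where w: "\<And>i j. i < k \<Longrightarrow> j < k \<Longrightarrow> Q i j = (\<Sum>l<k. star (w l i) * w l j)"
    using assms(2) unfolding positive_matrix_full_algebra by blast
  obtain M1 where M1: "M1 \<ge> 0" "\<And>\<xi>. pos (M1 *\<^sub>R vip k \<xi> \<xi> - vip k (mapply k z \<xi>) (mapply k z \<xi>))"
    using vip_mapply_bound[of k z] by blast
  obtain M2 where M2: "M2 \<ge> 0" "\<And>\<xi>. pos (M2 *\<^sub>R vip k \<xi> \<xi> - vip k (mapply k w \<xi>) (mapply k w \<xi>))"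
    using vip_mapply_bound[of k w] by blast
  define M where "M = M1 + M2 + 1"
  have M: "M > 0" using M1(1) M2(1) by (simp add: M_def)
  define V where "V i j = P i j + Q i j" for i j
  define x where "x i j = (if i = j then 1 else 0) - (1 / M) *\<^sub>R V i j" for i j
  have sa: "star (x i j) = x j i" if "i < k" "j < k" for i j
    using that by (auto simp: x_def V_def z w star_diff star_scaleR star_add star_sum star_mult star_star)
  have pv: "pos (vip k \<xi> \<xi>)" for \<xi> :: "nat \<Rightarrow> 'a" unfolding vip_def by (intro pos_sum pos_star_mult)
  have xV: "vip k \<xi> (mapply k x \<xi>) = vip k \<xi> \<xi> - (1 / M) *\<^sub>R (vip k (mapply k z \<xi>) (mapply k z \<xi>) + vip k (mapply k w \<xi>) (mapply k w \<xi>))" for \<xi>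
  proof -
    have "mapply k x \<xi> i = \<xi> i - (1 / M) *\<^sub>R (mapply k P \<xi> i + mapply k Q \<xi> i)" if "i < k" for i
    proof -
      have "mapply k x \<xi> i = (\<Sum>j<k. (if i = j then 1 else 0) * \<xi> j) - (\<Sum>j<k. (1 / M) *\<^sub>R (V i j * \<xi> j))"
        by (simp add: mapply_def x_def left_diff_distrib sum_subtractf)
      then show ?thesis
        using that by (simp add: delta_sum mapply_def V_def distrib_right sum.distrib scaleR_add_right
            scaleR_sum_right)
    qed
    then have "vip k \<xi> (mapply k x \<xi>) = vip k \<xi> \<xi> - (1 / M) *\<^sub>R (vip k \<xi> (mapply k P \<xi>) + vip k \<xi> (mapply k Q \<xi>))"
      by (simp add: vip_def right_diff_distrib distrib_left sum.distrib sum_subtractf scaleR_add_right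
          scaleR_sum_right)
    then show ?thesis using vip_gram[of k P z \<xi>] vip_gram[of k Q w \<xi>] z w by simp
  qed
  have p1: "pos (vip k \<xi> (mapply k x \<xi>))" for \<xi>
  proof -
    have "pos ((1 / M) *\<^sub>R (vip k \<xi> \<xi> + ((M1 *\<^sub>R vip k \<xi> \<xi> - vip k (mapply k z \<xi>) (mapply k z \<xi>))
        + (M2 *\<^sub>R vip k \<xi> \<xi> - vip k (mapply k w \<xi>) (mapply k w \<xi>)))))"
      using M by (intro pos_scaleR pos_add pv M1 M2) simp
    also have "vip k \<xi> \<xi> + ((M1 *\<^sub>R vip k \<xi> \<xi> - vip k (mapply k z \<xi>) (mapply k z \<xi>))
        + (M2 *\<^sub>R vip k \<xi> \<xi> - vip k (mapply k w \<xi>) (mapply k w \<xi>)))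
      = M *\<^sub>R vip k \<xi> \<xi> - (vip k (mapply k z \<xi>) (mapply k z \<xi>) + vip k (mapply k w \<xi>) (mapply k w \<xi>))"
      by (simp add: M_def algebra_simps)
    finally show ?thesis using M by (simp add: xV scaleR_diff_right)
  qed
  have p2: "pos (vip k \<xi> \<xi> - vip k \<xi> (mapply k x \<xi>))" for \<xi>
    unfolding xV using M by (simp add: pos_scaleR pos_add pv)
  have "\<exists>y. \<forall>i<k. \<forall>j<k. star (y i j) = y j i \<and>
      (\<Sum>l<k. y i l * y l j) = (if i = j then 1 else 0) - x i j"
  proof (rule matrix_sqrt)
    show "star (x i j) = x j i" if "i < k" "j < k" for i j by (rule sa[OF that])
    show "norm (mpow k x m i j) \<le> 1" if "i < k" "j < k" for i j m
      by (rule norm_mpow_le_1) (use sa p1 p2 that in simp_all)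
  qed
  then obtain y where "\<forall>i<k. \<forall>j<k. star (y i j) = y j i \<and>
      (\<Sum>l<k. y i l * y l j) = (if i = j then 1 else 0) - x i j" ..
  then have y: "star (y i j) = y j i" "(\<Sum>l<k. y i l * y l j) = (if i = j then 1 else 0) - x i j"
    if "i < k" "j < k" for i j using that by blast+
  have "V i j = (\<Sum>l<k. star (sqrt M *\<^sub>R y l i) * (sqrt M *\<^sub>R y l j))" if ij: "i < k" "j < k" for i j
  proof -
    have "(\<Sum>l<k. star (sqrt M *\<^sub>R y l i) * (sqrt M *\<^sub>R y l j)) = M *\<^sub>R (\<Sum>l<k. y i l * y l j)"
      using M ij by (simp add: star_scaleR y(1) scaleR_sum_right)
    also have "\<dots> = V i j" using M by (simp add: y(2)[OF ij] x_def)
    finally show ?thesis by simp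
  qed
  then show ?thesis
    unfolding positive_matrix_full_algebra V_def[symmetric]
    by (intro exI[of _ "\<lambda>l i. sqrt M *\<^sub>R y l i"] allI impI)
qed

lemma positive_matrix_sum:
  fixes P :: "'c \<Rightarrow> nat \<Rightarrow> nat \<Rightarrow> 'a::cstar_algebra"
  assumes "\<And>c. c \<in> I \<Longrightarrow> positive_matrix full_algebra k (P c)"
  shows "positive_matrix full_algebra k (\<lambda>i j. \<Sum>c\<in>I. P c i j)"
proof -
  have z: "positive_matrix full_algebra k (\<lambda>i j. 0 :: 'a)"
    unfolding positive_matrix_full_algebra by (intro exI[of _ "\<lambda>_ _. 0"]) simp
  show ?thesis using assms
    by (induction I rule: infinite_finite_induct) (simp_all add: z positive_matrix_add)
qed

section \<open>An approximate unit\<close>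

text \<open>Take \<open>h = \<Sum>\<^sub>j \<gamma>\<^sub>j b\<^sub>j b\<^sub>j\<^sup>*\<close> with summable weights. For \<open>r = (1 - h)\<^sup>N\<close>, the element \<open>\<gamma>\<^sub>j r b\<^sub>j b\<^sub>j\<^sup>* r\<close> is dominated by
  \<open>r h r\<close>, whose norm is at most \<open>1 / N\<close> by \<open>norm_power_one_minus_mult\<close>. The last clause expresses that \<open>h\<close> belongs
  to the closed span of the elements \<open>b\<^sub>j b\<^sub>j\<^sup>*\<close>.\<close>

lemma approximate_unit_sequence:
  fixes b :: "nat \<Rightarrow> 'a::cstar_algebra"
  obtains h where "pos h" "norm h \<le> 1" "\<And>j. (\<lambda>N. (1 - h) ^ N * b j) \<longlonglongrightarrow> 0"
    "\<forall>f :: 'a \<Rightarrow> complex. bounded_linear f \<longrightarrow> (\<forall>j. f (b j * star (b j)) = 0) \<longrightarrow> f h = 0"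
proof
  define \<gamma> where "\<gamma> j = (1/2) ^ Suc j / (1 + (norm (b j))\<^sup>2)" for j
  have \<gamma>0: "\<gamma> j > 0" for j unfolding \<gamma>_def by (intro divide_pos_pos) (simp_all add: add_pos_nonneg)
  define t where "t j = \<gamma> j *\<^sub>R (b j * star (b j))" for j
  have nt: "norm (t j) \<le> (1/2) ^ Suc j" for j
  proof -
    have "(norm (b j))\<^sup>2 / (1 + (norm (b j))\<^sup>2) \<le> 1" by (simp add: divide_le_eq_1 add_pos_nonneg)
    then have "(1/2) ^ Suc j * ((norm (b j))\<^sup>2 / (1 + (norm (b j))\<^sup>2)) \<le> (1/2) ^ Suc j * 1"
      by (intro mult_left_mono) auto
    then show ?thesis using \<gamma>0[of j] by (simp add: t_def norm_mult_star \<gamma>_def)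
  qed
  have half: "(\<lambda>j. (1/2::real) ^ Suc j) sums 1" by (rule power_half_series)
  have snorm: "summable (\<lambda>j. norm (t j))"
    by (rule summable_comparison_test'[OF sums_summable[OF half]]) (use nt in simp)
  have st: "summable t" by (rule summable_norm_cancel[OF snorm])
  define h where "h = suminf t"
  have pt: "pos (t j)" for j
    unfolding t_def using pos_star_mult[of "star (b j)"] \<gamma>0[of j] by (intro pos_scaleR) (auto simp: star_star)
  have psums: "pos s" if "f sums s" "\<And>j. pos (f j)" for f and s :: 'a
    by (rule pos_limit[OF _ that(1)[unfolded sums_def]]) (intro pos_sum that(2))
  show ph: "pos h" unfolding h_def by (rule psums[OF summable_sums[OF st] pt])
  have "norm h \<le> (\<Sum>j. norm (t j))" unfolding h_def by (rule summable_norm[OF snorm])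
  also have "\<dots> \<le> (\<Sum>j. (1/2) ^ Suc j)" by (rule suminf_le[OF nt snorm sums_summable[OF half]])
  finally show h1: "norm h \<le> 1" using sums_unique[OF half] by simp
  have sh: "star h = h" by (rule pos_selfadjoint[OF ph])
  show "\<forall>f :: 'a \<Rightarrow> complex. bounded_linear f \<longrightarrow> (\<forall>j. f (b j * star (b j)) = 0) \<longrightarrow> f h = 0"
  proof (intro allI impI)
    fix f :: "'a \<Rightarrow> complex" assume f: "bounded_linear f" "\<forall>j. f (b j * star (b j)) = 0"
    interpret bounded_linear f by (rule f(1))
    show "f h = 0" unfolding h_def suminf[OF st] using f(2) by (simp add: t_def scaleR)
  qed
  fix j
  have below: "pos (h - t j)"
  proof -
    have "(\<lambda>i. t i - (if i = j then t j else 0)) sums (h - t j)"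
      unfolding h_def by (intro sums_diff summable_sums st sums_single[where f = t, of j, simplified]) (simp add: sums_If_finite_set[of "{j}" "\<lambda>_. t j", simplified])
    then show ?thesis by (rule psums) (simp add: pt)
  qed
  have bound: "(norm ((1 - h) ^ N * b j))\<^sup>2 \<le> (1 / \<gamma> j) * (1 / real N)" if N: "N > 0" for N
  proof -
    let ?r = "(1 - h) ^ N"
    have sr: "star ?r = ?r" by (simp add: star_power star_diff sh)
    have hr: "h * ?r = ?r * h" by (rule power_commuting_commutes[symmetric]) (simp add: algebra_simps)
    have "pos (star ?r * (h - t j) * ?r)" by (rule pos_conj[OF below])
    then have "pos (?r * h * ?r - ?r * t j * ?r)" by (simp add: sr algebra_simps)
    moreover have "pos (?r * t j * ?r)" using pos_conj[OF pt[of j], of ?r] by (simp add: sr)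
    ultimately have "norm (?r * t j * ?r) \<le> norm (?r * h * ?r)" by (intro pos_mono_norm)
    also have "?r * h * ?r = (1 - h) ^ (2 * N) * h" by (simp add: mult.assoc hr power_add mult_2)
    also have "norm ((1 - h) ^ (2 * N) * h) \<le> 1 / real N"
    proof -
      have "real N * norm ((1 - h) ^ (2 * N) * h) \<le> real (2 * N) * norm ((1 - h) ^ (2 * N) * h)"
        by (intro mult_right_mono) auto
      then have "real N * norm ((1 - h) ^ (2 * N) * h) \<le> 1"
        using norm_power_one_minus_mult[OF ph h1, of "2 * N"] by linarith
      then show ?thesis using N by (simp add: field_simps)
    qed
    finally have "norm (?r * t j * ?r) \<le> 1 / real N" .
    moreover have "?r * t j * ?r = \<gamma> j *\<^sub>R ((?r * b j) * star (?r * b j))"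
      by (simp add: t_def star_mult sr mult.assoc)
    ultimately have "\<gamma> j * (norm (?r * b j))\<^sup>2 \<le> 1 / real N"
      using \<gamma>0[of j] by (simp add: norm_mult_star)
    then have "(1 / \<gamma> j) * (\<gamma> j * (norm (?r * b j))\<^sup>2) \<le> (1 / \<gamma> j) * (1 / real N)"
      using \<gamma>0[of j] by (intro mult_left_mono) auto
    then show ?thesis using \<gamma>0[of j] by simp
  qed
  have "(\<lambda>N. (norm ((1 - h) ^ N * b j))\<^sup>2) \<longlonglongrightarrow> 0"
  proof (rule Lim_null_comparison)
    show "(\<lambda>N. (1 / \<gamma> j) * (1 / real N)) \<longlonglongrightarrow> 0"
      using tendsto_mult_right_zero[OF lim_1_over_n] by blast
    show "eventually (\<lambda>N. norm ((norm ((1 - h) ^ N * b j))\<^sup>2) \<le> (1 / \<gamma> j) * (1 / real N)) sequentially"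
      using eventually_gt_at_top[of 0]
    proof (rule eventually_mono)
      fix N :: nat assume "N > 0"
      then show "norm ((norm ((1 - h) ^ N * b j))\<^sup>2) \<le> (1 / \<gamma> j) * (1 / real N)"
        using bound[of N] by (simp only: real_norm_def abs_of_nonneg[OF zero_le_power2])
    qed
  qed
  then have "(\<lambda>N. sqrt ((norm ((1 - h) ^ N * b j))\<^sup>2)) \<longlonglongrightarrow> sqrt 0" by (rule tendsto_real_sqrt)
  then show "(\<lambda>N. (1 - h) ^ N * b j) \<longlonglongrightarrow> 0" by (simp add: tendsto_norm_zero_iff)
qed

section \<open>Korovkin rigidity forces unique extensions\<close>

text \<open>Used with \<open>g = 1 - (1 - c)\<^sup>1\<^sup>/\<^sup>2\<close>: whatever almost commutes with \<open>c\<close> almost commutes with the square root. For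
  \<open>k = g v - v g\<close> one has \<open>c v - v c = 2 k - g k - k g\<close>, and the last two terms together are at most \<open>q k\<close>.\<close>

lemma (in cstar_seminorm) commutator_bound:
  assumes g: "q g \<le> 1/2" and c: "c = 2 *\<^sub>R g - g * g"
  shows "q (g * v - v * g) \<le> q (c * v - v * c)"
proof -
  define k where "k = g * v - v * g"
  have "2 *\<^sub>R k = (c * v - v * c) + (g * k + k * g)"
    by (simp add: k_def c algebra_simps scaleR_2)
  then have "q (2 *\<^sub>R k) \<le> q (c * v - v * c) + q (g * k + k * g)" using q_add by metis
  moreover have "q (g * k + k * g) \<le> q g * q k + q k * q g"
    using q_add[of "g * k" "k * g"] q_mult[of g k] q_mult[of k g] by linarith
  moreover have "q g * q k \<le> (1/2) * q k" using g q_nonneg by (intro mult_right_mono) auto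
  ultimately show ?thesis by (simp add: q_scaleR k_def mult.commute)
qed

text \<open>A sequence as a net indexed by a countable subset of \<open>'i\<close>.\<close>

lemma directed_range_nat:
  fixes \<iota> :: "nat \<Rightarrow> 'i"
  assumes inj: "inj \<iota>"
  defines "r \<equiv> {(\<iota> m, \<iota> k) | m k. m \<le> k}"
  shows "directed_on (range \<iota>) r"
    "eventually P (net_filter (range \<iota>) r) \<longleftrightarrow> eventually (\<lambda>k. P (\<iota> k)) sequentially"
proof -
  have r: "(\<iota> m, \<iota> k) \<in> r \<longleftrightarrow> m \<le> k" for m k using inj by (auto simp: r_def inj_eq)
  show dir: "directed_on (range \<iota>) r"
    unfolding directed_on_def preorder_on_def
  proof (intro conjI ballI)
    show "refl_on (range \<iota>) r" by (auto simp: refl_on_def r)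
    show "r \<subseteq> range \<iota> \<times> range \<iota>" by (auto simp: r_def)
    show "trans r" unfolding trans_def r_def using inj by (auto simp: inj_eq)
    fix d e assume "d \<in> range \<iota>" "e \<in> range \<iota>"
    then obtain m k where mk: "d = \<iota> m" "e = \<iota> k" by blast
    show "\<exists>f\<in>range \<iota>. (d, f) \<in> r \<and> (e, f) \<in> r"
      by (rule bexI[of _ "\<iota> (max m k)"]) (simp_all add: mk r)
  qed simp
  show "eventually P (net_filter (range \<iota>) r) \<longleftrightarrow> eventually (\<lambda>k. P (\<iota> k)) sequentially"
    unfolding eventually_net_filter[OF dir] eventually_sequentially by (auto simp: r)
qed

text \<open>For the last clause, the factorisation of \<open>\<psi> (X i j)\<close> over \<open>B(L)\<close> is read off in matrix entries.\<close>

lemma ucp_matrix_of: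
  fixes \<psi> :: "'a::cstar_algebra \<Rightarrow> 'h::chilbert_space \<Rightarrow>\<^sub>L 'h"
  assumes on: "orthonormal n e" and ucp: "ucp (bounded_operators (cspan (e ` {..<n}))) \<psi>"
  defines "f \<equiv> \<lambda>x. matrix_of e (\<psi> x)"
  shows "f (x + y) i j = f x i j + f y i j" "f (c *\<^sub>C x) i j = c * f x i j"
    "i < n \<Longrightarrow> j < n \<Longrightarrow> f 1 i j = (if i = j then 1 else 0)"
    "op_of n e (f x) = \<psi> x"
    "positive_matrix full_algebra k X \<Longrightarrow> \<exists>W. \<forall>i<k. \<forall>j<k. \<forall>a<n. \<forall>b<n.
       f (X i j) a b = (\<Sum>l<k. \<Sum>c<n. cnj (W l i c a) * W l j c b)"
proof -
  let ?L = "cspan (e ` {..<n})"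
  have lin: "clinear \<psi>" and ran: "\<And>x. \<psi> x \<in> carrier (bounded_operators ?L)"
    and unit: "\<And>T. T \<in> carrier (bounded_operators ?L) \<Longrightarrow> product (bounded_operators ?L) (\<psi> 1) T = T"
    using ucp by (auto simp: ucp_def completely_positive_def)
  show "f (x + y) i j = f x i j + f y i j"
    by (simp add: f_def matrix_of_def clinearD[OF lin] blinfun.add_left cinner_add_right)
  show "f (c *\<^sub>C x) i j = c * f x i j"
    by (simp add: f_def matrix_of_def clinearD[OF lin] scaleC_blinfun_apply cinner_scaleC_right)
  show op: "op_of n e (f x) = \<psi> x" for x unfolding f_def by (rule op_of_matrix_of[OF on ran])
  show "f 1 i j = (if i = j then 1 else 0)" if ij: "i < n" "j < n"
  proof -
    let ?I = "op_of n e (\<lambda>i j. if i = j then 1 else 0)"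
    have Ij: "blinfun_apply ?I (e j) = e j"
      by (rule op_of_identity[OF on]) (use ij in \<open>simp_all add: complex_vector.span_base\<close>)
    have I1: "\<psi> 1 o\<^sub>L ?I = ?I" using unit[OF op_of_carrier[OF on]] by (simp add: bounded_operators_def)
    have "blinfun_apply (\<psi> 1) (e j) = blinfun_apply (\<psi> 1 o\<^sub>L ?I) (e j)" by (simp add: Ij)
    then have "blinfun_apply (\<psi> 1) (e j) = e j" by (simp only: I1 Ij)
    then show ?thesis using on ij by (simp add: f_def matrix_of_def orthonormal_def)
  qed
  assume X: "positive_matrix full_algebra k X"
  then have "positive_matrix (bounded_operators ?L) k (\<lambda>i j. \<psi> (X i j))"
    using ucp by (simp add: ucp_def completely_positive_def)
  then obtain z where z: "\<forall>i<k. \<forall>j<k. z i j \<in> carrier (bounded_operators ?L)"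
    and z': "\<forall>i<k. \<forall>j<k. \<psi> (X i j) = (\<Sum>l<k. adjoint_op (z l i) o\<^sub>L z l j)"
    by (auto simp: positive_matrix_def bounded_operators_def)
  have "f (X i j) a b = (\<Sum>l<k. \<Sum>c<n. cnj (matrix_of e (z l i) c a) * matrix_of e (z l j) c b)"
    if ij: "i < k" "j < k" "a < n" "b < n" for i j a b
  proof -
    have "\<psi> (X i j) = (\<Sum>l<k. adjoint_op (z l i) o\<^sub>L z l j)" using z' ij by blast
    also have "\<dots> = (\<Sum>l<k. op_of n e (\<lambda>a b. \<Sum>c<n. cnj (matrix_of e (z l i) c a) * matrix_of e (z l j) c b))"
    proof (rule sum.cong[OF refl])
      fix l assume "l \<in> {..<k}"
      then have "z l i = op_of n e (matrix_of e (z l i))" "z l j = op_of n e (matrix_of e (z l j))"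
        using op_of_matrix_of[OF on] z ij by simp_all
      then show "adjoint_op (z l i) o\<^sub>L z l j
          = op_of n e (\<lambda>a b. \<Sum>c<n. cnj (matrix_of e (z l i) c a) * matrix_of e (z l j) c b)"
        using op_of_adjoint[OF on, of "matrix_of e (z l i)"]
          op_of_mult[OF on, of "\<lambda>a c. cnj (matrix_of e (z l i) c a)" "matrix_of e (z l j)"] by simp
    qed
    also have "\<dots> = op_of n e (\<lambda>a b. \<Sum>l<k. \<Sum>c<n. cnj (matrix_of e (z l i) c a) * matrix_of e (z l j) c b)"
      by (rule op_of_sum[symmetric])
    finally show ?thesis using ij by (simp add: f_def matrix_of_op_of[OF on])
  qed
  then show "\<exists>W. \<forall>i<k. \<forall>j<k. \<forall>a<n. \<forall>b<n. f (X i j) a b = (\<Sum>l<k. \<Sum>c<n. cnj (W l i c a) * W l j c b)"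
    by (intro exI[of _ "\<lambda>l i. matrix_of e (z l i)"]) simp
qed

text \<open>The elements \<open>T k x\<close> below lie in the kernel of \<open>\<pi>\<close>, and \<open>\<Psi> N v - c N v = \<lambda> \<Sum>\<^sub>a (r m\<^sub>a)\<^sup>* (r T a v)\<close> for \<open>v \<in> S\<close>,
  which tends to \<open>0\<close>. The same holds for \<open>\<Psi> N v - v c N\<close>, by taking adjoints, and so \<open>c N\<close> asymptotically commutes
  with \<open>v\<close>. It is for the formula with \<open>T a v\<close> that the \<open>m a\<close> lift a single row of matrix units.\<close>

theorem unique_extension_of_strong_korovkin:
  fixes \<pi> :: "'a::cstar_algebra \<Rightarrow> 'h::chilbert_space \<Rightarrow>\<^sub>L 'h" and s :: "nat \<Rightarrow> 'a"
  assumes dense: "closure (range s) = UNIV" and inf: "infinite (UNIV :: 'i set)"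
    and S: "operator_system S" and SK: "strong_korovkin TYPE('i) full_algebra S (id :: 'a \<Rightarrow> 'a)"
    and irr: "irreducible_representation L \<pi>" and dim: "has_cdim L n"
  shows "unique_extension_property S L \<pi>"
  unfolding unique_extension_property_def
proof (intro allI impI, elim conjE)
  fix \<psi> :: "'a \<Rightarrow> 'h \<Rightarrow>\<^sub>L 'h"
  assume ucp\<psi>: "ucp (bounded_operators L) \<psi>" and \<psi>S: "\<forall>v\<in>S. \<psi> v = \<pi> v"
  obtain e where on: "orthonormal n e" and eL: "cspan (e ` {..<n}) = L"
    by (rule has_cdim_orthonormal_basis[OF dim])
  have rep: "unital_representation (cspan (e ` {..<n})) \<pi>"
    using irr eL by (simp add: irreducible_representation_def)
  have n0: "0 < n"
  proof (rule ccontr)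
    assume "\<not> 0 < n"
    then have "L = {0}" using eL by simp
    then show False using irr by (simp add: irreducible_representation_def)
  qed
  define p where "p x = matrix_of e (\<pi> x)" for x
  have prep: "matrix_representation n p" unfolding p_def[abs_def] by (rule matrix_representation_matrix_of[OF on rep])
  have padd: "p (x + y) i j = p x i j + p y i j" and pscale: "p (c *\<^sub>C x) i j = c * p x i j"
    and pmult: "p (x * y) i j = (\<Sum>k<n. p x i k * p y k j)" and pstar: "p (star x) i j = cnj (p x j i)"
    and pone: "p 1 i j = (if i = j then 1 else 0)" if "i < n" "j < n" for x y c i j
    using prep that unfolding matrix_representation_def by blast+
  have pdiff: "p (x - y) i j = p x i j - p y i j" if "i < n" "j < n" for x y i j
    using padd[OF that, of "x - y" y] by simp
  have pscaleR: "p (c *\<^sub>R x) i j = of_real c * p x i j" if "i < n" "j < n" for c x i j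
    unfolding scaleR_scaleC by (rule pscale[OF that])
  have psum: "p (\<Sum>l\<in>I. g l) i j = (\<Sum>l\<in>I. p (g l) i j)" if "i < n" "j < n" for i j I and g :: "nat \<Rightarrow> 'a"
    by (induction I rule: infinite_finite_induct)
      (use pscale[OF that, of 0 0] in \<open>auto simp: padd that\<close>)
  have ple: "cmod (p x i j) \<le> norm x" if "i < n" "j < n" for x i j
    unfolding p_def using cmod_matrix_of_le[OF on that, of "\<pi> x"] representation_contractive[OF rep, of x] by linarith
  define f where "f x = matrix_of e (\<psi> x)" for x
  have ucpe: "ucp (bounded_operators (cspan (e ` {..<n}))) \<psi>" using ucp\<psi> eL by simp
  note f = ucp_matrix_of[OF on ucpe, folded f_def]
  have fS: "f v = p v" if "v \<in> S" for v using \<psi>S that by (simp add: f_def p_def)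
  have "\<exists>a. \<forall>i<n. \<forall>j<n. p a i j = (if i = 0 \<and> j = k then 1 else 0)" for k
    using irreducible_matrix_surj[OF irr eL[symmetric] on, of "\<lambda>i j. if i = 0 \<and> j = k then 1 else 0"]
    unfolding p_def by metis
  then obtain m where m: "\<And>k i j. i < n \<Longrightarrow> j < n \<Longrightarrow> p (m k) i j = (if i = 0 \<and> j = k then 1 else 0)"
    by metis
  \<comment> \<open>elements of the kernel of \<open>\<pi>\<close> that measure the failure of \<open>m k\<close> to be a row of matrix units\<close>
  define T where "T k x = (\<Sum>l<n. p x k l *\<^sub>C m l) - m k * x" for k x
  have pT: "p (T k x) i j = 0" if "k < n" "i < n" "j < n" for k x i j
  proof -
    have "(\<Sum>l<n. p x k l * p (m l) i j) = (\<Sum>l<n. if l = j then (if i = 0 then p x k j else 0) else 0)"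
      using that by (intro sum.cong) (auto simp: m)
    moreover have "(\<Sum>l<n. p (m k) i l * p x l j) = (\<Sum>l<n. if l = k then (if i = 0 then p x k j else 0) else 0)"
      using that by (intro sum.cong) (auto simp: m)
    ultimately show ?thesis using that by (simp add: T_def pdiff psum pscale pmult)
  qed
  have Tdiff: "T k (x - y) = T k x - T k y" if "k < n" for k x y
    using that by (simp add: T_def pdiff complex_vector.scale_left_diff_distrib sum_subtractf right_diff_distrib)
  define C where "C k = (\<Sum>l<n. norm (m l)) + norm (m k)" for k
  have C0: "C k \<ge> 0" for k unfolding C_def by (intro add_nonneg_nonneg sum_nonneg) auto
  have Tle: "norm (T k x) \<le> C k * norm x" if "k < n" for k x
  proof -
    have "norm (\<Sum>l<n. p x k l *\<^sub>C m l) \<le> (\<Sum>l<n. norm x * norm (m l))"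
      by (rule order_trans[OF norm_sum sum_mono]) (use ple that in \<open>simp add: norm_scaleC mult_right_mono\<close>)
    also have "\<dots> = (\<Sum>l<n. norm (m l)) * norm x" by (simp add: sum_distrib_left mult.commute)
    finally show ?thesis
      using norm_triangle_ineq4[of "\<Sum>l<n. p x k l *\<^sub>C m l" "m k * x"] norm_mult_ineq[of "m k" x]
      by (simp add: T_def C_def distrib_right)
  qed
  define b where "b j = (case prod_decode j of (k, i) \<Rightarrow> if k < n then T k (s i) else 0)" for j
  obtain h where h: "pos h" "norm h \<le> 1" "\<And>j. (\<lambda>N. (1 - h) ^ N * b j) \<longlonglongrightarrow> 0"
    and hker: "\<forall>f :: 'a \<Rightarrow> complex. bounded_linear f \<longrightarrow> (\<forall>j. f (b j * star (b j)) = 0) \<longrightarrow> f h = 0"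
    by (rule approximate_unit_sequence[of b]) (rule that, assumption+)
  have ph: "p h i j = 0" if ij: "i < n" "j < n" for i j
  proof (rule hker[rule_format])
    show "bounded_linear (\<lambda>x. p x i j)"
      by (rule bounded_linear_intro[where K = 1])
        (use ij ple in \<open>auto simp: padd pscaleR scaleR_conv_of_real[where 'a = complex]\<close>)
    have "p (b l) i k = 0" if "k < n" for l k
    proof (cases "prod_decode l")
      case (Pair k' i')
      then show ?thesis using pT[of k' i k "s i'"] that ij pscale[of i k 0 0] by (auto simp: b_def)
    qed
    then show "p (b l * star (b l)) i j = 0" for l using ij by (simp add: pmult)
  qed
  define r where "r N = (1 - h) ^ N" for N
  have sr: "star (r N) = r N" for N by (simp add: r_def star_power star_diff pos_selfadjoint[OF h(1)])
  have nr: "norm (r N) \<le> 1" for N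
  proof -
    have "norm (1 - h) \<le> 1" by (rule pos_norm_one_minus[OF h(1,2)])
    then show ?thesis unfolding r_def using norm_power_ineq[of "1 - h" N] power_le_one[of "norm (1 - h)" N] by simp
  qed
  have pr: "p (r N) i j = (if i = j then 1 else 0)" if "i < n" "j < n" for N i j
    using that
  proof (induction N arbitrary: i j)
    case (Suc N)
    have "p (r (Suc N)) i j = (\<Sum>k<n. (if i = k then 1 else 0) * p (r N) k j)"
      using Suc.prems by (simp add: r_def pmult) (intro sum.cong, auto simp: pdiff pone ph)
    then show ?case using Suc by (simp add: delta_sum)
  qed (simp add: r_def pone)
  have rT: "(\<lambda>N. r N * T k x) \<longlonglongrightarrow> 0" if k: "k < n" for k x
    unfolding LIMSEQ_iff
  proof (intro allI impI)
    fix \<epsilon> :: real assume \<epsilon>: "\<epsilon> > 0"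
    then have "\<epsilon> / (2 * (C k + 1)) > 0" using C0[of k] by simp
    then obtain i where i: "norm (x - s i) < \<epsilon> / (2 * (C k + 1))"
      using dense closure_approachable[of x "range s"] by (auto simp: dist_norm norm_minus_commute)
    have "b (prod_encode (k, i)) = T k (s i)" using k by (simp add: b_def)
    then have "(\<lambda>N. r N * T k (s i)) \<longlonglongrightarrow> 0" using h(3)[of "prod_encode (k, i)"] by (simp add: r_def)
    then obtain N0 where N0: "\<And>N. N \<ge> N0 \<Longrightarrow> norm (r N * T k (s i)) < \<epsilon> / 2"
      using \<epsilon> unfolding LIMSEQ_iff by (metis diff_zero half_gt_zero)
    have "norm (r N * T k x) < \<epsilon>" if "N \<ge> N0" for N
    proof -
      have "norm (r N * T k (x - s i)) \<le> 1 * (C k * norm (x - s i))"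
        by (rule order_trans[OF norm_mult_ineq]) (intro mult_mono nr Tle k, auto)
      also have "C k * norm (x - s i) \<le> (C k + 1) * norm (x - s i)" by (simp add: distrib_right)
      also have "\<dots> < (C k + 1) * (\<epsilon> / (2 * (C k + 1)))"
        using i C0[of k] by (intro mult_strict_left_mono) auto
      also have "\<dots> = \<epsilon> / 2"
      proof -
        have cancel: "z * (\<epsilon> / (2 * z)) = \<epsilon> / 2" if "z \<noteq> 0" for z :: real using that by simp
        show ?thesis by (rule cancel) (use C0[of k] in linarith)
      qed
      finally have "norm (r N * T k (x - s i)) < \<epsilon> / 2" by simp
      moreover have "norm (r N * T k x) = norm (r N * T k (s i) + r N * T k (x - s i))"
        by (simp add: Tdiff[OF k] right_diff_distrib)
      ultimately show ?thesis
        using N0[OF that] norm_triangle_ineq[of "r N * T k (s i)" "r N * T k (x - s i)"] by linarith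
    qed
    then show "\<exists>N0. \<forall>N\<ge>N0. norm (r N * T k x - 0) < \<epsilon>" by auto
  qed
  \<comment> \<open>The constant makes the norm of \<open>c N\<close> at most \<open>1/2\<close>, as required for the square root and for \<open>commutator_bound\<close>.\<close>
  define lam where "lam = 1 / (2 * (1 + (\<Sum>a<n. (norm (m a))\<^sup>2)))"
  have sum0: "(\<Sum>a<n. (norm (m a))\<^sup>2) \<ge> 0" by (rule sum_nonneg) simp
  then have lam0: "lam > 0" by (simp add: lam_def)
  define y where "y N a = r N * m a" for N a
  have ny: "norm (y N a) \<le> norm (m a)" for N a
    unfolding y_def by (rule order_trans[OF norm_mult_ineq]) (use nr[of N] in \<open>simp add: mult_left_le_one_le\<close>)
  have py: "p (y N a) i j = (if i = 0 \<and> j = a then 1 else 0)" if "i < n" "j < n" for N a i j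
  proof -
    have "p (y N a) i j = (\<Sum>k<n. (if i = k then 1 else 0) * p (m a) k j)"
      unfolding y_def pmult[OF that] using that by (intro sum.cong) (simp_all add: pr)
    then show ?thesis using that by (simp add: delta_sum m)
  qed
  have pyy: "p (star (y N a) * y N c) i j = (if i = a \<and> j = c then 1 else 0)" if "i < n" "j < n" for N a c i j
  proof -
    have "p (star (y N a) * y N c) i j = (\<Sum>k<n. (if k = 0 then (if i = a \<and> j = c then 1 else 0) else 0))"
      unfolding pmult[OF that] using that by (intro sum.cong) (auto simp: pstar py)
    then show ?thesis using n0 by simp
  qed
  define c where "c N = lam *\<^sub>R (\<Sum>a<n. star (y N a) * y N a)" for N
  define \<Psi> where "\<Psi> N x = lam *\<^sub>R (\<Sum>a<n. \<Sum>d<n. f x a d *\<^sub>C (star (y N a) * y N d))" for N x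
  have sc: "star (c N) = c N" for N by (simp add: c_def star_scaleR star_sum star_mult star_star)
  have nc: "norm (c N) \<le> 1/2" for N
  proof -
    have "norm (\<Sum>a<n. star (y N a) * y N a) \<le> (\<Sum>a<n. (norm (m a))\<^sup>2)"
      by (rule order_trans[OF norm_sum sum_mono]) (simp add: norm_star_mult power_mono ny)
    then have "norm (c N) \<le> lam * (1 + (\<Sum>a<n. (norm (m a))\<^sup>2))"
      unfolding c_def using lam0 by (simp add: mult_left_mono)
    moreover have "lam * (1 + (\<Sum>a<n. (norm (m a))\<^sup>2)) = 1/2"
    proof -
      have cancel: "1 / (2 * z) * z = 1/2" if "z \<noteq> 0" for z :: real using that by simp
      show ?thesis unfolding lam_def by (rule cancel) (use sum0 in linarith)
    qed
    ultimately show ?thesis by simp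
  qed
  have nc1: "norm (c N) \<le> 1" for N using nc[of N] by linarith
  define w where "w N = sqrt_one_minus (c N)" for N
  have w: "star (w N) = w N" "w N * w N = 1 - c N" "norm (1 - w N) \<le> 1/2" for N
    using star_sqrt_one_minus[OF nc1, of N] sqrt_one_minus_square[OF nc1, of N]
      norm_one_minus_sqrt_le[OF nc1, of N] nc[of N] by (simp_all add: w_def sc)
  define \<phi> where "\<phi> N x = w N * x * w N + \<Psi> N x" for N x
  have \<Psi>one: "\<Psi> N 1 = c N" for N
  proof -
    have "(\<Sum>d<n. f 1 a d *\<^sub>C (star (y N a) * y N d)) = star (y N a) * y N a" if "a < n" for a
    proof -
      have "(\<Sum>d<n. f 1 a d *\<^sub>C (star (y N a) * y N d)) = (\<Sum>d<n. if d = a then star (y N a) * y N a else 0)"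
        using that by (intro sum.cong) (auto simp: f(3) scaleC_one)
      then show ?thesis using that by simp
    qed
    then show ?thesis by (simp add: \<Psi>_def c_def)
  qed
  have fa: "full_algebra\<lparr>carrier := range (id :: 'a \<Rightarrow> 'a)\<rparr> = full_algebra" by (simp add: full_algebra_def)
  have ucp\<phi>: "ucp (full_algebra\<lparr>carrier := range (id :: 'a \<Rightarrow> 'a)\<rparr>) (\<phi> N)" for N
    unfolding ucp_def completely_positive_def fa
  proof (intro conjI allI impI ballI)
    show "clinear (\<phi> N)"
      unfolding clinear_iff
      by (simp add: \<phi>_def \<Psi>_def f(1,2) distrib_left distrib_right mult_scaleC_left mult_scaleC_right
          scaleC_add_left scaleC_add_right sum.distrib scaleR_add_right complex_vector.scale_sum_right
          scaleC_scaleC scaleR_scaleC mult.left_commute)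
    show "range (\<phi> N) \<subseteq> carrier full_algebra" by (simp add: full_algebra_def)
    have "\<phi> N 1 = 1" by (simp add: \<phi>_def \<Psi>one w(2))
    then show "product full_algebra (\<phi> N 1) t = t" "product full_algebra t (\<phi> N 1) = t" for t
      by (simp_all add: full_algebra_def)
    fix k and x :: "nat \<Rightarrow> nat \<Rightarrow> 'a" assume x: "positive_matrix full_algebra k x"
    obtain z where z: "\<And>i j. i < k \<Longrightarrow> j < k \<Longrightarrow> x i j = (\<Sum>l<k. star (z l i) * z l j)"
      using x unfolding positive_matrix_full_algebra by blast
    have "w N * x i j * w N = (\<Sum>l<k. star (z l i * w N) * (z l j * w N))" if "i < k" "j < k" for i j
      using z[OF that] by (simp add: star_mult w(1) sum_distrib_left sum_distrib_right mult.assoc)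
    then have p1: "positive_matrix full_algebra k (\<lambda>i j. w N * x i j * w N)"
      unfolding positive_matrix_full_algebra by (intro exI[of _ "\<lambda>l i. z l i * w N"]) simp
    obtain W where W: "\<And>i j a d. i < k \<Longrightarrow> j < k \<Longrightarrow> a < n \<Longrightarrow> d < n \<Longrightarrow>
        f (x i j) a d = (\<Sum>l<k. \<Sum>t<n. cnj (W l i t a) * W l j t d)"
      using f(5)[OF x] by blast
    \<comment> \<open>For each row index \<open>t\<close> of the factors \<open>W\<close> this gives one positive matrix; \<open>\<Psi> N (x i j)\<close> is the sum over \<open>t\<close>.\<close>
    define v where "v t l i = sqrt lam *\<^sub>R (\<Sum>a<n. W l i t a *\<^sub>C y N a)" for t l i
    define P where "P t i j = (\<Sum>l<k. star (v t l i) * v t l j)" for t i j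
    have vv: "star (v t l i) * v t l j = lam *\<^sub>R (\<Sum>a<n. \<Sum>d<n. (cnj (W l i t a) * W l j t d) *\<^sub>C (star (y N a) * y N d))" for t l i j
      using lam0 by (simp add: v_def star_scaleR star_sum star_scaleC sum_product mult_scaleC_left mult_scaleC_right scaleC_scaleC mult.commute)
    have "\<Psi> N (x i j) = (\<Sum>t<n. P t i j)" if ij: "i < k" "j < k" for i j
    proof -
      have "\<Psi> N (x i j) = lam *\<^sub>R (\<Sum>a<n. \<Sum>d<n. \<Sum>l<k. \<Sum>t<n. (cnj (W l i t a) * W l j t d) *\<^sub>C (star (y N a) * y N d))"
        unfolding \<Psi>_def using ij by (simp add: W complex_vector.scale_sum_left)
      also have "(\<Sum>a<n. \<Sum>d<n. \<Sum>l<k. \<Sum>t<n. (cnj (W l i t a) * W l j t d) *\<^sub>C (star (y N a) * y N d))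
          = (\<Sum>t<n. \<Sum>l<k. \<Sum>a<n. \<Sum>d<n. (cnj (W l i t a) * W l j t d) *\<^sub>C (star (y N a) * y N d))"
        (is "(\<Sum>a<n. \<Sum>d<n. \<Sum>l<k. \<Sum>t<n. ?g a d l t) = _")
      proof -
        have "(\<Sum>a<n. \<Sum>d<n. \<Sum>l<k. \<Sum>t<n. ?g a d l t) = (\<Sum>a<n. \<Sum>d<n. \<Sum>t<n. \<Sum>l<k. ?g a d l t)"
          by (intro sum.cong[OF refl]) (rule sum.swap)
        also have "\<dots> = (\<Sum>a<n. \<Sum>t<n. \<Sum>d<n. \<Sum>l<k. ?g a d l t)"
          by (rule sum.cong[OF refl]) (rule sum.swap)
        also have "\<dots> = (\<Sum>t<n. \<Sum>a<n. \<Sum>d<n. \<Sum>l<k. ?g a d l t)" by (rule sum.swap)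
        also have "\<dots> = (\<Sum>t<n. \<Sum>a<n. \<Sum>l<k. \<Sum>d<n. ?g a d l t)"
          by (rule sum.cong[OF refl], rule sum.cong[OF refl]) (rule sum.swap)
        also have "\<dots> = (\<Sum>t<n. \<Sum>l<k. \<Sum>a<n. \<Sum>d<n. ?g a d l t)"
          by (rule sum.cong[OF refl]) (rule sum.swap)
        finally show ?thesis .
      qed
      also have "lam *\<^sub>R \<dots> = (\<Sum>t<n. P t i j)" by (simp add: P_def vv scaleR_sum_right)
      finally show ?thesis .
    qed
    moreover have "positive_matrix full_algebra k (\<lambda>i j. \<Sum>t<n. P t i j)"
      by (rule positive_matrix_sum) (auto simp: positive_matrix_full_algebra P_def)
    ultimately have "positive_matrix full_algebra k (\<lambda>i j. \<Psi> N (x i j))"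
      unfolding positive_matrix_full_algebra by simp
    from positive_matrix_add[OF p1 this] show "positive_matrix full_algebra k (\<lambda>i j. \<phi> N (x i j))"
      by (simp add: \<phi>_def)
  qed
  \<comment> \<open>The form in which \<open>commutator_bound\<close> applies to \<open>g = 1 - w N\<close>.\<close>
  have cg: "c N = 2 *\<^sub>R (1 - w N) - (1 - w N) * (1 - w N)" for N
    using w(2)[of N] by (simp add: algebra_simps scaleR_2)
  define E where "E N v = \<Psi> N v - c N * v" for N v
  have wvw: "w N * v * w N = v - c N * v + w N * ((1 - w N) * v - v * (1 - w N))" for N v
  proof -
    have "w N * v * w N = (w N * w N) * v + w N * (v * w N - w N * v)" by (simp add: algebra_simps)
    then show ?thesis unfolding w(2) by (simp add: algebra_simps)
  qed
  have conv: "(\<lambda>N. \<phi> N v) \<longlonglongrightarrow> v" if v: "v \<in> S" for v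
  proof -
    have Elim: "(\<lambda>N. E N u) \<longlonglongrightarrow> 0" if u: "u \<in> S" for u
    proof -
      have "E N u = lam *\<^sub>R (\<Sum>a<n. star (y N a) * (r N * T a u))" for N
      proof -
        have "r N * T a u = (\<Sum>d<n. p u a d *\<^sub>C y N d) - y N a * u" for a
          by (simp add: T_def y_def right_diff_distrib sum_distrib_left mult_scaleC_right mult.assoc)
        then show ?thesis
          by (simp add: E_def \<Psi>_def c_def fS[OF u] right_diff_distrib sum_distrib_left sum_distrib_right
              mult_scaleC_right sum_subtractf scaleR_diff_right mult.assoc)
      qed
      moreover have "(\<lambda>N. star (y N a) * (r N * T a u)) \<longlonglongrightarrow> 0" if a: "a < n" for a
      proof (rule Lim_null_comparison)
        show "(\<lambda>N. norm (m a) * norm (r N * T a u)) \<longlonglongrightarrow> 0"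
          using tendsto_mult_right_zero[OF tendsto_norm_zero[OF rT[OF a]]] by blast
        show "eventually (\<lambda>N. norm (star (y N a) * (r N * T a u)) \<le> norm (m a) * norm (r N * T a u)) sequentially"
          by (intro always_eventually allI order_trans[OF norm_mult_ineq] mult_right_mono) (simp_all add: ny)
      qed
      then have "(\<lambda>N. lam *\<^sub>R (\<Sum>a<n. star (y N a) * (r N * T a u))) \<longlonglongrightarrow> lam *\<^sub>R (\<Sum>a<n. 0)"
        by (intro tendsto_intros) auto
      ultimately show ?thesis by simp
    qed
    have vS: "star v \<in> S" using S v by (auto simp: operator_system_def)
    have "star (\<Psi> N (star v)) = \<Psi> N v" for N
    proof -
      have "star (\<Psi> N (star v)) = lam *\<^sub>R (\<Sum>a<n. \<Sum>d<n. p v d a *\<^sub>C (star (y N d) * y N a))"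
        by (simp add: \<Psi>_def fS[OF vS] star_scaleR star_sum star_scaleC star_mult star_star pstar)
      also have "\<dots> = \<Psi> N v" unfolding \<Psi>_def fS[OF v] by (subst sum.swap) (rule refl)
      finally show ?thesis .
    qed
    then have comm: "c N * v - v * c N = star (E N (star v)) - E N v" for N
      by (simp add: E_def star_diff star_mult star_star sc)
    have "(\<lambda>N. star (E N (star v)) - E N v) \<longlonglongrightarrow> star 0 - 0"
      by (intro tendsto_diff bounded_linear.tendsto[OF bounded_linear_star] Elim v vS)
    then have c0: "(\<lambda>N. norm (c N * v - v * c N)) \<longlonglongrightarrow> 0"
      unfolding comm by (intro tendsto_norm_zero) simp
    interpret N: cstar_seminorm "norm :: 'a \<Rightarrow> real" 1 by (rule cstar_seminorm_norm)
    have nw: "norm (w N) \<le> 2" for N using norm_triangle_ineq4[of 1 "1 - w N"] w(3)[of N] by simp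
    have "(\<lambda>N. w N * ((1 - w N) * v - v * (1 - w N))) \<longlonglongrightarrow> 0"
    proof (rule Lim_null_comparison)
      show "(\<lambda>N. 2 * norm (c N * v - v * c N)) \<longlonglongrightarrow> 0"
        using tendsto_mult_right_zero[OF c0] by blast
      show "eventually (\<lambda>N. norm (w N * ((1 - w N) * v - v * (1 - w N))) \<le> 2 * norm (c N * v - v * c N)) sequentially"
        by (intro always_eventually allI order_trans[OF norm_mult_ineq] mult_mono nw
            N.commutator_bound[OF w(3) cg]) auto
    qed
    then have "(\<lambda>N. v + (w N * ((1 - w N) * v - v * (1 - w N)) + E N v)) \<longlonglongrightarrow> v + (0 + 0)"
      by (intro tendsto_intros Elim v)
    moreover have "\<phi> N v = v + (w N * ((1 - w N) * v - v * (1 - w N)) + E N v)" for N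
      by (simp add: \<phi>_def wvw E_def)
    ultimately show ?thesis by simp
  qed
  obtain \<iota> :: "nat \<Rightarrow> 'i" where inj: "inj \<iota>" using inf infinite_countable_subset by blast
  define rr where "rr = {(\<iota> m, \<iota> k) | m k. m \<le> k}"
  note dir = directed_range_nat[OF inj, folded rr_def]
  have net: "((\<lambda>d. norm (\<phi> (inv \<iota> d) x - x)) \<longlongrightarrow> 0) (net_filter (range \<iota>) rr)
      \<longleftrightarrow> (\<lambda>N. norm (\<phi> N x - x)) \<longlonglongrightarrow> 0" for x
    unfolding tendsto_iff dir(2) using inv_f_f[OF inj] by simp
  have "((\<lambda>d. norm (\<phi> (inv \<iota> d) a - id a)) \<longlongrightarrow> 0) (net_filter (range \<iota>) rr)" for a
    using SK dir(1) ucp\<phi> conv net unfolding strong_korovkin_def id_apply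
    by (metis LIM_zero tendsto_norm_zero)
  then have all: "(\<lambda>N. norm (\<phi> N a - a)) \<longlonglongrightarrow> 0" for a using net by simp
  have pc: "p (c N) i j = (if i = j then of_real lam else 0)" if "i < n" "j < n" for N i j
  proof -
    have "(\<Sum>a<n. if i = a \<and> j = a then 1 else 0) = (\<Sum>a<n. if a = i then (if i = j then 1 else 0) else (0::complex))"
      by (intro sum.cong) auto
    then show ?thesis using that by (simp add: c_def pscaleR psum pyy)
  qed
  have p\<Psi>: "p (\<Psi> N a) i j = of_real lam * f a i j" if ij: "i < n" "j < n" for N a i j
  proof -
    have "(\<Sum>d<n. f a k d * (if i = k \<and> j = d then 1 else 0)) = (if k = i then f a i j else 0)" for k
    proof -
      have "(\<Sum>d<n. f a k d * (if i = k \<and> j = d then 1 else 0))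
          = (\<Sum>d<n. if d = j then (if k = i then f a i j else 0) else 0)"
        by (rule sum.cong) auto
      then show ?thesis using ij by simp
    qed
    then have "(\<Sum>k<n. \<Sum>d<n. f a k d * (if i = k \<and> j = d then 1 else 0)) = f a i j" using ij by simp
    moreover have "p (\<Psi> N a) i j = of_real lam * (\<Sum>k<n. \<Sum>d<n. f a k d * (if i = k \<and> j = d then 1 else 0))"
      unfolding \<Psi>_def pscaleR[OF ij] psum[OF ij] pscale[OF ij] pyy[OF ij] ..
    ultimately show ?thesis by simp
  qed
  have "cstar_seminorm (\<lambda>x. norm (\<pi> x)) 1"
    by (rule cstar_seminorm_representation) (use irr in \<open>auto simp: irreducible_representation_def\<close>)
  then interpret Q: cstar_seminorm "\<lambda>x. norm (\<pi> x)" 1 .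
  have p\<phi>: "p (\<phi> N a - a) i j = of_real lam * (f a i j - p a i j)" if ij: "i < n" "j < n" for N a i j
  proof -
    have op: "op_of n e (p x) = \<pi> x" for x
      unfolding p_def by (rule op_of_matrix_of[OF on]) (use rep in \<open>auto simp: unital_representation_def\<close>)
    have cx: "p (c N * x) i j = of_real lam * p x i j" "p (x * c N) i j = of_real lam * p x i j" if "i < n" "j < n" for x i j
    proof -
      have "p (c N * x) i j = (\<Sum>k<n. if k = i then of_real lam * p x i j else 0)"
        unfolding pmult[OF that] using that by (intro sum.cong) (auto simp: pc)
      then show "p (c N * x) i j = of_real lam * p x i j" using that by simp
      have "p (x * c N) i j = (\<Sum>k<n. if k = j then of_real lam * p x i j else 0)"
        unfolding pmult[OF that] using that by (intro sum.cong) (auto simp: pc)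
      then show "p (x * c N) i j = of_real lam * p x i j" using that by simp
    qed
    have "\<pi> (c N * a - a * c N) = 0"
    proof -
      have "op_of n e (p (c N * a - a * c N)) = op_of n e (\<lambda>i j. 0 * 0)"
        by (rule op_of_cong) (simp add: pdiff cx)
      also have "\<dots> = 0" using op_of_scaleC[of n e 0 "\<lambda>i j. 0"] by simp
      finally show ?thesis by (simp add: op)
    qed
    moreover have "norm (\<pi> (1 - w N)) \<le> 1/2"
      using representation_contractive[OF rep, of "1 - w N"] w(3)[of N] by linarith
    ultimately have k0: "\<pi> ((1 - w N) * a - a * (1 - w N)) = 0"
      using Q.commutator_bound[of "1 - w N" "c N" a] cg[of N] by simp
    let ?k = "(1 - w N) * a - a * (1 - w N)"
    have "p ?k i' j' = 0" for i' j' unfolding p_def k0 by (simp add: matrix_of_def)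
    then have "p (w N * ?k) i j = 0" by (simp add: pmult ij)
    then have "p (w N * a * w N) i j = p a i j - of_real lam * p a i j"
      unfolding wvw by (simp add: padd pdiff ij cx)
    then show ?thesis by (simp add: \<phi>_def padd pdiff p\<Psi> ij algebra_simps)
  qed
  show "\<psi> = \<pi>"
  proof
    fix a
    have "f a i j = p a i j" if ij: "i < n" "j < n" for i j
    proof -
      have "lam * cmod (f a i j - p a i j) \<le> 0"
      proof (rule LIMSEQ_le_const[OF all[of a]], intro exI allI impI)
        fix N
        show "lam * cmod (f a i j - p a i j) \<le> norm (\<phi> N a - a)"
          using ple[OF ij, of "\<phi> N a - a"] p\<phi>[OF ij, of N a] lam0 by (simp add: norm_mult)
      qed
      then have "cmod (f a i j - p a i j) \<le> 0" using lam0 by (simp add: mult_le_0_iff)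
      then show ?thesis by simp
    qed
    then have "op_of n e (f a) = op_of n e (p a)" by (intro op_of_cong)
    moreover have "op_of n e (p a) = \<pi> a"
      unfolding p_def by (rule op_of_matrix_of[OF on]) (use rep in \<open>auto simp: unital_representation_def\<close>)
    ultimately show "\<psi> a = \<pi> a" using f(4)[of a] by simp
  qed
qed

section \<open>The equivalence\<close>

theorem corollary3p5:
  fixes S :: "'a::cstar_algebra set"
  assumes "separable_space (euclidean :: 'a topology)"
    and "infinite_cdim TYPE('h::chilbert_space)"
    and "infinite (UNIV :: 'i set)"
    and "homogeneous TYPE('a) TYPE('h)"
    and "operator_system S"
    and "generated_cstar_algebra S = UNIV"
  shows "((\<forall>(L :: 'h set) (\<rho> :: 'a \<Rightarrow> 'h \<Rightarrow>\<^sub>L 'h).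
             irreducible_representation L \<rho> \<longrightarrow> boundary_representation S L \<rho>)
          \<longleftrightarrow> strong_korovkin TYPE('i) full_algebra S (id :: 'a \<Rightarrow> 'a))
       \<and> (strong_korovkin TYPE('i) full_algebra S (id :: 'a \<Rightarrow> 'a)
          \<longleftrightarrow> (\<forall>(L :: 'h set) (\<pi> :: 'a \<Rightarrow> 'h \<Rightarrow>\<^sub>L 'h).
                 unital_representation L \<pi> \<longrightarrow>
                 strong_korovkin TYPE('i) (bounded_operators L) S \<pi>))"
    (is "(?i \<longleftrightarrow> ?ii) \<and> (?ii \<longleftrightarrow> ?iii)")
proof -
  obtain C :: "'a set" where C: "countable C" "closure C = UNIV"
    using assms(1) unfolding separable_space_def by (auto simp: euclidean_closure_of)
  then have "C \<noteq> {}" by auto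
  then obtain s :: "nat \<Rightarrow> 'a" where "range s = C" using C(1) by (metis range_from_nat_into)
  then have dense: "closure (range s) = UNIV" using C(2) by simp
  obtain u :: "nat \<Rightarrow> 'h" where u: "\<And>n. orthonormal n u"
    using infinite_orthonormal_sequence[OF assms(2)] by blast
  obtain n where hom: "\<And>L (\<sigma> :: 'a \<Rightarrow> 'h \<Rightarrow>\<^sub>L 'h). irreducible_representation L \<sigma> \<Longrightarrow> has_cdim L n"
    using assms(4) unfolding homogeneous_def by blast
  have ii: ?ii if ?i
  proof (rule strong_korovkin_of_boundary[OF u dense])
    show "has_cdim L n" if "irreducible_representation L \<sigma>" for L and \<sigma> :: "'a \<Rightarrow> 'h \<Rightarrow>\<^sub>L 'h"
      by (rule hom[OF that])
    show "cstar_seminorm (\<lambda>x. norm (id x :: 'a)) 1" using cstar_seminorm_norm by simp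
    show "clinear (id :: 'a \<Rightarrow> 'a)" by (simp add: clinear_iff)
    show "unique_extension_property S L \<rho>" if "irreducible_representation L \<rho>" for L and \<rho> :: "'a \<Rightarrow> 'h \<Rightarrow>\<^sub>L 'h"
      using \<open>?i\<close> that by (simp add: boundary_representation_def)
  qed (simp_all add: full_algebra_def)
  have iii: ?iii if ?i
  proof (intro allI impI)
    fix L and \<pi> :: "'a \<Rightarrow> 'h \<Rightarrow>\<^sub>L 'h" assume rep: "unital_representation L \<pi>"
    note D = unital_representationD[OF rep]
    show "strong_korovkin TYPE('i) (bounded_operators L) S \<pi>"
    proof (cases "L = {0}")
      case True
      then have \<pi>0: "\<pi> x = 0" for x using D(3)[of x] by (intro blinfun_eqI) simp
      show ?thesis
        unfolding strong_korovkin_def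
      proof (intro allI impI, elim conjE)
        fix D :: "'i set" and r and \<phi> :: "'i \<Rightarrow> 'a \<Rightarrow> 'h \<Rightarrow>\<^sub>L 'h" and a :: 'a
        assume dir: "directed_on D r" and ucp: "\<forall>d\<in>D. ucp (bounded_operators L\<lparr>carrier := range \<pi>\<rparr>) (\<phi> d)"
        have "\<phi> d a = 0" if "d \<in> D" for d
          using ucp that \<pi>0 by (force simp: ucp_def completely_positive_def)
        then have "eventually (\<lambda>d. 0 = norm (\<phi> d a - \<pi> a)) (net_filter D r)"
          unfolding eventually_net_filter[OF dir] using dir \<pi>0 by (auto simp: directed_on_def)
        then show "((\<lambda>d. norm (\<phi> d a - \<pi> a)) \<longlongrightarrow> 0) (net_filter D r)"
          by (rule Lim_transform_eventually[OF tendsto_const])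
      qed
    next
      case False
      show ?thesis
      proof (rule strong_korovkin_of_boundary[OF u dense])
        show "has_cdim L n" if "irreducible_representation L \<sigma>" for L and \<sigma> :: "'a \<Rightarrow> 'h \<Rightarrow>\<^sub>L 'h"
          by (rule hom[OF that])
        show "cstar_seminorm (\<lambda>x. norm (\<pi> x)) 1" by (rule cstar_seminorm_representation[OF rep False])
        show "clinear \<pi>" by (rule D(5))
        show "product (bounded_operators L) (\<pi> x) (\<pi> y) = \<pi> (x * y)" for x y
          by (rule blinfun_eqI) (simp add: bounded_operators_def D(6))
        show "involution (bounded_operators L) (\<pi> x) = \<pi> (star x)" for x
          by (simp add: bounded_operators_def D(7))
        show "unique_extension_property S L \<rho>" if "irreducible_representation L \<rho>" for L and \<rho> :: "'a \<Rightarrow> 'h \<Rightarrow>\<^sub>L 'h"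
          using \<open>?i\<close> that by (simp add: boundary_representation_def)
      qed
    qed
  qed
  have i_ii: ?i if ?ii
  proof (intro allI impI)
    fix L and \<rho> :: "'a \<Rightarrow> 'h \<Rightarrow>\<^sub>L 'h" assume irr: "irreducible_representation L \<rho>"
    then show "boundary_representation S L \<rho>"
      using unique_extension_of_strong_korovkin[OF dense assms(3,5) that irr hom[OF irr]]
      by (simp add: boundary_representation_def)
  qed
  have i_iii: ?i if ?iii
  proof (intro allI impI)
    fix L and \<rho> :: "'a \<Rightarrow> 'h \<Rightarrow>\<^sub>L 'h" assume irr: "irreducible_representation L \<rho>"
    obtain e where e: "orthonormal n e" "cspan (e ` {..<n}) = L"
      by (rule has_cdim_orthonormal_basis[OF hom[OF irr]])
    have ran: "bounded_operators L\<lparr>carrier := range \<rho>\<rparr> = bounded_operators L"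
      unfolding irreducible_range[OF irr e(2)[symmetric] e(1)] by (simp add: bounded_operators_def)
    have SK: "strong_korovkin TYPE('i) (bounded_operators L) S \<rho>"
      using \<open>?iii\<close> irr by (simp add: irreducible_representation_def)
    have "\<psi> = \<rho>" if \<psi>: "ucp (bounded_operators L) \<psi>" "\<forall>v\<in>S. \<psi> v = \<rho> v" for \<psi>
    proof
      fix a
      obtain d :: 'i where True by blast
      have dir: "directed_on {d} {(d, d)}"
        by (auto simp: directed_on_def preorder_on_def refl_on_def trans_def)
      have "((\<lambda>_. norm (\<psi> a - \<rho> a)) \<longlongrightarrow> 0) (net_filter {d} {(d, d)})"
        using SK[unfolded strong_korovkin_def, rule_format, of "{d}" "{(d, d)}" "\<lambda>_. \<psi>" a] dir \<psi> by (simp add: ran)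
      moreover have "net_filter {d} {(d, d)} \<noteq> bot"
        unfolding trivial_limit_def eventually_net_filter[OF dir] by auto
      ultimately have "norm (\<psi> a - \<rho> a) = 0" using tendsto_unique tendsto_const by blast
      then show "\<psi> a = \<rho> a" by simp
    qed
    then show "boundary_representation S L \<rho>"
      using irr by (simp add: boundary_representation_def unique_extension_property_def)
  qed
  show ?thesis using ii iii i_ii i_iii by blast
qed

end
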